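(* Let $p\ge 1$ and $\alpha\ge 0$. The family of operators $(T_{t,p})_{t\in\mathbb{R}}$ defined by $$T_{t,p}f(s)=e^{-t/p}f(e^{-t}s),\qquad s>0,\ f\in\mathcal{T}_p^{(\alpha)}(t^\alpha),$$ is a $C_0$-group of isometries on $\mathcal{T}_p^{(\alpha)}(t^\alpha)$, whose infinitesimal generator $\Lambda$ is given by $(\Lambda f)(s)=-sf'(s)-\frac1p f(s)$ with domain $D(\Lambda)=\mathcal{T}_p^{(\alpha+1)}(t^{\alpha+1})$.
   Context: $\mathcal{S}_+$ denotes the Schwartz class on $[0,\infty)$. For $\alpha>0$ and $f\in\mathcal{S}_+$, the Weyl fractional integral is $W_+^{-\alpha}f(t)=\frac{1}{\Gamma(\alpha)}\int_t^\infty (s-t)^{\alpha-1}f(s)\,ds$ ($t>0$), and the Weyl fractional derivative is $W_+^{\alpha}f(t)=(-1)^n\frac{d^n}{dt^n}W_+^{-(n-\alpha)}f(t)$ with $n=[\alpha]+1$; $W_+^0$ is the identity. For $\alpha>0$ and $1\le p<\infty$, $\mathcal{T}_p^{(\alpha)}(t^\alpha)$ is the Banach space obtained as the completion of $\mathcal{S}_+$ in the norm $\|f\|_{\alpha,p}=\frac{1}{\Gamma(\alpha+1)}\left(\int_0^\infty |W_+^\alpha f(t)|^p t^{\alpha p}\,dt\right)^{1/p}$; by convention $\mathcal{T}_p^{(0)}(t^0)=L^p(\mathbb{R}^+)$ with $\|\cdot\|_{0,p}=\|\cdot\|_p$. These spaces embed continuously into $L^p(\mathbb{R}^+)$, so their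 elements are (a.e. defined) functions on $(0,\infty)$. *)

theory Defs
  imports "HOL-Analysis.Analysis"
begin

text \<open>Functions on the half line are modelled as maps real => complex; only their
values on (0,infinity) matter.\<close>

definition vderiv :: "(real \<Rightarrow> complex) \<Rightarrow> real \<Rightarrow> complex" where
  "vderiv g = (\<lambda>t. vector_derivative g (at t))"

definition schwartz_plus :: "(real \<Rightarrow> complex) \<Rightarrow> bool" where
  "schwartz_plus f \<longleftrightarrow>
     (\<forall>n. \<forall>t>0. ((vderiv ^^ n) f has_vector_derivative (vderiv ^^ Suc n) f t) (at t)) \<and>
     (\<forall>n. \<exists>L. ((vderiv ^^ n) f \<longlongrightarrow> L) (at_right 0)) \<and>
     (\<forall>n m. \<exists>C. \<forall>t>0. t ^ m * norm ((vderiv ^^ n) f t) \<le> C)"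

definition weyl_int :: "real \<Rightarrow> (real \<Rightarrow> complex) \<Rightarrow> real \<Rightarrow> complex" where
  "weyl_int \<beta> f t = complex_of_real (1 / Gamma \<beta>) *
      (LINT s:{t..}|lborel. complex_of_real ((s - t) powr (\<beta> - 1)) * f s)"

definition weyl_deriv :: "real \<Rightarrow> (real \<Rightarrow> complex) \<Rightarrow> real \<Rightarrow> complex" where
  "weyl_deriv \<alpha> f =
     (if \<alpha> = 0 then f
      else (let n = nat \<lfloor>\<alpha>\<rfloor> + 1 in
            (\<lambda>t. (-1) ^ n * (vderiv ^^ n) (weyl_int (real n - \<alpha>) f) t)))"

definition T_norm :: "real \<Rightarrow> real \<Rightarrow> (real \<Rightarrow> complex) \<Rightarrow> real" where
  "T_norm \<alpha> p f = (1 / Gamma (\<alpha> + 1)) *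
     (LINT t:{0<..}|lborel. (norm (weyl_deriv \<alpha> f t) * t powr \<alpha>) powr p) powr (1 / p)"

definition Lp :: "real \<Rightarrow> (real \<Rightarrow> complex) \<Rightarrow> bool" where
  "Lp p f \<longleftrightarrow> set_borel_measurable lborel {0<..} f \<and>
                set_integrable lborel {0<..} (\<lambda>t. norm (f t) powr p)"

definition Lp_norm :: "real \<Rightarrow> (real \<Rightarrow> complex) \<Rightarrow> real" where
  "Lp_norm p f = (LINT t:{0<..}|lborel. norm (f t) powr p) powr (1 / p)"

text \<open>phi is a sequence in the Schwartz class, Cauchy for the norm T_norm alpha p,
and converging to f in L^p (concrete realisation of the completion inside L^p).\<close>
definition T_approx :: "real \<Rightarrow> real \<Rightarrow> (nat \<Rightarrow> real \<Rightarrow> complex) \<Rightarrow> (real \<Rightarrow> complex) \<Rightarrow> bool" where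
  "T_approx \<alpha> p \<phi> f \<longleftrightarrow>
     (\<forall>n. schwartz_plus (\<phi> n)) \<and>
     (\<forall>e>0. \<exists>N. \<forall>m\<ge>N. \<forall>n\<ge>N. T_norm \<alpha> p (\<lambda>s. \<phi> m s - \<phi> n s) < e) \<and>
     ((\<lambda>n. Lp_norm p (\<lambda>s. \<phi> n s - f s)) \<longlonglongrightarrow> 0)"

definition T_space :: "real \<Rightarrow> real \<Rightarrow> (real \<Rightarrow> complex) set" where
  "T_space \<alpha> p =
     (if \<alpha> = 0 then {f. Lp p f} else {f. Lp p f \<and> (\<exists>\<phi>. T_approx \<alpha> p \<phi> f)})"

definition T_space_norm :: "real \<Rightarrow> real \<Rightarrow> (real \<Rightarrow> complex) \<Rightarrow> real" where
  "T_space_norm \<alpha> p f =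
     (if \<alpha> = 0 then Lp_norm p f
      else lim (\<lambda>n. T_norm \<alpha> p ((SOME \<phi>. T_approx \<alpha> p \<phi> f) n)))"

definition T_grp :: "real \<Rightarrow> real \<Rightarrow> (real \<Rightarrow> complex) \<Rightarrow> real \<Rightarrow> complex" where
  "T_grp p t f = (\<lambda>s. complex_of_real (exp (- t / p)) * f (exp (- t) * s))"

definition is_generator_value :: "real \<Rightarrow> real \<Rightarrow> (real \<Rightarrow> complex) \<Rightarrow> (real \<Rightarrow> complex) \<Rightarrow> bool" where
  "is_generator_value \<alpha> p f g \<longleftrightarrow> g \<in> T_space \<alpha> p \<and>
     ((\<lambda>t. T_space_norm \<alpha> p (\<lambda>s. (T_grp p t f s - f s) / complex_of_real t - g s)) \<longlongrightarrow> 0) (at 0)"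

definition test_fun :: "(real \<Rightarrow> complex) \<Rightarrow> bool" where
  "test_fun \<psi> \<longleftrightarrow>
     (\<forall>n t. ((vderiv ^^ n) \<psi> has_vector_derivative (vderiv ^^ Suc n) \<psi> t) (at t)) \<and>
     (\<exists>a b. 0 < a \<and> a \<le> b \<and> (\<forall>s. s \<notin> {a..b} \<longrightarrow> \<psi> s = 0))"

end

theory Submission
  imports Defs
begin

text \<open>On \<open>L\<^sup>p\<close> of the half-line, the dilation group has the resolvents
  \<open>R\<^sub>\<mu> = (\<Lambda> + 1/p + \<mu>)\<^bsup>-1\<^esup>\<close>, \<open>R\<^sub>\<mu> K (t) = t\<^sup>\<mu> \<integral>\<^sub>t\<^sup>\<infinity> s\<^bsup>-\<mu>-1\<^esup> K(s) ds\<close>. For a Schwartz function \<open>\<phi>\<close> put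
  \<open>G\<^sub>\<alpha> \<phi> = t\<^sup>\<alpha> W\<^sup>\<alpha> \<phi>\<close>. Then \<open>G\<^sub>\<alpha> \<phi> = R\<^sub>\<alpha> (G\<^bsub>\<alpha>+1\<^esub> \<phi>)\<close>, and for \<open>0 < \<alpha> < 1\<close> the function \<open>\<phi>\<close> is recovered
  from \<open>G\<^sub>\<alpha> \<phi>\<close> by a fractional integral. Hence \<open>\<phi> = H\<^sub>\<alpha> (G\<^sub>\<alpha> \<phi>)\<close> with a bounded injective operator
  \<open>H\<^sub>\<alpha>\<close> on \<open>L\<^sup>p\<close> that commutes with dilations, being built from kernels homogeneous of degree \<open>-1\<close>,
  and \<open>H\<^bsub>\<alpha>+1\<^esub> = H\<^sub>\<alpha> R\<^sub>\<alpha>\<close>. The functions \<open>G\<^sub>\<alpha> \<phi>\<close> are dense in \<open>L\<^sup>p\<close>, because they include all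
  \<open>t\<^sup>\<alpha> e\<^bsup>-kt\<^esup>\<close> with \<open>k \<ge> 1\<close>. So the space of order \<open>\<alpha>\<close> is isometric, up to a constant factor, to \<open>L\<^sup>p\<close> via \<open>H\<^sub>\<alpha>\<close>. The
  group properties transfer from \<open>L\<^sup>p\<close>, and the domain of the generator is
  \<open>H\<^sub>\<alpha> R\<^sub>\<alpha> L\<^sup>p\<close>, the space of order \<open>\<alpha> + 1\<close>.\<close>

section \<open>Lebesgue spaces over a measure space\<close>

text \<open>The norm of the completion is computed from an arbitrarily chosen approximating
  sequence, so it is well defined only if the limit \<open>G\<close> of the functions
  \<open>weyl_G \<alpha> (\<phi> n)\<close> is determined by \<open>f\<close>. The crux is therefore
  that the representing operator is injective, not merely bounded. For a resolvent this comes from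
  the generator itself: if \<open>kop (res_ker \<mu>) K\<close> vanishes, so do its difference
  quotients, yet they converge to \<open>K\<close>. The fractional factor commutes with a second
  kernel operator, and the product of the two is a Beta value times the resolvent with
  \<open>\<mu> = 0\<close>, so injectivity is inherited. Orders above 1 require no composition rule
  for Weyl derivatives: raising the order by one amounts to a single integration, and only orders in
  \<open>[0, 1)\<close> are treated by hand. In the formula for the generator the derivative is
  meant weakly, against test functions supported away from 0. Since the representing operator is
  bounded, this formula only has to be shown in \<open>L^p\<close>.\<close>

definition lp_fun :: "'a measure \<Rightarrow> real \<Rightarrow> ('a \<Rightarrow> complex) \<Rightarrow> bool" where
  "lp_fun M p f \<longleftrightarrow> f \<in> borel_measurable M \<and> integrable M (\<lambda>x. norm (f x) powr p)"

definition lp_norm :: "'a measure \<Rightarrow> real \<Rightarrow> ('a \<Rightarrow> complex) \<Rightarrow> real" where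
  "lp_norm M p f = (\<integral>x. norm (f x) powr p \<partial>M) powr (1 / p)"

lemma lp_fun_integrable: "lp_fun M p f \<Longrightarrow> integrable M (\<lambda>x. norm (f x) powr p)"
  by (simp add: lp_fun_def)

lemma lp_norm_nonneg [simp]: "0 \<le> lp_norm M p f"
  by (simp add: lp_norm_def)

lemma lp_norm_powr:
  assumes "p \<ge> 1"
  shows "lp_norm M p f powr p = (\<integral>x. norm (f x) powr p \<partial>M)"
  using assms by (simp add: lp_norm_def powr_powr Bochner_Integration.integral_nonneg)

lemma lp_norm_leI:
  assumes "p \<ge> 1" "0 \<le> c" "(\<integral>x. norm (f x) powr p \<partial>M) \<le> c powr p"
  shows "lp_norm M p f \<le> c"
proof -
  have "lp_norm M p f \<le> (c powr p) powr (1 / p)"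
    unfolding lp_norm_def using assms by (intro powr_mono2) auto
  then show ?thesis using assms by (simp add: powr_powr)
qed

text \<open>Convexity enters here: the graph of \<open>x powr p\<close> lies above its tangents.
  Taking the tangent at a mean value yields both the two-point inequality behind the triangle
  inequality and Jensen's inequality.\<close>

lemma powr_tangent_le:
  fixes x c p :: real
  assumes "p \<ge> 1" "x \<ge> 0" "c \<ge> 0"
  shows "c powr p + p * c powr (p - 1) * (x - c) \<le> x powr p"
\<comment> \<open>At \<open>c = 0\<close> both terms on the left vanish, also for
  \<open>p = 1\<close>, because \<open>0 powr 0 = 0\<close>.\<close>
proof (cases "c = 0 \<or> x = 0")
  case True
  then show ?thesis
  proof
    assume "c = 0" then show ?thesis using assms by auto
  next
    assume "x = 0"
    moreover have "c powr p = c powr (p - 1) * c"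
      using assms by (cases "c = 0") (auto simp: powr_diff)
    ultimately show ?thesis using assms
      by (auto simp: algebra_simps mult_le_cancel_right1 intro!: mult_right_mono)
        (metis mult_left_mono mult_1 powr_ge_zero mult.commute)
  qed
next
  case False
  then have pos: "c > 0" "x > 0" using assms by auto
  define y where "y = x / c"
  have y: "y > 0" using pos by (simp add: y_def)
  \<comment> \<open>Young's inequality with exponents \<open>1 / p\<close> and
    \<open>1 - 1 / p\<close> for the numbers \<open>y powr p\<close> and 1 is Bernoulli's inequality
    for \<open>y = x / c\<close>.\<close>
  have "(y powr p) powr (1 / p) * 1 powr (1 - 1 / p) \<le> (1 / p) * (y powr p) + (1 - 1 / p) * 1"
    using assms y by (intro Youngs_inequality_0) auto
  then have "y \<le> (1 / p) * (y powr p) + (1 - 1 / p)"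
    using assms y by (simp add: powr_powr)
  then have "p * y \<le> p * ((1 / p) * (y powr p) + (1 - 1 / p))"
    using assms by (intro mult_left_mono) auto
  then have "1 + p * (y - 1) \<le> y powr p"
    using assms by (simp add: algebra_simps)
  then have "c powr p * (1 + p * (y - 1)) \<le> c powr p * y powr p"
    by (intro mult_left_mono) auto
  also have "c powr p * y powr p = x powr p"
    using pos by (simp add: y_def powr_divide)
  also have "c powr p * (1 + p * (y - 1)) = c powr p + p * c powr (p - 1) * (x - c)"
    using pos by (simp add: y_def powr_diff field_simps)
  finally show ?thesis .
qed

text \<open>Average the tangent inequalities at the mean \<open>c\<close> with weights
  \<open>a\<close> and \<open>b\<close>; the linear terms cancel.\<close>

lemma powr_convex_comb:
  fixes x y a b p :: real
  assumes "p \<ge> 1" "x \<ge> 0" "y \<ge> 0" "a \<ge> 0" "b \<ge> 0" "a + b = 1"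
  shows "(a * x + b * y) powr p \<le> a * x powr p + b * y powr p"
proof -
  define c where "c = a * x + b * y"
  have c: "c \<ge> 0" using assms by (simp add: c_def)
  have "a * (c powr p + p * c powr (p - 1) * (x - c)) \<le> a * x powr p"
       "b * (c powr p + p * c powr (p - 1) * (y - c)) \<le> b * y powr p"
    using assms c by (auto intro!: mult_left_mono powr_tangent_le)
  then have "a * (c powr p + p * c powr (p - 1) * (x - c)) + b * (c powr p + p * c powr (p - 1) * (y - c))
      \<le> a * x powr p + b * y powr p" by simp
  also have "a * (c powr p + p * c powr (p - 1) * (x - c)) + b * (c powr p + p * c powr (p - 1) * (y - c))
      = (a + b) * c powr p + p * c powr (p - 1) * (a * x + b * y - (a + b) * c)"
    by (simp add: algebra_simps)
  also have "\<dots> = c powr p" using assms by (simp add: c_def)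
  finally show ?thesis by (simp add: c_def)
qed

text \<open>A crude bound that serves to show that sums stay in the space, before the norm
  inequality is available.\<close>

lemma powr_add_le:
  fixes x y p :: real
  assumes "p \<ge> 1" "x \<ge> 0" "y \<ge> 0"
  shows "(x + y) powr p \<le> 2 powr p * (x powr p + y powr p)"
proof -
  have "(x + y) powr p \<le> (2 * max x y) powr p"
    using assms by (intro powr_mono2) auto
  also have "\<dots> = 2 powr p * max x y powr p" using assms by (simp add: powr_mult)
  also have "\<dots> \<le> 2 powr p * (x powr p + y powr p)"
    by (intro mult_left_mono) (auto simp: max_def)
  finally show ?thesis .
qed

lemma lp_fun_cmult: 
  assumes "lp_fun M p f" shows "lp_fun M p (\<lambda>x. c * f x)"
  using assms by (auto simp: lp_fun_def norm_mult powr_mult)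

lemma lp_norm_cmult: 
  assumes "p \<ge> 1"
  shows "lp_norm M p (\<lambda>x. c * f x) = norm c * lp_norm M p f"
  using assms by (simp add: lp_norm_def norm_mult powr_mult powr_powr Bochner_Integration.integral_nonneg)

lemma lp_fun_bound:
  assumes "p \<ge> 1" "lp_fun M p g" "f \<in> borel_measurable M" "AE x in M. norm (f x) \<le> norm (g x)"
  shows "lp_fun M p f" "lp_norm M p f \<le> lp_norm M p g"
proof -
  have ae: "AE x in M. norm (f x) powr p \<le> norm (g x) powr p"
    using assms(4) by eventually_elim (use assms(1) in \<open>auto intro: powr_mono2\<close>)
  have *: "integrable M (\<lambda>x. norm (f x) powr p)"
    by (rule Bochner_Integration.integrable_bound[OF lp_fun_integrable[OF assms(2)]])
      (use assms ae in auto)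
  then show "lp_fun M p f" using assms by (simp add: lp_fun_def)
  show "lp_norm M p f \<le> lp_norm M p g"
    unfolding lp_norm_def using assms
    by (intro powr_mono2 integral_mono_AE * lp_fun_integrable ae) (auto intro: Bochner_Integration.integral_nonneg)
qed

lemma lp_fun_add:
  assumes "p \<ge> 1" "lp_fun M p f" "lp_fun M p g"
  shows "lp_fun M p (\<lambda>x. f x + g x)"
proof -
  have [measurable]: "f \<in> borel_measurable M" "g \<in> borel_measurable M"
    using assms by (auto simp: lp_fun_def)
  have "integrable M (\<lambda>x. norm (f x + g x) powr p)"
  proof (rule Bochner_Integration.integrable_bound)
    show "integrable M (\<lambda>x. 2 powr p * (norm (f x) powr p + norm (g x) powr p))"
      using assms by (auto simp: lp_fun_def)
    have "norm (f x + g x) powr p \<le> 2 powr p * (norm (f x) powr p + norm (g x) powr p)" for x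
      using powr_add_le[OF assms(1), of "norm (f x)" "norm (g x)"] powr_mono2[of p "norm (f x + g x)" "norm (f x) + norm (g x)"]
        assms(1) norm_triangle_ineq[of "f x" "g x"] by auto
    then show "AE x in M. norm (norm (f x + g x) powr p) \<le> norm (2 powr p * (norm (f x) powr p + norm (g x) powr p))"
      by simp
  qed measurable
  then show ?thesis by (simp add: lp_fun_def)
qed

lemma lp_fun_diff:
  assumes "p \<ge> 1" "lp_fun M p f" "lp_fun M p g"
  shows "lp_fun M p (\<lambda>x. f x - g x)"
  using lp_fun_add[OF assms(1,2) lp_fun_cmult[OF assms(3), of "-1"]] by simp

lemma lp_norm_cong_AE:
  assumes "f \<in> borel_measurable M" "g \<in> borel_measurable M" "AE x in M. f x = g x"
  shows "lp_norm M p f = lp_norm M p g"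
proof -
  have "(\<integral>x. norm (f x) powr p \<partial>M) = (\<integral>x. norm (g x) powr p \<partial>M)"
    by (rule integral_cong_AE) (use assms in auto)
  then show ?thesis by (simp add: lp_norm_def)
qed

lemma lp_norm_eq_0_iff:
  assumes "p \<ge> 1" "lp_fun M p f"
  shows "lp_norm M p f = 0 \<longleftrightarrow> (AE x in M. f x = 0)"
  using assms integral_nonneg_eq_0_iff_AE[OF lp_fun_integrable[OF assms(2)]]
  by (simp add: lp_norm_def)

text \<open>Convexity is used directly instead of Hoelder's inequality: with slightly enlarged norms
  \<open>a\<close> and \<open>b\<close>, the function \<open>(f + g) / (a + b)\<close> is a convex
  combination of \<open>f / a\<close> and \<open>g / b\<close> with weights
  \<open>a / (a + b)\<close> and \<open>b / (a + b)\<close>.\<close>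

lemma lp_norm_triangle:
  assumes p: "p \<ge> 1" and f: "lp_fun M p f" and g: "lp_fun M p g"
  shows "lp_norm M p (\<lambda>x. f x + g x) \<le> lp_norm M p f + lp_norm M p g"
proof (rule field_le_epsilon)
  fix e :: real assume "e > 0"
  \<comment> \<open>The \<open>e / 2\<close> keeps \<open>a\<close> and \<open>b\<close> positive
    when a norm is zero, so that the divisions are legitimate.\<close>
  define a where "a = lp_norm M p f + e / 2"
  define b where "b = lp_norm M p g + e / 2"
  have ab: "a > 0" "b > 0" "lp_norm M p f \<le> a" "lp_norm M p g \<le> b"
    using \<open>e > 0\<close> by (auto simp: a_def b_def add_nonneg_pos)
  have If: "(\<integral>x. norm (f x) powr p \<partial>M) \<le> a powr p"
    using lp_norm_powr[OF p, of M f] powr_mono2[of p "lp_norm M p f" a] ab p by simp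
  have Ig: "(\<integral>x. norm (g x) powr p \<partial>M) \<le> b powr p"
    using lp_norm_powr[OF p, of M g] powr_mono2[of p "lp_norm M p g" b] ab p by simp
  define A where "A = (a + b) powr p * (a / (a + b)) / a powr p"
  define B where "B = (a + b) powr p * (b / (a + b)) / b powr p"
  have le: "norm (f x + g x) powr p \<le> A * norm (f x) powr p + B * norm (g x) powr p" for x
  proof -
    have "norm (f x + g x) powr p \<le> (norm (f x) + norm (g x)) powr p"
      using p by (intro powr_mono2 norm_triangle_ineq) auto
    also have "norm (f x) + norm (g x) = (a + b) * (a / (a + b) * (norm (f x) / a) + b / (a + b) * (norm (g x) / b))"
      using ab by (simp add: distrib_left add_pos_pos[THEN less_imp_neq, THEN not_sym])
    also have "\<dots> powr p = (a + b) powr p * (a / (a + b) * (norm (f x) / a) + b / (a + b) * (norm (g x) / b)) powr p"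
      using ab by (subst powr_mult) auto
    also have "\<dots> \<le> (a + b) powr p * (a / (a + b) * (norm (f x) / a) powr p + b / (a + b) * (norm (g x) / b) powr p)"
      using ab p by (intro mult_left_mono powr_convex_comb) (auto simp: add_divide_distrib[symmetric])
    also have "\<dots> = A * norm (f x) powr p + B * norm (g x) powr p"
      using ab by (simp add: A_def B_def powr_divide algebra_simps)
    finally show ?thesis .
  qed
  have "(\<integral>x. norm (f x + g x) powr p \<partial>M) \<le> (\<integral>x. A * norm (f x) powr p + B * norm (g x) powr p \<partial>M)"
    using le lp_fun_integrable[OF lp_fun_add[OF p f g]] lp_fun_integrable[OF f] lp_fun_integrable[OF g]
    by (intro integral_mono) auto
  also have "\<dots> = A * (\<integral>x. norm (f x) powr p \<partial>M) + B * (\<integral>x. norm (g x) powr p \<partial>M)"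
    using lp_fun_integrable[OF f] lp_fun_integrable[OF g] by simp
  also have "\<dots> \<le> A * a powr p + B * b powr p"
    using If Ig ab by (intro add_mono mult_left_mono) (auto simp: A_def B_def)
  also have "\<dots> = (a + b) powr p * (a / (a + b) + b / (a + b))"
    using ab unfolding A_def B_def distrib_left by simp
  also have "\<dots> = (a + b) powr p"
    using ab by (simp add: add_divide_distrib[symmetric])
  finally have "lp_norm M p (\<lambda>x. f x + g x) \<le> a + b"
    using p ab by (intro lp_norm_leI) auto
  then show "lp_norm M p (\<lambda>x. f x + g x) \<le> lp_norm M p f + lp_norm M p g + e"
    by (simp add: a_def b_def)
qed

lemma lp_norm_triangle_diff:
  assumes p: "p \<ge> 1" and f: "lp_fun M p f" and g: "lp_fun M p g"
  shows "lp_norm M p (\<lambda>x. f x - g x) \<le> lp_norm M p f + lp_norm M p g"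
  using lp_norm_triangle[OF p f lp_fun_cmult[OF g, of "-1"]] lp_norm_cmult[OF p, of M "-1" g] by simp

lemma lp_norm_minus_commute:
  "lp_norm M p (\<lambda>x. f x - g x) = lp_norm M p (\<lambda>x. g x - f x)"
  by (simp add: lp_norm_def norm_minus_commute)

lemma lp_norm_triangle3:
  assumes p: "p \<ge> 1" and f: "lp_fun M p f" and g: "lp_fun M p g" and h: "lp_fun M p h"
  shows "lp_norm M p (\<lambda>x. f x - h x) \<le> lp_norm M p (\<lambda>x. f x - g x) + lp_norm M p (\<lambda>x. g x - h x)"
  using lp_norm_triangle[OF p lp_fun_diff[OF p f g] lp_fun_diff[OF p g h]] by simp

lemma lp_norm_abs_diff:
  assumes p: "p \<ge> 1" and f: "lp_fun M p f" and g: "lp_fun M p g"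
  shows "\<bar>lp_norm M p f - lp_norm M p g\<bar> \<le> lp_norm M p (\<lambda>x. f x - g x)"
proof -
  have "lp_norm M p f \<le> lp_norm M p (\<lambda>x. f x - g x) + lp_norm M p g"
    using lp_norm_triangle[OF p lp_fun_diff[OF p f g] g] by simp
  moreover have "lp_norm M p g \<le> lp_norm M p (\<lambda>x. g x - f x) + lp_norm M p f"
    using lp_norm_triangle[OF p lp_fun_diff[OF p g f] f] by simp
  ultimately show ?thesis by (simp add: lp_norm_minus_commute[of M p f g])
qed

section \<open>Convergence theorems and completeness\<close>

lemma lp_dominated_convergence:
  assumes p: "p \<ge> 1" and g: "lp_fun M p g" and f: "f \<in> borel_measurable M"
    and s: "\<And>i. s i \<in> borel_measurable M"
    and lim: "AE x in M. (\<lambda>i. s i x) \<longlonglongrightarrow> f x"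
    and bound: "\<And>i. AE x in M. norm (s i x) \<le> norm (g x)"
  shows "lp_fun M p f" "(\<lambda>i. lp_norm M p (\<lambda>x. s i x - f x)) \<longlonglongrightarrow> 0"
proof -
  have "AE x in M. \<forall>i. norm (s i x) \<le> norm (g x)"
    using bound by (simp add: AE_all_countable)
  then have fb: "AE x in M. norm (f x) \<le> norm (g x)"
    using lim by eventually_elim (rule Lim_bounded[OF tendsto_norm, of _ _ 0], auto)
  show "lp_fun M p f" by (rule lp_fun_bound[OF p g f fb])
  have "(\<lambda>i. \<integral>x. norm (s i x - f x) powr p \<partial>M) \<longlonglongrightarrow> (\<integral>x. 0 \<partial>M)"
  proof (rule integral_dominated_convergence[where w="\<lambda>x. norm (2 * g x) powr p"])
    show "integrable M (\<lambda>x. norm (2 * g x) powr p)"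
      by (intro lp_fun_integrable lp_fun_cmult g)
    show "AE x in M. (\<lambda>i. norm (s i x - f x) powr p) \<longlonglongrightarrow> 0"
      using lim
    proof eventually_elim
      case (elim x)
      have "(\<lambda>i. norm (s i x - f x)) \<longlonglongrightarrow> 0"
        using elim by (simp add: LIM_zero tendsto_norm_zero)
      moreover have "0 powr p = (0::real)" "p > 0" using p by auto
      ultimately show ?case
        by (metis tendsto_powr'[OF _ tendsto_const] norm_ge_zero always_eventually)
    qed
    show "AE x in M. norm (norm (s i x - f x) powr p) \<le> norm (2 * g x) powr p" for i
      using bound[of i] fb
    proof eventually_elim
      case (elim x)
      then have "norm (s i x - f x) \<le> norm (2 * g x)"
        using norm_triangle_ineq4[of "s i x" "f x"] by (simp add: norm_mult)
      then show ?case using p by (auto intro: powr_mono2)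
    qed
  qed (use s f in auto)
  then have *: "(\<lambda>i. \<integral>x. norm (s i x - f x) powr p \<partial>M) \<longlonglongrightarrow> 0" by simp
  have "(\<lambda>i. (\<integral>x. norm (s i x - f x) powr p \<partial>M) powr (1/p)) \<longlonglongrightarrow> 0 powr (1/p)"
    by (rule tendsto_powr'[OF * tendsto_const])
      (use p in \<open>auto intro!: Bochner_Integration.integral_nonneg always_eventually\<close>)
  then show "(\<lambda>i. lp_norm M p (\<lambda>x. s i x - f x)) \<longlonglongrightarrow> 0"
    by (simp add: lp_norm_def)
qed

lemma lp_norm_sum_le:
  assumes p: "p \<ge> 1" and f: "\<And>i. i \<in> I \<Longrightarrow> lp_fun M p (f i)" and "finite I"
  shows "lp_fun M p (\<lambda>x. \<Sum>i\<in>I. f i x) \<and> lp_norm M p (\<lambda>x. \<Sum>i\<in>I. f i x) \<le> (\<Sum>i\<in>I. lp_norm M p (f i))"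
  using assms(3) f
proof (induction I rule: finite_induct)
  case empty
  then show ?case using p by (simp add: lp_fun_def lp_norm_def)
next
  case (insert i I)
  then show ?case
    using lp_norm_triangle[OF p, of M "f i" "\<lambda>x. \<Sum>i\<in>I. f i x"] lp_fun_add[OF p, of M "f i" "\<lambda>x. \<Sum>i\<in>I. f i x"]
    by auto
qed

text \<open>Fatou's lemma for the p-th powers. The bound is required only eventually, which suits a
  tail of a Cauchy sequence.\<close>

lemma lp_fatou:
  assumes p: "p \<ge> 1" and s: "\<And>i. lp_fun M p (s i)" and f: "f \<in> borel_measurable M"
    and lim: "AE x in M. (\<lambda>i. s i x) \<longlonglongrightarrow> f x"
    and c: "c \<ge> 0" and bound: "eventually (\<lambda>i. lp_norm M p (s i) \<le> c) sequentially"
  shows "lp_fun M p f \<and> lp_norm M p f \<le> c"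
proof -
  have [measurable]: "s i \<in> borel_measurable M" for i using s by (simp add: lp_fun_def)
  have "(\<integral>\<^sup>+x. ennreal (norm (f x) powr p) \<partial>M) = (\<integral>\<^sup>+x. liminf (\<lambda>i. ennreal (norm (s i x) powr p)) \<partial>M)"
  proof (rule nn_integral_cong_AE)
    show "AE x in M. ennreal (norm (f x) powr p) = liminf (\<lambda>i. ennreal (norm (s i x) powr p))"
      using lim
    proof eventually_elim
      case (elim x)
      have "(\<lambda>i. norm (s i x) powr p) \<longlonglongrightarrow> norm (f x) powr p"
        using tendsto_powr'[OF tendsto_norm[OF elim] tendsto_const, of p] p by auto
      then have "(\<lambda>i. ennreal (norm (s i x) powr p)) \<longlonglongrightarrow> ennreal (norm (f x) powr p)"
        by (rule tendsto_ennrealI)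
      from lim_imp_Liminf[OF _ this] show ?case by simp
    qed
  qed
  also have "\<dots> \<le> liminf (\<lambda>i. \<integral>\<^sup>+x. ennreal (norm (s i x) powr p) \<partial>M)"
    by (rule nn_integral_liminf) measurable
  also have "\<dots> \<le> ennreal (c powr p)"
  proof (rule Liminf_le[OF sequentially_bot])
    show "\<forall>\<^sub>F i in sequentially. (\<integral>\<^sup>+x. ennreal (norm (s i x) powr p) \<partial>M) \<le> ennreal (c powr p)"
      using bound
    proof eventually_elim
      case (elim i)
      have "(\<integral>\<^sup>+x. ennreal (norm (s i x) powr p) \<partial>M) = ennreal (\<integral>x. norm (s i x) powr p \<partial>M)"
        by (rule nn_integral_eq_integral[OF lp_fun_integrable[OF s]]) auto
      also have "(\<integral>x. norm (s i x) powr p \<partial>M) \<le> c powr p"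
        unfolding lp_norm_powr[OF p, symmetric] using elim p by (intro powr_mono2) auto
      finally show ?case by (simp add: ennreal_leI)
    qed
  qed
  finally have le: "(\<integral>\<^sup>+x. ennreal (norm (f x) powr p) \<partial>M) \<le> ennreal (c powr p)" .
  have int: "integrable M (\<lambda>x. norm (f x) powr p)"
    using f le by (intro integrableI_nonneg) (auto simp: top_unique less_top[symmetric])
  have "ennreal (\<integral>x. norm (f x) powr p \<partial>M) \<le> ennreal (c powr p)"
    using le by (subst (asm) nn_integral_eq_integral[OF int]) auto
  then have "(\<integral>x. norm (f x) powr p \<partial>M) \<le> c powr p" by simp
  then show ?thesis
    using int f p c by (auto simp: lp_fun_def intro: lp_norm_leI)
qed

text \<open>Riesz-Fischer: along a fast subsequence the increments are absolutely summable almost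
  everywhere, which gives a pointwise limit; Fatou's lemma turns the Cauchy bounds into bounds for
  the distance to it.\<close>

lemma lp_complete:
  assumes p: "p \<ge> 1" and s: "\<And>i. lp_fun M p (s i)"
    and cauchy: "\<And>e. e > 0 \<Longrightarrow> \<exists>N. \<forall>m\<ge>N. \<forall>n\<ge>N. lp_norm M p (\<lambda>x. s m x - s n x) < e"
  obtains f where "lp_fun M p f" "(\<lambda>i. lp_norm M p (\<lambda>x. s i x - f x)) \<longlonglongrightarrow> 0"
proof -
  obtain K where K: "\<And>k m n. m \<ge> K k \<Longrightarrow> n \<ge> K k \<Longrightarrow> lp_norm M p (\<lambda>x. s m x - s n x) < (1/2)^k" for k :: nat
    using cauchy[of "(1/2)^k" for k :: nat] by (metis half_gt_zero zero_less_one zero_less_power)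
  \<comment> \<open>The recursion makes \<open>r\<close> strictly increasing and keeps
    \<open>r k\<close> above the threshold \<open>K k\<close>.\<close>
  define r where "r = rec_nat (K 0) (\<lambda>k j. max (K (Suc k)) (Suc j))"
  have r0: "r 0 = K 0" and rS: "r (Suc k) = max (K (Suc k)) (Suc (r k))" for k
    by (simp_all add: r_def)
  have rK: "r k \<ge> K k" for k by (cases k) (auto simp: r0 rS)
  have mono: "strict_mono r" by (rule strict_mono_Suc_iff[THEN iffD2]) (auto simp: rS)
  define d where "d k x = s (r (Suc k)) x - s (r k) x" for k x
  have d: "lp_fun M p (d k)" for k unfolding d_def by (intro lp_fun_diff p s)
  have [measurable]: "d k \<in> borel_measurable M" "s k \<in> borel_measurable M" for k
    using d s by (auto simp: lp_fun_def)
  have dn: "lp_norm M p (d k) \<le> (1/2)^k" for k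
    unfolding d_def using K[of k "r (Suc k)" "r k"] rK[of k] mono
    by (metis less_imp_le order.trans strict_mono_less_eq le_SucI order_refl)
  \<comment> \<open>The partial sums of the moduli are made complex-valued so that the norm lemmas
    apply; their norms stay below the geometric sum 2.\<close>
  define g where "g n x = (\<Sum>k<n. complex_of_real (norm (d k x)))" for n x
  have lpd: "lp_fun M p (\<lambda>x. complex_of_real (norm (d k x)))" "lp_norm M p (\<lambda>x. complex_of_real (norm (d k x))) = lp_norm M p (d k)" for k
    using d[of k] by (auto simp: lp_fun_def lp_norm_def)
  have lpg: "lp_fun M p (g n)" "lp_norm M p (g n) \<le> 2" for n
  proof -
    have *: "lp_fun M p (g n) \<and> lp_norm M p (g n) \<le> (\<Sum>k<n. lp_norm M p (\<lambda>x. complex_of_real (norm (d k x))))"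
      unfolding g_def by (rule lp_norm_sum_le) (use p lpd in auto)
    then show "lp_fun M p (g n)" by simp
    have "(\<Sum>k<n. lp_norm M p (d k)) \<le> (\<Sum>k<n. (1/2)^k)" by (intro sum_mono dn)
    also have "\<dots> \<le> 2" by (simp add: sum_gp_strict)
    finally show "lp_norm M p (g n) \<le> 2" using * lpd by simp
  qed
  have [measurable]: "g n \<in> borel_measurable M" for n using lpg by (simp add: lp_fun_def)
  have norm_g: "norm (g n x) = (\<Sum>k<n. norm (d k x))" for n x
    unfolding g_def of_real_sum[symmetric] norm_of_real by (simp add: sum_nonneg)
  have conv: "AE x in M. convergent (\<lambda>n. s (r n) x)"
  proof -
    have "(\<integral>\<^sup>+x. (SUP n. ennreal (norm (g n x) powr p)) \<partial>M) = (SUP n. \<integral>\<^sup>+x. ennreal (norm (g n x) powr p) \<partial>M)"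
    proof (rule nn_integral_monotone_convergence_SUP)
      show "incseq (\<lambda>n x. ennreal (norm (g n x) powr p))"
        using p unfolding norm_g
        by (intro incseq_SucI le_funI ennreal_leI powr_mono2) (auto intro: sum_nonneg)
    qed (use lpg in \<open>auto simp: lp_fun_def\<close>)
    also have "\<dots> \<le> ennreal (2 powr p)"
    proof (rule SUP_least)
      fix n
      have "(\<integral>\<^sup>+x. ennreal (norm (g n x) powr p) \<partial>M) = ennreal (\<integral>x. norm (g n x) powr p \<partial>M)"
        by (rule nn_integral_eq_integral[OF lp_fun_integrable[OF lpg(1)]]) auto
      also have "(\<integral>x. norm (g n x) powr p \<partial>M) \<le> 2 powr p"
        unfolding lp_norm_powr[OF p, symmetric] using lpg p by (intro powr_mono2) auto
      finally show "(\<integral>\<^sup>+x. ennreal (norm (g n x) powr p) \<partial>M) \<le> ennreal (2 powr p)" by (simp add: ennreal_leI)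
    qed
    finally have "(\<integral>\<^sup>+x. (SUP n. ennreal (norm (g n x) powr p)) \<partial>M) \<noteq> \<infinity>"
      by (auto simp: top_unique)
    then have "AE x in M. (SUP n. ennreal (norm (g n x) powr p)) \<noteq> \<infinity>"
      by (intro nn_integral_PInf_AE) measurable
    then show ?thesis
    proof eventually_elim
      case (elim x)
      then obtain B where "B \<ge> 0" "(SUP n. ennreal (norm (g n x) powr p)) = ennreal B"
        by (cases "SUP n. ennreal (norm (g n x) powr p)") auto
      then have "ennreal (norm (g n x) powr p) \<le> ennreal B" for n
        by (metis SUP_upper UNIV_I)
      then have B: "norm (g n x) powr p \<le> B" for n using \<open>B \<ge> 0\<close> by simp
      have "norm (g n x) \<le> B powr (1/p)" for n
      proof -
        have "(norm (g n x) powr p) powr (1/p) \<le> B powr (1/p)"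
          using B p by (intro powr_mono2) auto
        then show ?thesis using p by (simp add: powr_powr)
      qed
      then have "summable (\<lambda>k. norm (d k x))"
        unfolding norm_g by (intro bounded_imp_summable[where B="B powr (1/p)"])
          (auto, metis lessThan_Suc_atMost)
      then have "summable (\<lambda>k. d k x)" by (rule summable_norm_cancel)
      then have "convergent (\<lambda>n. (\<Sum>k<n. d k x) + s (r 0) x)"
        by (intro convergent_add convergent_const) (simp add: summable_iff_convergent)
      moreover have "(\<Sum>k<n. d k x) + s (r 0) x = s (r n) x" for n
        unfolding d_def using sum_lessThan_telescope[of "\<lambda>k. s (r k) x" n] by simp
      ultimately show ?case by simp
    qed
  qed
  \<comment> \<open>\<open>lim\<close> is total, so \<open>f\<close> is a measurable function on the
    whole space; its value is meaningful only where the subsequence converges.\<close>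
  define f where "f x = lim (\<lambda>n. s (r n) x)" for x
  have fm [measurable]: "f \<in> borel_measurable M"
    unfolding f_def by measurable
  have lim: "AE x in M. (\<lambda>n. s (r n) x) \<longlonglongrightarrow> f x"
    using conv by eventually_elim (simp add: f_def convergent_LIMSEQ_iff)
  \<comment> \<open>Let \<open>k\<close> tend to infinity in \<open>s i - s (r k)\<close>: the
    Cauchy bound passes to \<open>s i - f\<close>.\<close>
  have main: "lp_fun M p (\<lambda>x. s i x - f x) \<and> lp_norm M p (\<lambda>x. s i x - f x) \<le> e" 
    if "e > 0" "\<forall>m\<ge>N. \<forall>n\<ge>N. lp_norm M p (\<lambda>x. s m x - s n x) < e" "i \<ge> N" for e N i
  proof (rule lp_fatou[where s="\<lambda>k x. s i x - s (r k) x"])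
    show "AE x in M. (\<lambda>k. s i x - s (r k) x) \<longlonglongrightarrow> s i x - f x"
      using lim by eventually_elim (intro tendsto_intros)
    have "r k \<ge> N" if "k \<ge> N" for k using seq_suble[OF mono, of k] that by simp
    then show "\<forall>\<^sub>F k in sequentially. lp_norm M p (\<lambda>x. s i x - s (r k) x) \<le> e"
      using that by (intro eventually_sequentiallyI[of N]) (auto intro: less_imp_le)
  qed (use p s that in \<open>auto intro: lp_fun_diff\<close>)
  show ?thesis
  proof
    obtain N where "\<forall>m\<ge>N. \<forall>n\<ge>N. lp_norm M p (\<lambda>x. s m x - s n x) < 1" using cauchy[of 1] by auto
    then have "lp_fun M p (\<lambda>x. s N x - f x)" using main[of 1 N N] by auto
    from lp_fun_diff[OF p s[of N] this] show "lp_fun M p f" by simp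
    show "(\<lambda>i. lp_norm M p (\<lambda>x. s i x - f x)) \<longlonglongrightarrow> 0"
    proof (rule LIMSEQ_I)
      fix e :: real assume "e > 0"
      then obtain N where "\<forall>m\<ge>N. \<forall>n\<ge>N. lp_norm M p (\<lambda>x. s m x - s n x) < e/2" using cauchy[of "e/2"] by auto
      then show "\<exists>no. \<forall>n\<ge>no. norm (lp_norm M p (\<lambda>x. s n x - f x) - 0) < e"
        using main[of "e/2" N] \<open>e > 0\<close> by (intro exI[of _ N]) force
    qed
  qed
qed

section \<open>Jensen's inequality and Minkowski's integral inequality\<close>

lemma jensen_powr:
  fixes w h :: "'a \<Rightarrow> real"
  assumes p: "p \<ge> 1" and w: "integrable N w" "\<And>u. u \<in> space N \<Longrightarrow> 0 \<le> w u"
    and h: "h \<in> borel_measurable N" "\<And>u. u \<in> space N \<Longrightarrow> 0 \<le> h u"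
    and wh: "integrable N (\<lambda>u. w u * h u powr p)" and W: "(\<integral>u. w u \<partial>N) > 0"
  shows "integrable N (\<lambda>u. w u * h u)"
    "(\<integral>u. w u * h u \<partial>N) powr p \<le> (\<integral>u. w u \<partial>N) powr (p - 1) * (\<integral>u. w u * h u powr p \<partial>N)"
proof -
  show int: "integrable N (\<lambda>u. w u * h u)"
  proof (rule Bochner_Integration.integrable_bound)
    show "integrable N (\<lambda>u. w u + w u * h u powr p)" using w wh by auto
    have "w u * h u \<le> w u + w u * h u powr p" if "u \<in> space N" for u
    proof -
      have "h u \<le> 1 + h u powr p"
      proof (cases "h u \<le> 1")
        case True
        then show ?thesis using powr_ge_zero[of "h u" p] by linarith
      next
        case False
        then have "h u powr 1 \<le> h u powr p" using p by (intro powr_mono) auto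
        then show ?thesis using False by simp
      qed
      then have "w u * h u \<le> w u * (1 + h u powr p)" using w(2)[OF that] by (intro mult_left_mono) auto
      then show ?thesis by (simp add: algebra_simps)
    qed
    then show "AE u in N. norm (w u * h u) \<le> norm (w u + w u * h u powr p)"
      using w h by (intro AE_I2) (auto simp: abs_mult)
  qed (use w h in auto)
  define W where "W = (\<integral>u. w u \<partial>N)"
  define I where "I = (\<integral>u. w u * h u \<partial>N)"
  have I: "I \<ge> 0" unfolding I_def using w h by (intro Bochner_Integration.integral_nonneg) auto
  have Wpos: "W > 0" using W by (simp add: W_def)
  \<comment> \<open>The tangent is taken at the weighted mean \<open>c\<close>. As the mass
    \<open>W\<close> of the weight is not normalised, a factor \<open>W powr (p - 1)\<close> remains
    in the result.\<close>
  define c where "c = I / W"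
  have c: "c \<ge> 0" using I Wpos by (simp add: c_def)
  have "(\<integral>u. w u * c powr p + p * c powr (p - 1) * (w u * h u - w u * c) \<partial>N) \<le> (\<integral>u. w u * h u powr p \<partial>N)"
  proof (rule integral_mono)
    fix u assume u: "u \<in> space N"
    have "w u * (c powr p + p * c powr (p - 1) * (h u - c)) \<le> w u * h u powr p"
      by (intro mult_left_mono powr_tangent_le) (use p c w h u in auto)
    then show "w u * c powr p + p * c powr (p - 1) * (w u * h u - w u * c) \<le> w u * h u powr p"
      by (simp add: algebra_simps)
  qed (use int w wh in auto)
  also have "(\<integral>u. w u * c powr p + p * c powr (p - 1) * (w u * h u - w u * c) \<partial>N) =
      W * c powr p + p * c powr (p - 1) * (I - W * c)"
    using int w by (simp add: W_def I_def)
  also have "\<dots> = W * (I powr p / W powr p)" using Wpos I by (simp add: c_def powr_divide)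
  finally have "W powr (p - 1) * (W * (I powr p / W powr p)) \<le> W powr (p - 1) * (\<integral>u. w u * h u powr p \<partial>N)"
    by (intro mult_left_mono) auto
  also have "W powr (p - 1) * (W * (I powr p / W powr p)) = I powr p"
    using Wpos by (simp add: powr_diff)
  finally show "(\<integral>u. w u * h u \<partial>N) powr p \<le> (\<integral>u. w u \<partial>N) powr (p - 1) * (\<integral>u. w u * h u powr p \<partial>N)"
    by (simp add: W_def I_def)
qed

text \<open>Jensen's inequality is applied for fixed \<open>x\<close>, and Tonelli's theorem
  exchanges the integrals. The norm bound is asked only where \<open>w\<close> does not vanish, so
  that a weight concentrated on a small set requires information only there.\<close>

lemma minkowski_integral:
  fixes w :: "'b \<Rightarrow> real" and F :: "'a \<Rightarrow> 'b \<Rightarrow> complex"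
  assumes p: "p \<ge> 1" and M: "sigma_finite_measure M" and N: "sigma_finite_measure N"
    and w: "integrable N w" "\<And>u. u \<in> space N \<Longrightarrow> 0 \<le> w u"
    and F [measurable]: "(\<lambda>(x, u). F x u) \<in> borel_measurable (M \<Otimes>\<^sub>M N)"
    and b: "b \<ge> 0"
    and bound: "\<And>u. u \<in> space N \<Longrightarrow> w u \<noteq> 0 \<Longrightarrow> lp_fun M p (\<lambda>x. F x u) \<and> lp_norm M p (\<lambda>x. F x u) \<le> b"
  shows "AE x in M. integrable N (\<lambda>u. w u *\<^sub>R F x u)"
    and "lp_fun M p (\<lambda>x. \<integral>u. w u *\<^sub>R F x u \<partial>N)"
    and "lp_norm M p (\<lambda>x. \<integral>u. w u *\<^sub>R F x u \<partial>N) \<le> (\<integral>u. w u \<partial>N) * b"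
proof -
  interpret M: sigma_finite_measure M by fact
  interpret N: sigma_finite_measure N by fact
  interpret pair_sigma_finite M N ..
  have [measurable]: "w \<in> borel_measurable N" using w by auto
  define W where "W = (\<integral>u. w u \<partial>N)"
  have W0: "W \<ge> 0" unfolding W_def using w by (intro Bochner_Integration.integral_nonneg) auto
  define J where "J x = (\<integral>u. w u *\<^sub>R F x u \<partial>N)" for x
  have Jm [measurable]: "J \<in> borel_measurable M" unfolding J_def by measurable
  have "(AE x in M. integrable N (\<lambda>u. w u *\<^sub>R F x u)) \<and> (\<integral>\<^sup>+x. ennreal (norm (J x) powr p) \<partial>M) \<le> ennreal ((W * b) powr p)"
  \<comment> \<open>Jensen's inequality requires positive total mass; a null weight makes all the
    inner integrals zero.\<close>
  proof (cases "W = 0")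
    case True
    then have "AE u in N. w u = 0"
      using integral_nonneg_eq_0_iff_AE[OF w(1)] w(2) by (auto simp: W_def)
    then have ae: "AE u in N. w u *\<^sub>R F x u = 0" for x by eventually_elim simp
    have "integrable N (\<lambda>u. w u *\<^sub>R F x u)" if "x \<in> space M" for x
      using integrable_cong_AE[THEN iffD2, OF _ _ ae[of x]] that by simp
    moreover have "J x = 0" for x
      unfolding J_def using integral_eq_zero_AE[OF ae[of x]] .
    ultimately show ?thesis using p by auto
  next
    case False
    then have Wpos: "W > 0" using W0 by simp
    have "(\<integral>\<^sup>+x. \<integral>\<^sup>+u. ennreal (w u * norm (F x u) powr p) \<partial>N \<partial>M) = 
        (\<integral>\<^sup>+u. \<integral>\<^sup>+x. ennreal (w u * norm (F x u) powr p) \<partial>M \<partial>N)"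
      by (rule Fubini'[symmetric]) measurable
    also have "\<dots> \<le> (\<integral>\<^sup>+u. ennreal (w u * b powr p) \<partial>N)"
    proof (rule nn_integral_mono)
      fix u assume u: "u \<in> space N"
      show "(\<integral>\<^sup>+x. ennreal (w u * norm (F x u) powr p) \<partial>M) \<le> ennreal (w u * b powr p)"
      proof (cases "w u = 0")
        case False
        note bd = bound[OF u False]
        have "(\<integral>\<^sup>+x. ennreal (w u * norm (F x u) powr p) \<partial>M) = ennreal (\<integral>x. w u * norm (F x u) powr p \<partial>M)"
          using bd w(2)[OF u] by (intro nn_integral_eq_integral) (auto dest: lp_fun_integrable)
        also have "(\<integral>x. w u * norm (F x u) powr p \<partial>M) = w u * lp_norm M p (\<lambda>x. F x u) powr p"
          using p by (simp add: lp_norm_powr)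
        also have "\<dots> \<le> w u * b powr p"
          using bd p w(2)[OF u] by (intro mult_left_mono powr_mono2) auto
        finally show ?thesis by (simp add: ennreal_leI)
      qed auto
    qed
    also have "\<dots> = ennreal (\<integral>u. w u * b powr p \<partial>N)"
      using w by (intro nn_integral_eq_integral) auto
    also have "\<dots> = ennreal (W * b powr p)" by (simp add: W_def)
    finally have tot: "(\<integral>\<^sup>+x. \<integral>\<^sup>+u. ennreal (w u * norm (F x u) powr p) \<partial>N \<partial>M) \<le> ennreal (W * b powr p)" .
    have "AE x in M. (\<integral>\<^sup>+u. ennreal (w u * norm (F x u) powr p) \<partial>N) \<noteq> \<infinity>"
      by (rule nn_integral_PInf_AE) (use tot in \<open>auto simp: top_unique\<close>)
    moreover have "AE x in M. x \<in> space M" by simp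
    ultimately have ae: "AE x in M. integrable N (\<lambda>u. w u *\<^sub>R F x u) \<and>
       ennreal (norm (J x) powr p) \<le> ennreal (W powr (p - 1)) * (\<integral>\<^sup>+u. ennreal (w u * norm (F x u) powr p) \<partial>N)"
    proof eventually_elim
      case (elim x)
      then have Fx [measurable]: "F x \<in> borel_measurable N" by measurable
      have int: "integrable N (\<lambda>u. w u * norm (F x u) powr p)"
        using elim w(2) by (intro integrableI_nonneg) (auto simp: less_top)
      note jen = jensen_powr[OF p w(1) w(2) _ _ int, unfolded W_def[symmetric], OF _ _ _ Wpos]
      have i1: "integrable N (\<lambda>u. w u * norm (F x u))" by (rule jen(1)) (use Fx in auto)
      have i2: "integrable N (\<lambda>u. w u *\<^sub>R F x u)"
      proof (rule Bochner_Integration.integrable_bound[OF i1])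
        show "AE u in N. norm (w u *\<^sub>R F x u) \<le> norm (w u * norm (F x u))"
          by (simp add: abs_mult)
      qed measurable
      have "norm (J x) \<le> (\<integral>u. norm (w u *\<^sub>R F x u) \<partial>N)"
        unfolding J_def by (rule integral_norm_bound)
      also have "\<dots> = (\<integral>u. w u * norm (F x u) \<partial>N)"
        by (rule Bochner_Integration.integral_cong) (use w(2) in auto)
      finally have "norm (J x) powr p \<le> (\<integral>u. w u * norm (F x u) \<partial>N) powr p"
        using p by (intro powr_mono2) auto
      also have "\<dots> \<le> W powr (p - 1) * (\<integral>u. w u * norm (F x u) powr p \<partial>N)"
        by (rule jen(2)) (use Fx in auto)
      finally have "ennreal (norm (J x) powr p) \<le> ennreal (W powr (p - 1)) * ennreal (\<integral>u. w u * norm (F x u) powr p \<partial>N)"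
        by (subst ennreal_mult[symmetric]) (use w(2) in \<open>auto intro!: Bochner_Integration.integral_nonneg ennreal_leI\<close>)
      also have "ennreal (\<integral>u. w u * norm (F x u) powr p \<partial>N) = (\<integral>\<^sup>+u. ennreal (w u * norm (F x u) powr p) \<partial>N)"
        by (rule nn_integral_eq_integral[symmetric, OF int]) (use w(2) in auto)
      finally show ?case using i2 by simp
    qed
    then have "(\<integral>\<^sup>+x. ennreal (norm (J x) powr p) \<partial>M) \<le> 
       (\<integral>\<^sup>+x. ennreal (W powr (p - 1)) * (\<integral>\<^sup>+u. ennreal (w u * norm (F x u) powr p) \<partial>N) \<partial>M)"
      by (intro nn_integral_mono_AE) auto
    also have "\<dots> = ennreal (W powr (p - 1)) * (\<integral>\<^sup>+x. \<integral>\<^sup>+u. ennreal (w u * norm (F x u) powr p) \<partial>N \<partial>M)"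
      by (rule nn_integral_cmult) measurable
    also have "\<dots> \<le> ennreal (W powr (p - 1)) * ennreal (W * b powr p)"
      by (intro mult_left_mono tot) auto
    also have "\<dots> = ennreal ((W * b) powr p)"
      using Wpos b by (subst ennreal_mult[symmetric]) (auto simp: powr_mult powr_diff)
    finally show ?thesis using ae by auto
  qed
  then have ae: "AE x in M. integrable N (\<lambda>u. w u *\<^sub>R F x u)"
    and le: "(\<integral>\<^sup>+x. ennreal (norm (J x) powr p) \<partial>M) \<le> ennreal ((W * b) powr p)" by auto
  show "AE x in M. integrable N (\<lambda>u. w u *\<^sub>R F x u)" by fact
  have int: "integrable M (\<lambda>x. norm (J x) powr p)"
    using le by (intro integrableI_nonneg) (auto simp: less_top[symmetric] top_unique)
  then have "lp_fun M p J" by (simp add: lp_fun_def)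
  then show "lp_fun M p (\<lambda>x. \<integral>u. w u *\<^sub>R F x u \<partial>N)" by (simp add: J_def[abs_def])
  have "ennreal (\<integral>x. norm (J x) powr p \<partial>M) \<le> ennreal ((W * b) powr p)"
    using le by (subst (asm) nn_integral_eq_integral[OF int]) auto
  then have "lp_norm M p J \<le> W * b"
    using p W0 b by (intro lp_norm_leI) auto
  then show "lp_norm M p (\<lambda>x. \<integral>u. w u *\<^sub>R F x u \<partial>N) \<le> (\<integral>u. w u \<partial>N) * b"
    by (simp add: J_def[abs_def] W_def)
qed

section \<open>Kernel operators on the half-line\<close>

text \<open>The half-line is a measure space of its own rather than the domain of set integrals over
  \<open>lborel\<close>: the general \<open>L^p\<close> lemmas and product measures then apply to it
  directly.\<close>

definition half_line :: "real measure" where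
  "half_line = restrict_space lborel {0<..}"

abbreviation "hfun \<equiv> lp_fun half_line"
abbreviation "hnorm \<equiv> lp_norm half_line"

lemma space_half_line [simp]: "space half_line = {0<..}"
  by (simp add: half_line_def space_restrict_space)

lemma sigma_finite_half_line: "sigma_finite_measure half_line"
  unfolding half_line_def by (rule sigma_finite_measure_restrict_space) (auto simp: lborel.sigma_finite_measure_axioms)

interpretation half_line: sigma_finite_measure half_line
  by (rule sigma_finite_half_line)

interpretation half_line_pair: pair_sigma_finite half_line half_line ..

lemma integral_half_line: 
  fixes f :: "real \<Rightarrow> 'b::{banach, second_countable_topology}"
  shows "integral\<^sup>L half_line f = (LINT x:{0<..}|lborel. f x)"
  by (simp add: half_line_def integral_restrict_space set_lebesgue_integral_def)

lemma integrable_half_line: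
  fixes f :: "real \<Rightarrow> 'b::{banach, second_countable_topology}"
  shows "integrable half_line f \<longleftrightarrow> set_integrable lborel {0<..} f"
  by (simp add: half_line_def integrable_restrict_space set_integrable_def)

lemma nn_integral_half_line:
  "(\<integral>\<^sup>+x. f x \<partial>half_line) = (\<integral>\<^sup>+x. f x * indicator {0<..} x \<partial>lborel)"
  by (simp add: half_line_def nn_integral_restrict_space)

lemma borel_measurable_half_line:
  fixes f :: "real \<Rightarrow> 'b::real_normed_vector"
  shows "f \<in> borel_measurable half_line \<longleftrightarrow> (\<lambda>x. indicator {0<..} x *\<^sub>R f x) \<in> borel_measurable borel"
  by (simp add: half_line_def borel_measurable_restrict_space_iff)

lemma Lp_iff: "Lp p f \<longleftrightarrow> hfun p f"
  by (simp add: Lp_def lp_fun_def borel_measurable_half_line set_borel_measurable_def integrable_half_line)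

lemma Lp_norm_eq: "Lp_norm p f = hnorm p f"
  by (simp add: Lp_norm_def lp_norm_def integral_half_line)

lemma measurable_half_line_borel:
  "f \<in> borel_measurable borel \<Longrightarrow> f \<in> borel_measurable half_line"
  by (simp add: half_line_def measurable_restrict_space1)

lemma AE_half_line: "(\<And>x. x > 0 \<Longrightarrow> P x) \<Longrightarrow> AE x in half_line. P x"
  by (rule AE_I2) simp

lemma measurable_half_lineI:
  assumes "f \<in> borel_measurable N" "\<And>x. x \<in> space N \<Longrightarrow> f x > 0"
  shows "f \<in> N \<rightarrow>\<^sub>M half_line"
  unfolding half_line_def using assms
  by (intro measurable_restrict_space2) auto

lemma measurable_half_lineD: "f \<in> N \<rightarrow>\<^sub>M half_line \<Longrightarrow> f \<in> borel_measurable N"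
  unfolding half_line_def using measurable_restrict_space2_iff[of f N lborel "{0<..}"] by simp

lemma half_line_mult [measurable (raw)]:
  assumes "f \<in> N \<rightarrow>\<^sub>M half_line" "g \<in> N \<rightarrow>\<^sub>M half_line"
  shows "(\<lambda>x. f x * g x) \<in> N \<rightarrow>\<^sub>M half_line"
proof (rule measurable_half_lineI)
  show "(\<lambda>x. f x * g x) \<in> borel_measurable N"
    using assms[THEN measurable_half_lineD] by measurable
  show "f x * g x > 0" if "x \<in> space N" for x
    using assms[THEN measurable_space, OF that] by simp
qed

lemma half_line_divide [measurable (raw)]:
  assumes "f \<in> N \<rightarrow>\<^sub>M half_line" "g \<in> N \<rightarrow>\<^sub>M half_line"
  shows "(\<lambda>x. f x / g x) \<in> N \<rightarrow>\<^sub>M half_line"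
proof (rule measurable_half_lineI)
  show "(\<lambda>x. f x / g x) \<in> borel_measurable N"
    using assms[THEN measurable_half_lineD] by measurable
  show "f x / g x > 0" if "x \<in> space N" for x
    using assms[THEN measurable_space, OF that] by simp
qed

lemma half_line_scale [measurable]: "c > 0 \<Longrightarrow> (\<lambda>x. c * x) \<in> half_line \<rightarrow>\<^sub>M half_line"
  by (intro half_line_mult measurable_const measurable_ident_sets) auto

lemma half_line_id_borel [measurable]: "(\<lambda>x. x) \<in> borel_measurable half_line"
  by (rule measurable_half_line_borel) simp

lemma half_line_fst_borel [measurable]: "fst \<in> borel_measurable (half_line \<Otimes>\<^sub>M N)"
  and half_line_snd_borel [measurable]: "snd \<in> borel_measurable (N \<Otimes>\<^sub>M half_line)"
  by (intro measurable_half_lineD measurable_fst measurable_snd)+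

section \<open>Dilations of the half-line and the operators commuting with them\<close>

lemma integral_half_line_scale:
  fixes f :: "real \<Rightarrow> 'b::{banach, second_countable_topology}"
  assumes "c > 0"
  shows "(\<integral>x. f (c * x) \<partial>half_line) = (1 / c) *\<^sub>R (\<integral>x. f x \<partial>half_line)"
proof -
  have "(\<integral>x. f x \<partial>half_line) = (\<integral>x. indicator {0<..} x *\<^sub>R f x \<partial>lborel)"
    by (simp add: integral_half_line set_lebesgue_integral_def)
  also have "\<dots> = \<bar>c\<bar> *\<^sub>R (\<integral>x. indicator {0<..} (0 + c * x) *\<^sub>R f (0 + c * x) \<partial>lborel)"
    using assms by (intro lborel_integral_real_affine) auto
  also have "(\<lambda>x. indicator {0<..} (0 + c * x) *\<^sub>R f (0 + c * x)) = (\<lambda>x. indicator {0<..} x *\<^sub>R f (c * x))"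
    using assms by (auto simp: indicator_def zero_less_mult_iff)
  finally show ?thesis
    using assms by (simp add: integral_half_line set_lebesgue_integral_def)
qed

lemma integrable_half_line_scale:
  fixes f :: "real \<Rightarrow> 'b::{banach, second_countable_topology}"
  assumes "c > 0"
  shows "integrable half_line (\<lambda>x. f (c * x)) \<longleftrightarrow> integrable half_line f"
proof -
  have "integrable half_line f \<longleftrightarrow> integrable lborel (\<lambda>x. indicator {0<..} (0 + c * x) *\<^sub>R f (0 + c * x))"
    using assms lborel_integrable_real_affine_iff[of c "\<lambda>x. indicator {0<..} x *\<^sub>R f x" 0]
    by (simp add: integrable_half_line set_integrable_def)
  also have "(\<lambda>x. indicator {0<..} (0 + c * x) *\<^sub>R f (0 + c * x)) = (\<lambda>x. indicator {0<..} x *\<^sub>R f (c * x))"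
    using assms by (auto simp: indicator_def zero_less_mult_iff)
  finally show ?thesis
    by (simp add: integrable_half_line set_integrable_def)
qed

lemma lp_scale:
  assumes "c > 0" "hfun p f"
  shows "hfun p (\<lambda>x. f (c * x))"
proof -
  have [measurable]: "f \<in> borel_measurable half_line" using assms by (simp add: lp_fun_def)
  have "(\<lambda>x. f (c * x)) \<in> borel_measurable half_line"
    using assms(1) by measurable
  then show ?thesis
    using assms integrable_half_line_scale[of c "\<lambda>x. norm (f x) powr p"] by (simp add: lp_fun_def)
qed

lemma lp_norm_scale:
  assumes "p \<ge> 1" "c > 0"
  shows "hnorm p (\<lambda>x. f (c * x)) = c powr (- 1 / p) * hnorm p f"
proof -
  have "(\<integral>x. norm (f (c * x)) powr p \<partial>half_line) = (1 / c) * (\<integral>x. norm (f x) powr p \<partial>half_line)"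
    using integral_half_line_scale[OF assms(2), of "\<lambda>x. norm (f x) powr p"] by simp
  then have "hnorm p (\<lambda>x. f (c * x)) = (1 / c) powr (1 / p) * hnorm p f"
    using assms by (simp add: lp_norm_def powr_mult[symmetric])
  also have "(1 / c) powr (1 / p) = c powr (- 1 / p)"
    using assms by (simp add: powr_divide powr_minus_divide)
  finally show ?thesis .
qed

lemma lp_fun_T_grp: "hfun p f \<Longrightarrow> hfun p (T_grp p t f)"
  unfolding T_grp_def by (intro lp_fun_cmult lp_scale) auto

text \<open>Dilating the argument by \<open>exp (- t)\<close> multiplies the norm by
  \<open>exp (t / p)\<close>, and the prefactor of \<open>T_grp\<close> is the inverse of this
  number.\<close>

lemma lp_norm_T_grp:
  assumes "p \<ge> 1" 
  shows "hnorm p (T_grp p t f) = hnorm p f"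
proof -
  have "hnorm p (T_grp p t f) = exp (- t / p) * (exp (- t) powr (- 1 / p) * hnorm p f)"
    unfolding T_grp_def using assms by (simp add: lp_norm_cmult lp_norm_scale)
  also have "exp (- t / p) * (exp (- t) powr (- 1 / p) * hnorm p f) = 
     (exp (- t / p) * exp (t / p)) * hnorm p f"
    by (simp add: powr_def)
  also have "exp (- t / p) * exp (t / p) = 1" by (simp add: exp_add[symmetric])
  finally show ?thesis by simp
qed

text \<open>\<open>u powr (- 1 / p)\<close> is the norm on \<open>L^p\<close> of the dilation by
  \<open>u\<close>, so the last condition says that the superposition of dilations with weights
  \<open>k u\<close> converges absolutely.\<close>

definition kern :: "real \<Rightarrow> (real \<Rightarrow> real) \<Rightarrow> bool" where
  "kern p k \<longleftrightarrow> k \<in> borel_measurable half_line \<and> (\<forall>u>0. 0 \<le> k u) \<and>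
     integrable half_line (\<lambda>u. k u * u powr (- 1 / p))"

text \<open>With \<open>s = t * u\<close> this is the integral operator with kernel
  \<open>k (s / t) / t\<close>, homogeneous of degree -1. In the variable \<open>u\<close> it is a
  superposition of dilations and visibly commutes with \<open>T_grp\<close>.\<close>

definition kop :: "(real \<Rightarrow> real) \<Rightarrow> (real \<Rightarrow> complex) \<Rightarrow> real \<Rightarrow> complex" where
  "kop k f t = (\<integral>u. k u *\<^sub>R f (t * u) \<partial>half_line)"

lemma kop_bounded:
  assumes p: "p \<ge> 1" and k: "kern p k" and f: "hfun p f"
  shows "AE t in half_line. integrable half_line (\<lambda>u. k u *\<^sub>R f (t * u))"
    and "hfun p (kop k f)"
    and "hnorm p (kop k f) \<le> (\<integral>u. k u * u powr (- 1 / p) \<partial>half_line) * hnorm p f"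
proof -
  define w where "w u = k u * u powr (- 1 / p)" for u
  \<comment> \<open>The factor \<open>u powr (1 / p)\<close> normalises the dilated function, so
    that its norm no longer depends on \<open>u\<close>; the weight \<open>w\<close> absorbs the
    inverse factor.\<close>
  define F where "F x u = complex_of_real (u powr (1 / p)) * f (x * u)" for x u :: real
  have [measurable]: "f \<in> borel_measurable half_line" using f by (simp add: lp_fun_def)
  have eq: "w u *\<^sub>R F x u = k u *\<^sub>R f (x * u)" if "u > 0" for x u
  proof -
    have "w u *\<^sub>R F x u = (k u * (u powr (- 1 / p) * u powr (1 / p))) *\<^sub>R f (x * u)"
      by (simp add: w_def F_def scaleR_conv_of_real)
    also have "u powr (- 1 / p) * u powr (1 / p) = 1"
      using that by (simp add: powr_add[symmetric])
    finally show ?thesis by simp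
  qed
  have a: "hfun p (\<lambda>x. F x u) \<and> hnorm p (\<lambda>x. F x u) \<le> hnorm p f" if "u > 0" for u
  proof
    have *: "(\<lambda>x. F x u) = (\<lambda>x. complex_of_real (u powr (1 / p)) * f (u * x))"
      by (auto simp: F_def mult.commute)
    show "hfun p (\<lambda>x. F x u)"
      unfolding * by (intro lp_fun_cmult lp_scale that f)
    have "hnorm p (\<lambda>x. F x u) = (u powr (1 / p) * u powr (- 1 / p)) * hnorm p f"
      unfolding * using p that by (simp add: lp_norm_cmult lp_norm_scale)
    also have "u powr (1 / p) * u powr (- 1 / p) = 1"
      using that by (simp add: powr_add[symmetric])
    finally show "hnorm p (\<lambda>x. F x u) \<le> hnorm p f" by simp
  qed
  have b: "integrable half_line w" "\<And>u. u \<in> space half_line \<Longrightarrow> 0 \<le> w u"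
    using k by (auto simp: kern_def w_def[abs_def])
  have c: "(\<lambda>(x, u). F x u) \<in> borel_measurable (half_line \<Otimes>\<^sub>M half_line)"
    unfolding F_def by measurable
  note mi = minkowski_integral[OF p sigma_finite_half_line sigma_finite_half_line b c lp_norm_nonneg[of half_line p f]]
  have int: "(\<integral>u. w u *\<^sub>R F x u \<partial>half_line) = kop k f x" for x
    unfolding kop_def by (rule Bochner_Integration.integral_cong) (auto simp: eq)
  have "integrable half_line (\<lambda>u. w u *\<^sub>R F x u) \<longleftrightarrow> integrable half_line (\<lambda>u. k u *\<^sub>R f (x * u))" for x
    by (rule Bochner_Integration.integrable_cong) (auto simp: eq)
  then show "AE t in half_line. integrable half_line (\<lambda>u. k u *\<^sub>R f (t * u))"
    using mi(1) a by simp
  show "hfun p (kop k f)" using mi(2) a by (simp add: int)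
  show "hnorm p (kop k f) \<le> (\<integral>u. k u * u powr (- 1 / p) \<partial>half_line) * hnorm p f"
    using mi(3) a unfolding int by (simp add: w_def)
qed

lemma kop_cmult: "kop k (\<lambda>x. c * f x) t = c * kop k f t"
  by (simp add: kop_def mult_scaleR_right[symmetric] del: mult_scaleR_right)

lemma kop_kernel_cmult: "kop (\<lambda>u. c * k u) f t = c *\<^sub>R kop k f t"
  by (simp add: kop_def scaleR_scaleR[symmetric] del: scaleR_scaleR)

lemma kop_kernel_add:
  assumes p: "p \<ge> 1" and k: "kern p k" "kern p l" and f: "hfun p f"
  shows "AE t in half_line. kop (\<lambda>u. k u + l u) f t = kop k f t + kop l f t"
  using kop_bounded(1)[OF p k(1) f] kop_bounded(1)[OF p k(2) f]
  by eventually_elim (simp add: kop_def scaleR_add_left)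

lemma kop_cong: "(\<And>x. x > 0 \<Longrightarrow> f x = g x) \<Longrightarrow> t > 0 \<Longrightarrow> kop k f t = kop k g t"
  unfolding kop_def by (rule Bochner_Integration.integral_cong) auto

lemma kop_kernel_cong: "(\<And>u. u > 0 \<Longrightarrow> k u = l u) \<Longrightarrow> kop k f t = kop l f t"
  unfolding kop_def by (rule Bochner_Integration.integral_cong) auto

lemma kop_T_grp: "kop k (T_grp p t f) s = T_grp p t (kop k f) s"
proof -
  have "kop k (T_grp p t f) s = (\<integral>u. exp (- t / p) * (k u *\<^sub>R f (exp (- t) * s * u)) \<partial>half_line)"
    unfolding kop_def T_grp_def by (rule Bochner_Integration.integral_cong) (auto simp: mult.assoc)
  then show ?thesis
    by (simp add: T_grp_def kop_def mult_scaleR_right[symmetric] del: mult_scaleR_right)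
qed

text \<open>Both sides are the double integral of \<open>f (t * u * v)\<close> against
  \<open>k u\<close> and \<open>l v\<close>. Minkowski's inequality on the product measure shows
  that it converges absolutely for almost every \<open>t\<close>, which allows Fubini's
  theorem.\<close>

lemma kop_commute:
  assumes p: "p \<ge> 1" and k: "kern p k" "kern p l" and f: "hfun p f"
  shows "AE t in half_line. kop k (kop l f) t = kop l (kop k f) t"
proof -
  define w where "w = (\<lambda>(u, v). (k u * u powr (- 1 / p)) * (l v * v powr (- 1 / p)))"
  define F where "F x = (\<lambda>(u, v). complex_of_real ((u * v) powr (1 / p)) * f (x * (u * v)))" for x :: real
  let ?N = "half_line \<Otimes>\<^sub>M half_line"
  have [measurable]: "f \<in> borel_measurable half_line" "k \<in> borel_measurable half_line" "l \<in> borel_measurable half_line" 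
    using f k by (auto simp: lp_fun_def kern_def)
  have N: "sigma_finite_measure ?N" by (rule half_line_pair.sigma_finite_measure_axioms)
  have eq: "w (u, v) *\<^sub>R F x (u, v) = k u *\<^sub>R l v *\<^sub>R f (x * u * v)" if "u > 0" "v > 0" for x u v
  proof -
    have "w (u, v) *\<^sub>R F x (u, v) = (k u * l v * (u powr (- 1 / p) * u powr (1 / p)) * (v powr (- 1 / p) * v powr (1 / p))) *\<^sub>R f (x * (u * v))"
      using that by (simp add: w_def F_def scaleR_conv_of_real powr_mult)
    moreover have "u powr (- 1 / p) * u powr (1 / p) = 1" "v powr (- 1 / p) * v powr (1 / p) = 1"
      using that by (simp_all add: powr_add[symmetric])
    ultimately show ?thesis by (simp add: mult.assoc)
  qed
  have "AE t in half_line. integrable ?N (\<lambda>z. w z *\<^sub>R F t z)"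
  proof (rule minkowski_integral(1)[OF p sigma_finite_half_line N])
    show "integrable ?N w"
    proof (rule half_line_pair.Fubini_integrable)
      show "integrable half_line (\<lambda>u. \<integral>v. norm (w (u, v)) \<partial>half_line)"
        using k integrable_norm[of half_line "\<lambda>u. k u * u powr (- 1 / p)"]
        by (simp add: w_def abs_mult kern_def)
      show "AE u in half_line. integrable half_line (\<lambda>v. w (u, v))"
        using k by (simp add: w_def kern_def)
    qed (simp add: w_def split_beta')
    show "0 \<le> w z" if "z \<in> space ?N" for z
      using that k by (auto simp: w_def space_pair_measure kern_def)
    show "(\<lambda>(x, z). F x z) \<in> borel_measurable (half_line \<Otimes>\<^sub>M ?N)"
      unfolding F_def split_beta' by measurable
    show "0 \<le> hnorm p f" by simp
    show "hfun p (\<lambda>x. F x z) \<and> hnorm p (\<lambda>x. F x z) \<le> hnorm p f"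
      if zN: "z \<in> space ?N" for z
    proof -
      obtain u v where z: "z = (u, v)" "u > 0" "v > 0"
        using zN by (cases z) (auto simp: space_pair_measure)
      have *: "(\<lambda>x. F x z) = (\<lambda>x. complex_of_real ((u * v) powr (1 / p)) * f ((u * v) * x))"
        by (auto simp: F_def z mult_ac)
      have "hnorm p (\<lambda>x. F x z) = ((u * v) powr (1 / p) * (u * v) powr (- 1 / p)) * hnorm p f"
        unfolding * using p z by (simp add: lp_norm_cmult lp_norm_scale)
      also have "(u * v) powr (1 / p) * (u * v) powr (- 1 / p) = 1"
        using z by (simp add: powr_add[symmetric])
      finally show ?thesis
        using z unfolding * by (auto intro!: lp_fun_cmult lp_scale f)
    qed
  qed
  moreover have "AE t in half_line. t \<in> space half_line" by (rule AE_space)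
  ultimately show ?thesis
  proof eventually_elim
    case (elim t)
    have "integrable ?N (\<lambda>(u, v). k u *\<^sub>R l v *\<^sub>R f (t * u * v))"
      using elim(1) by (rule Bochner_Integration.integrable_cong[THEN iffD1, rotated -1])
        (auto simp: eq space_pair_measure)
    from half_line_pair.Fubini_integral[OF this]
    have "(\<integral>v. (\<integral>u. k u *\<^sub>R l v *\<^sub>R f (t * u * v) \<partial>half_line) \<partial>half_line) = 
       (\<integral>u. (\<integral>v. k u *\<^sub>R l v *\<^sub>R f (t * u * v) \<partial>half_line) \<partial>half_line)" .
    also have "(\<integral>v. (\<integral>u. k u *\<^sub>R l v *\<^sub>R f (t * u * v) \<partial>half_line) \<partial>half_line) = 
       (\<integral>v. l v *\<^sub>R (\<integral>u. k u *\<^sub>R f (t * v * u) \<partial>half_line) \<partial>half_line)"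
      unfolding integral_scaleR_right[symmetric] by (simp add: mult_ac)
    also have "(\<integral>u. (\<integral>v. k u *\<^sub>R l v *\<^sub>R f (t * u * v) \<partial>half_line) \<partial>half_line) = 
       (\<integral>u. k u *\<^sub>R (\<integral>v. l v *\<^sub>R f (t * u * v) \<partial>half_line) \<partial>half_line)"
      by (simp del: scaleR_scaleR)
    finally show ?case by (simp add: kop_def)
  qed
qed

text \<open>\<open>m\<close> is the multiplicative convolution of \<open>k\<close> and
  \<open>l\<close>. The kernels being nonnegative, the hypothesis is stated with the nonnegative
  integral: Tonelli's theorem then derives absolute convergence of the double integral from that of
  the single integral for \<open>m\<close>.\<close>

lemma kop_compose:
  assumes p: "p \<ge> 1" and k: "kern p k" "kern p l" "kern p m" and f: "hfun p f"
    and conv: "\<And>w. w > 0 \<Longrightarrow> (\<integral>\<^sup>+u. ennreal (k u * l (w / u) / u) \<partial>half_line) = ennreal (m w)"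
  shows "AE t in half_line. kop k (kop l f) t = kop m f t"
proof -
  let ?N = "half_line \<Otimes>\<^sub>M half_line"
  have [measurable]: "f \<in> borel_measurable half_line" "k \<in> borel_measurable half_line" "l \<in> borel_measurable half_line" "m \<in> borel_measurable half_line" 
    using f k by (auto simp: lp_fun_def kern_def)
  have k0: "0 \<le> k u" "0 \<le> l u" "0 \<le> m u" if "u > 0" for u using k that by (auto simp: kern_def)
  have "AE t in half_line. t \<in> space half_line" by (rule AE_space)
  with kop_bounded(1)[OF p k(3) f] show ?thesis
  proof eventually_elim
    case (elim t)
    then have t: "t > 0" by simp
    define Q where "Q u w = (k u * l (w / u) / u) *\<^sub>R f (t * w)" for u w
    have ft [measurable]: "(\<lambda>w. f (t * w)) \<in> borel_measurable half_line"
      using measurable_compose[OF half_line_scale[OF t], of f] by simp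
    have ft2 [measurable]: "(\<lambda>z. f (t * snd z)) \<in> borel_measurable ?N"
      by (rule measurable_compose[OF measurable_snd ft])
    have Qm [measurable]: "(\<lambda>(u, w). Q u w) \<in> borel_measurable ?N"
      unfolding Q_def split_beta' by measurable
    have "(\<integral>\<^sup>+u. \<integral>\<^sup>+w. ennreal (norm (Q u w)) \<partial>half_line \<partial>half_line) = (\<integral>\<^sup>+w. \<integral>\<^sup>+u. ennreal (norm (Q u w)) \<partial>half_line \<partial>half_line)"
      by (rule half_line_pair.Fubini'[symmetric]) measurable
    also have "\<dots> = (\<integral>\<^sup>+w. ennreal (norm (m w *\<^sub>R f (t * w))) \<partial>half_line)"
    proof (rule nn_integral_cong)
      fix w assume "w \<in> space half_line"
      then have w: "w > 0" by simp
      have "(\<integral>\<^sup>+u. ennreal (norm (Q u w)) \<partial>half_line) = (\<integral>\<^sup>+u. ennreal (k u * l (w / u) / u) * ennreal (norm (f (t * w))) \<partial>half_line)"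
        by (rule nn_integral_cong) (use k0 w in \<open>auto simp: Q_def ennreal_mult[symmetric] abs_mult\<close>)
      also have "\<dots> = ennreal (m w) * ennreal (norm (f (t * w)))"
        using w by (subst nn_integral_multc) (auto simp: conv intro!: measurable_compose[OF half_line_divide[OF measurable_const], of w, where g = l])
      finally show "(\<integral>\<^sup>+u. ennreal (norm (Q u w)) \<partial>half_line) = ennreal (norm (m w *\<^sub>R f (t * w)))"
        using k0 w by (simp add: ennreal_mult)
    qed
    also have "\<dots> < \<infinity>" using elim(1) by (simp add: integrable_iff_bounded)
    finally have "(\<integral>\<^sup>+z. ennreal (norm (case_prod Q z)) \<partial>?N) < \<infinity>"
      by (subst half_line.nn_integral_fst[symmetric]) auto
    then have int: "integrable ?N (\<lambda>(u, w). Q u w)" by (intro integrableI_bounded) auto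
    have "kop k (kop l f) t = (\<integral>u. (\<integral>w. Q u w \<partial>half_line) \<partial>half_line)"
      unfolding kop_def
    proof (rule Bochner_Integration.integral_cong[OF refl])
      fix u assume "u \<in> space half_line"
      then have u: "u > 0" by simp
      \<comment> \<open>Substitute \<open>w = u * v\<close> in the inner integral.\<close>
      have "(\<integral>w. Q u w \<partial>half_line) = u *\<^sub>R (\<integral>w. Q u (u * w) \<partial>half_line)"
        using u by (subst integral_half_line_scale) auto
      also have "\<dots> = (\<integral>w. u *\<^sub>R Q u (u * w) \<partial>half_line)" by simp
      also have "\<dots> = (\<integral>v. k u *\<^sub>R (l v *\<^sub>R f (t * u * v)) \<partial>half_line)"
        by (rule Bochner_Integration.integral_cong) (use u in \<open>auto simp: Q_def mult_ac\<close>)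
      finally show "k u *\<^sub>R (\<integral>v. l v *\<^sub>R f (t * u * v) \<partial>half_line) = (\<integral>w. Q u w \<partial>half_line)"
        by (simp del: scaleR_scaleR)
    qed
    also have "\<dots> = (\<integral>w. (\<integral>u. Q u w \<partial>half_line) \<partial>half_line)"
      by (rule half_line_pair.Fubini_integral[OF int, symmetric])
    also have "\<dots> = (\<integral>w. m w *\<^sub>R f (t * w) \<partial>half_line)"
    proof (rule Bochner_Integration.integral_cong[OF refl])
      fix w assume "w \<in> space half_line"
      then have w: "w > 0" by simp
      have lm: "(\<lambda>u. l (w / u)) \<in> borel_measurable half_line"
        using w by (auto intro!: measurable_compose[OF half_line_divide[OF measurable_const], of w, where g = l])
      have hb: "has_bochner_integral half_line (\<lambda>u. k u * l (w / u) / u) (m w)"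
        using w conv[OF w] k0 lm by (intro has_bochner_integral_nn_integral) (auto intro!: AE_half_line)
      show "(\<integral>u. Q u w \<partial>half_line) = m w *\<^sub>R f (t * w)"
        unfolding Q_def using hb by (simp add: has_bochner_integral_iff)
    qed
    finally show ?case by (simp add: kop_def)
  qed
qed

section \<open>Density and strong continuity\<close>

text \<open>Carries explicitly known gauge integrals over to \<open>half_line\<close>. The set
  \<open>\<Omega>\<close> may contain 0, which is not a point of \<open>half_line\<close> but forms
  a null set.\<close>

lemma has_bochner_integral_half_lineI:
  fixes f :: "real \<Rightarrow> real"
  assumes f: "f \<in> borel_measurable borel" and nn: "\<And>x. x \<in> \<Omega> \<Longrightarrow> 0 \<le> f x"
    and I: "(f has_integral I) \<Omega>" and \<Omega>: "\<Omega> \<in> sets borel" "\<Omega> \<subseteq> {0..}"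
  shows "has_bochner_integral half_line (\<lambda>x. indicator \<Omega> x * f x) I"
proof (rule has_bochner_integral_nn_integral)
  show "(\<lambda>x. indicator \<Omega> x * f x) \<in> borel_measurable half_line"
    using f \<Omega> by (intro measurable_half_line_borel) auto
  show "AE x in half_line. 0 \<le> indicator \<Omega> x * f x"
    using nn by (auto simp: indicator_def)
  show "0 \<le> I" using has_integral_nonneg[OF I] nn by auto
  have "(\<integral>\<^sup>+x. ennreal (indicator \<Omega> x * f x) \<partial>half_line) = (\<integral>\<^sup>+x. ennreal (f x) * indicator \<Omega> x \<partial>lborel)"
    unfolding nn_integral_half_line
  proof (rule nn_integral_cong_AE)
    have "AE x in lborel. x \<noteq> (0::real)" by (rule AE_lborel_singleton)
    then show "AE x in lborel. ennreal (indicator \<Omega> x * f x) * indicator {0<..} x = ennreal (f x) * indicator \<Omega> x"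
      by eventually_elim (use \<Omega> in \<open>auto simp: indicator_def\<close>)
  qed
  then show "(\<integral>\<^sup>+x. ennreal (indicator \<Omega> x * f x) \<partial>half_line) = ennreal I"
    using nn_integral_has_integral_lebesgue'[OF nn I] by simp
qed

lemma integrable_half_line_powr:
  fixes a b :: real
  assumes a: "a > - 1" and ab: "a + b < - 1"
  shows "integrable half_line (\<lambda>x. x powr a * (1 + x) powr b)"
proof -
  \<comment> \<open>Bounds \<open>y powr b\<close> on \<open>[1, 2]\<close> for either sign of
    \<open>b\<close>: it is applied to \<open>y = 1 + x\<close> for \<open>x \<le> 1\<close> and to
    \<open>y = 1 + 1 / x\<close> for \<open>x > 1\<close>.\<close>
  define C where "C = max 1 (2 powr b)"
  have C: "C \<ge> 1" by (simp add: C_def)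
  have i1: "integrable half_line (\<lambda>x. indicator {0..1} x * x powr a)"
    using has_bochner_integral_half_lineI[OF _ _ has_integral_powr_from_0[OF a, of 1]]
    by (auto simp: has_bochner_integral_iff)
  have i2: "integrable half_line (\<lambda>x. indicator {1..} x * x powr (a + b))"
    using has_bochner_integral_half_lineI[OF _ _ has_integral_powr_to_inf[OF ab, of 1]]
    by (auto simp: has_bochner_integral_iff)
  have mb: "y powr b \<le> C" if "1 \<le> y" "y \<le> 2" for y
  proof (cases "b \<ge> 0")
    case True
    then have "y powr b \<le> 2 powr b" using that by (intro powr_mono2) auto
    then show ?thesis by (simp add: C_def)
  next
    case False
    then have "y powr b \<le> 1 powr b" using that by (intro powr_mono2') auto
    then show ?thesis by (simp add: C_def)
  qed
  show ?thesis
  proof (rule Bochner_Integration.integrable_bound)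
    show "integrable half_line (\<lambda>x. C * (indicator {0..1} x * x powr a + indicator {1..} x * x powr (a + b)))"
      using i1 i2 by auto
    have "x powr a * (1 + x) powr b \<le> C * (indicator {0..1} x * x powr a + indicator {1..} x * x powr (a + b))" if "x > 0" for x
    proof (cases "x \<le> 1")
      case True
      have "x powr a * (1 + x) powr b \<le> x powr a * C"
        using True that by (intro mult_left_mono mb) auto
      also have "\<dots> \<le> C * (indicator {0..1} x * x powr a + indicator {1..} x * x powr (a + b))"
        using True that C by (auto simp: indicator_def algebra_simps)
      finally show ?thesis .
    next
      case False
      have "(1 + x) powr b = (x * (1 + 1 / x)) powr b" using that by (simp add: distrib_left add.commute)
      also have "\<dots> = x powr b * (1 + 1 / x) powr b" using that by (subst powr_mult) auto
      also have "\<dots> \<le> x powr b * C" using False by (intro mult_left_mono mb) auto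
      finally have "x powr a * (1 + x) powr b \<le> x powr a * (x powr b * C)"
        by (intro mult_left_mono) auto
      also have "\<dots> = C * x powr (a + b)" by (simp add: powr_add)
      finally show ?thesis using False by (simp add: indicator_def)
    qed
    then show "AE x in half_line. norm (x powr a * (1 + x) powr b) \<le> norm (C * (indicator {0..1} x * x powr a + indicator {1..} x * x powr (a + b)))"
      using C by (intro AE_half_line) auto
  qed measurable
qed

section \<open>Density of exponential sums with a power weight\<close>

context
  fixes p \<alpha> :: real and V :: "(real \<Rightarrow> complex) set"
  assumes p: "p \<ge> 1"
    and lpV: "\<And>v. v \<in> V \<Longrightarrow> hfun p v"
    and addV: "\<And>v w. v \<in> V \<Longrightarrow> w \<in> V \<Longrightarrow> (\<lambda>s. v s + w s) \<in> V"
    and cmultV: "\<And>c v. v \<in> V \<Longrightarrow> (\<lambda>s. c * v s) \<in> V"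
    and expV: "\<And>k::nat. (\<lambda>s. complex_of_real (s powr \<alpha> * exp (- (real k + 1) * s))) \<in> V"
begin

lemma exp_sum_in_V:
  "(\<lambda>s. \<Sum>i\<le>n. c i * complex_of_real (s powr \<alpha> * exp (- (real i + 1) * s))) \<in> V"
proof (induction n)
  case 0
  show ?case using cmultV[OF expV[of 0], of "c 0"] by simp
next
  case (Suc n)
  show ?case using addV[OF Suc cmultV[OF expV[of "Suc n"], of "c (Suc n)"]] by simp
qed

lemma poly_exp_in_V:
  assumes "real_polynomial_function q"
  shows "(\<lambda>s. complex_of_real (s powr \<alpha> * exp (- s) * q (exp (- s)))) \<in> V"
proof -
  obtain a n where q: "q = (\<lambda>x. \<Sum>i\<le>n. a i * x ^ i)"
    using assms by (auto simp: real_polynomial_function_iff_sum)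
  have "exp (- s) * exp (- s) ^ i = exp (- (real i + 1) * s)" for s :: real and i
    by (simp add: exp_of_nat_mult[symmetric] exp_add[symmetric] algebra_simps)
  then have "s powr \<alpha> * exp (- s) * q (exp (- s)) = (\<Sum>i\<le>n. a i * (s powr \<alpha> * exp (- (real i + 1) * s)))" for s
    unfolding q sum_distrib_left by (intro sum.cong refl) (simp add: mult_ac)
  then have "(\<lambda>s. complex_of_real (s powr \<alpha> * exp (- s) * q (exp (- s)))) =
     (\<lambda>s. \<Sum>i\<le>n. complex_of_real (a i) * complex_of_real (s powr \<alpha> * exp (- (real i + 1) * s)))"
    by simp
  then show ?thesis using exp_sum_in_V[of "\<lambda>i. complex_of_real (a i)" n] by simp
qed

text \<open>Writing \<open>x = exp (- s)\<close> turns approximation by the spanning functions into the Weierstrass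
  theorem on the unit interval.\<close>

lemma dense_continuous:
  fixes g :: "real \<Rightarrow> complex"
  assumes g: "continuous_on UNIV g" and \<delta>: "\<delta> > 0" and z: "\<And>s. s \<notin> {\<delta>..A} \<Longrightarrow> g s = 0" and e: "e > 0"
  shows "\<exists>v\<in>V. hnorm p (\<lambda>s. g s - v s) < e"
proof -
  define E where "E s = complex_of_real (s powr \<alpha> * exp (- s))" for s
  have E: "hfun p E" using lpV[OF expV[of 0]] by (simp add: E_def[abs_def])
  \<comment> \<open>The factor 2 provides one \<open>\<epsilon>\<close> each for the real and the
    imaginary part; the added 1 makes the denominator positive.\<close>
  define \<epsilon> where "\<epsilon> = e / (2 * (1 + hnorm p E))"
  have den: "1 + hnorm p E > 0" by (simp add: add_pos_nonneg)
  have \<epsilon>: "\<epsilon> > 0" using e den by (simp add: \<epsilon>_def)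
  \<comment> \<open>Clamping at \<open>exp (- (A + 1))\<close> keeps the logarithm continuous down
    to \<open>x = 0\<close>; there \<open>L\<close> takes the value \<open>A + 1\<close>, where
    \<open>g\<close> vanishes.\<close>
  define X where "X x = max (exp (- (A + 1))) x" for x :: real
  define L where "L x = - ln (X x)" for x
  have X: "X x > 0" for x by (simp add: X_def less_max_iff_disj)
  have cX: "continuous_on S X" for S unfolding X_def by (intro continuous_intros)
  have cL: "continuous_on S L" for S
    unfolding L_def using X by (intro continuous_intros cX) (metis less_irrefl)
  have gL: "continuous_on S (\<lambda>x. g (L x))" for S
    using continuous_on_compose2[OF g cL] by simp
  \<comment> \<open>\<open>h\<close> is \<open>g\<close> divided by the weight \<open>E\<close>, in
    the variable \<open>x\<close>: approximating this quotient makes the error a multiple of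
    \<open>E\<close>. The maximum with \<open>\<delta>\<close> removes the singularity of the power
    at \<open>s = 0\<close> without any change on the support of \<open>g\<close>.\<close>
  define h where "h x = g (L x) * complex_of_real (max \<delta> (L x) powr (- \<alpha>) / X x)" for x
  have "\<delta> \<le> max \<delta> (L x)" for x by simp
  then have nz: "max \<delta> (L x) \<noteq> 0" "X x \<noteq> 0" for x using \<delta> X by (metis not_le, metis less_irrefl)
  have ch: "continuous_on {0..1} h"
    unfolding h_def by (intro continuous_intros gL cX cL) (use nz in auto)
  obtain q1 where q1: "real_polynomial_function q1" "\<And>x. x \<in> {0..1} \<Longrightarrow> \<bar>Re (h x) - q1 x\<bar> < \<epsilon>"
    by (rule Stone_Weierstrass_real_polynomial_function[of "{0..1::real}" "\<lambda>x. Re (h x)" \<epsilon>])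
      (use ch \<epsilon> in \<open>auto intro: continuous_intros\<close>)
  obtain q2 where q2: "real_polynomial_function q2" "\<And>x. x \<in> {0..1} \<Longrightarrow> \<bar>Im (h x) - q2 x\<bar> < \<epsilon>"
    by (rule Stone_Weierstrass_real_polynomial_function[of "{0..1::real}" "\<lambda>x. Im (h x)" \<epsilon>])
      (use ch \<epsilon> in \<open>auto intro: continuous_intros\<close>)
  define v where "v s = complex_of_real (s powr \<alpha> * exp (- s) * q1 (exp (- s))) + \<i> * complex_of_real (s powr \<alpha> * exp (- s) * q2 (exp (- s)))" for s
  have v: "v \<in> V"
    unfolding v_def using addV[OF poly_exp_in_V[OF q1(1)] cmultV[OF poly_exp_in_V[OF q2(1)], of \<i>]] .
  have hg: "h (exp (- s)) * E s = g s" if "s > 0" for s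
  proof (cases "s \<in> {\<delta>..A}")
    case True
    then have "X (exp (- s)) = exp (- s)" by (simp add: X_def)
    then have "L (exp (- s)) = s" "max \<delta> (L (exp (- s))) = s" using True by (auto simp: L_def)
    then have "h (exp (- s)) * E s = g s * complex_of_real ((s powr (- \<alpha>) * s powr \<alpha>) * (exp (- s) / exp (- s)))"
      unfolding h_def E_def using \<open>X (exp (- s)) = exp (- s)\<close> by (simp add: mult_ac)
    also have "s powr (- \<alpha>) * s powr \<alpha> = 1" using that by (simp add: powr_add[symmetric])
    finally show ?thesis by simp
  next
    case False
    have "L (exp (- s)) \<notin> {\<delta>..A}"
    proof (cases "s \<le> A + 1")
      case True
      then have "X (exp (- s)) = exp (- s)" by (simp add: X_def)
      then show ?thesis using False by (simp add: L_def)
    next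
      case False
      then have "X (exp (- s)) = exp (- (A + 1))" by (simp add: X_def)
      then show ?thesis by (simp add: L_def)
    qed
    then have "g (L (exp (- s))) = 0" "g s = 0" using False z by auto
    then show ?thesis by (simp add: h_def)
  qed
  have bd: "norm (g s - v s) \<le> norm (complex_of_real (2 * \<epsilon>) * E s)" if s: "s > 0" for s
  proof -
    define x where "x = exp (- s)"
    have x: "x \<in> {0..1}" using s by (simp add: x_def)
    have "g s - v s = (complex_of_real (Re (h x) - q1 x) + \<i> * complex_of_real (Im (h x) - q2 x)) * E s"
      unfolding hg[OF s, symmetric] v_def E_def x_def[symmetric]
      by (subst complex_eq[of "h x"]) (simp add: algebra_simps)
    then have "norm (g s - v s) = norm (complex_of_real (Re (h x) - q1 x) + \<i> * complex_of_real (Im (h x) - q2 x)) * norm (E s)"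
      by (simp only: norm_mult)
    also have "\<dots> \<le> (2 * \<epsilon>) * norm (E s)"
    proof (rule mult_right_mono)
      have "norm (complex_of_real (Re (h x) - q1 x) + \<i> * complex_of_real (Im (h x) - q2 x))
         \<le> \<bar>Re (h x) - q1 x\<bar> + \<bar>Im (h x) - q2 x\<bar>"
        using norm_triangle_ineq[of "complex_of_real (Re (h x) - q1 x)" "\<i> * complex_of_real (Im (h x) - q2 x)"]
        unfolding norm_mult norm_of_real by simp
      then show "norm (complex_of_real (Re (h x) - q1 x) + \<i> * complex_of_real (Im (h x) - q2 x)) \<le> 2 * \<epsilon>"
        using q1(2)[OF x] q2(2)[OF x] by simp
    qed simp
    finally show ?thesis using \<epsilon> by (simp add: norm_mult)
  qed
  have vm: "v \<in> borel_measurable half_line" using lpV[OF v] by (simp add: lp_fun_def)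
  have gm: "g \<in> borel_measurable half_line"
    using g by (intro measurable_half_line_borel borel_measurable_continuous_onI)
  have "hnorm p (\<lambda>s. g s - v s) \<le> hnorm p (\<lambda>s. complex_of_real (2 * \<epsilon>) * E s)"
    by (rule lp_fun_bound[OF p lp_fun_cmult[OF E]]) (use vm gm bd in \<open>auto intro!: AE_half_line\<close>)
  also have "\<dots> = 2 * \<epsilon> * hnorm p E"
    using \<epsilon> by (simp add: lp_norm_cmult[OF p] norm_mult)
  also have "\<dots> < 2 * \<epsilon> * (1 + hnorm p E)"
    using \<epsilon> by simp
  also have "\<dots> = e" using den by (simp add: \<epsilon>_def field_simps)
  finally show ?thesis using v by auto
qed

lemma dense_closed:
  assumes f: "hfun p f" and e: "e > 0"
    and ap: "\<And>e. e > 0 \<Longrightarrow> \<exists>g. hfun p g \<and> hnorm p (\<lambda>s. f s - g s) < e \<and>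
               (\<forall>d>0. \<exists>v\<in>V. hnorm p (\<lambda>s. g s - v s) < d)"
  shows "\<exists>v\<in>V. hnorm p (\<lambda>s. f s - v s) < e"
proof -
  obtain g v where g: "hfun p g" "hnorm p (\<lambda>s. f s - g s) < e / 2"
    and v: "v \<in> V" "hnorm p (\<lambda>s. g s - v s) < e / 2"
    using ap[of "e / 2"] e by (metis half_gt_zero)
  have "hnorm p (\<lambda>s. f s - v s) < e"
    using lp_norm_triangle3[OF p f g(1) lpV[OF v(1)]] g v by simp
  then show ?thesis using v by auto
qed

text \<open>First \<open>f\<close> is truncated in size and cut off to a compact set away from 0. As
  a measurable function it is also an almost everywhere limit of continuous functions; the same
  truncations make these uniformly bounded with a common compact support, so that dominated
  convergence reduces the claim to \<open>dense_continuous\<close>.\<close>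

lemma lp_dense:
  assumes f: "hfun p f" and e: "e > 0"
  shows "\<exists>v\<in>V. hnorm p (\<lambda>s. f s - v s) < e"
proof -
  \<comment> \<open>Both cut-offs are continuous maps rather than indicators, so that they send
    continuous approximants to continuous functions.\<close>
  define c where "c n z = z / complex_of_real (max 1 (norm z / real (Suc n)))" for n and z :: complex
  define \<tau> where "\<tau> n s = min 1 (max 0 (real (Suc n) * s - 1)) * min 1 (max 0 (real (Suc n) + 1 - s))" for n and s :: real
  have cc: "continuous_on UNIV (c n)" for n
    unfolding c_def by (intro continuous_intros) (auto simp: max_def)
  have c\<tau>: "continuous_on UNIV (\<tau> n)" for n
    unfolding \<tau>_def by (intro continuous_intros)
  have cn: "norm (c n z) \<le> norm z" "norm (c n z) \<le> real (Suc n)" for n z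
  proof -
    have "norm (c n z) = norm z / max 1 (norm z / real (Suc n))"
      by (simp add: c_def norm_divide)
    moreover have "norm z / max 1 (norm z / real (Suc n)) \<le> norm z / 1"
      by (intro divide_left_mono) auto
    moreover have "norm z / max 1 (norm z / real (Suc n)) \<le> real (Suc n)"
      by (cases "norm z = 0") (auto simp: divide_le_eq max_def not_le split: if_splits)
    ultimately show "norm (c n z) \<le> norm z" "norm (c n z) \<le> real (Suc n)" by auto
  qed
  have \<tau>b: "0 \<le> \<tau> n s" "\<tau> n s \<le> 1" for n s
    unfolding \<tau>_def by (auto intro: mult_le_one)
  have \<tau>z: "\<tau> n s = 0" if "s \<notin> {1 / real (Suc n)..real (Suc n) + 1}" for n s
    using that unfolding \<tau>_def by (auto simp: field_simps max_def)
  have [measurable]: "f \<in> borel_measurable half_line" using f by (simp add: lp_fun_def)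
  have [measurable]: "c n \<in> borel_measurable borel" "\<tau> n \<in> borel_measurable borel" for n
    using cc c\<tau> by (auto intro: borel_measurable_continuous_onI)
  have [measurable]: "\<tau> n \<in> borel_measurable half_line" for n
    by (rule measurable_half_line_borel) measurable
  define F where "F n s = c n (f s) * complex_of_real (\<tau> n s)" for n s
  have Fm [measurable]: "F n \<in> borel_measurable half_line" for n unfolding F_def by measurable
  have Fb: "norm (F n s) \<le> norm (f s)" for n s
    using mult_mono[OF cn(1)[of n "f s"] \<tau>b(2)[of n s]] \<tau>b(1)[of n s] by (simp add: F_def norm_mult)
  have lpF: "hfun p (F n)" for n
    by (rule lp_fun_bound[OF p f]) (use Fb in auto)
  have "(\<lambda>n. hnorm p (\<lambda>s. F n s - f s)) \<longlonglongrightarrow> 0"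
  proof (rule lp_dominated_convergence(2)[OF p f])
    show "AE s in half_line. (\<lambda>n. F n s) \<longlonglongrightarrow> f s"
    proof (rule AE_half_line)
      fix s :: real assume s: "s > 0"
      obtain N where N: "real N \<ge> norm (f s)" "real N \<ge> s" "real N \<ge> 2 / s"
        by (metis (no_types, opaque_lifting) max.bounded_iff real_arch_simple)
      have "F n s = f s" if "n \<ge> N" for n
      proof -
        have n: "real (Suc n) \<ge> norm (f s)" "real (Suc n) \<ge> s" "real (Suc n) \<ge> 2 / s" using N that by auto
        have "norm (f s) / real (Suc n) \<le> 1" using n by (simp add: divide_le_eq)
        then have "c n (f s) = f s" by (simp add: c_def max_def)
        moreover have "real (Suc n) * s \<ge> 2" using n(3) s by (simp only: divide_le_eq)
        then have "\<tau> n s = 1" unfolding \<tau>_def using n by (simp add: min_def max_def)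
        ultimately show ?thesis by (simp add: F_def)
      qed
      then show "(\<lambda>n. F n s) \<longlonglongrightarrow> f s"
        by (intro tendsto_eventually eventually_sequentiallyI[of N])
    qed
  qed (use Fb in auto)
  then have F_lim: "\<exists>n. hnorm p (\<lambda>s. f s - F n s) < d" if "d > 0" for d
    using order_tendstoD(2)[of "\<lambda>n. hnorm p (\<lambda>s. F n s - f s)" 0 sequentially d] that
    by (subst lp_norm_minus_commute) (auto simp: eventually_sequentially)
  have approx_F: "\<exists>v\<in>V. hnorm p (\<lambda>s. F n s - v s) < d" if d: "d > 0" for n d
  proof -
    have "(\<lambda>x. indicator {0<..} x *\<^sub>R f x) \<in> borel_measurable borel"
      using f by (simp add: lp_fun_def borel_measurable_half_line)
    then have "(\<lambda>x. indicator {0<..} x *\<^sub>R f x) \<in> borel_measurable lebesgue"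
      by (auto intro: measurable_completion)
    then have "(\<lambda>x. indicator {0<..} x *\<^sub>R f x) measurable_on UNIV"
      by (rule lebesgue_measurable_imp_measurable_on) simp
    then obtain Z g where Z: "negligible Z" and g: "\<And>i. continuous_on UNIV (g i)"
      and lim: "\<And>x. x \<notin> Z \<Longrightarrow> (\<lambda>i. g i x) \<longlonglongrightarrow> indicator {0<..} x *\<^sub>R f x"
      unfolding measurable_on_def by auto
    have aeZ: "AE x in half_line. x \<notin> Z"
    proof -
      have "Z \<in> null_sets lebesgue" using Z by (simp add: negligible_iff_null_sets)
      then have "AE x in lebesgue. x \<notin> Z" by (rule AE_not_in)
      then have "AE x in lborel. x \<notin> Z" by (simp add: AE_completion_iff)
      then show ?thesis unfolding half_line_def by (subst AE_restrict_space_iff) auto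
    qed
    define G where "G i s = c n (g i s) * complex_of_real (\<tau> n s)" for i s
    have cG: "continuous_on UNIV (G i)" for i
      unfolding G_def by (intro continuous_intros c\<tau> continuous_on_compose2[OF cc g]) auto
    have Gz: "G i s = 0" if "s \<notin> {1 / real (Suc n)..real (Suc n) + 1}" for i s
      using \<tau>z[OF that] by (simp add: G_def)
    have Gm: "G i \<in> borel_measurable half_line" for i
      using cG by (intro measurable_half_line_borel borel_measurable_continuous_onI)
    \<comment> \<open>The dominating function: the truncation level on a bounded interval that
      contains the common support.\<close>
    define D where "D s = complex_of_real (real (Suc n) * indicator {0..real (Suc n) + 1} s)" for s
    have D: "hfun p D"
    proof -
      have "integrable half_line (\<lambda>x. indicator {0..real (Suc n) + 1} x * x powr 0)"
        using has_bochner_integral_half_lineI[OF _ _ has_integral_powr_from_0[of 0 "real (Suc n) + 1"]]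
        by (auto simp: has_bochner_integral_iff)
      then have i: "integrable half_line (\<lambda>x. real (Suc n) powr p * (indicator {0..real (Suc n) + 1} x * x powr 0))"
        by (rule integrable_mult_right)
      have eq: "norm (D x) powr p = real (Suc n) powr p * (indicator {0..real (Suc n) + 1} x * x powr 0)" if "x > 0" for x
        using that p unfolding D_def norm_of_real by (auto simp: indicator_def)
      have "integrable half_line (\<lambda>x. norm (D x) powr p)"
        using i by (rule Bochner_Integration.integrable_cong[THEN iffD2, rotated -1]) (simp, rule eq, simp)
      moreover have "D \<in> borel_measurable half_line"
        unfolding D_def by (intro measurable_half_line_borel) measurable
      ultimately show ?thesis by (simp add: lp_fun_def)
    qed
    have Gb: "norm (G i s) \<le> norm (D s)" if s: "s > 0" for i s
    proof (cases "s \<le> real (Suc n) + 1")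
      case True
      have "norm (D s) = real (Suc n)" unfolding D_def norm_of_real using True s by simp
      then show ?thesis using mult_mono[OF cn(2)[of n "g i s"] \<tau>b(2)[of n s]] \<tau>b(1)[of n s]
        by (simp add: G_def norm_mult)
    next
      case False
      then show ?thesis using Gz[of s i] by simp
    qed
    have "(\<lambda>i. hnorm p (\<lambda>s. G i s - F n s)) \<longlonglongrightarrow> 0"
    proof (rule lp_dominated_convergence(2)[OF p D])
      have "AE s in half_line. s \<in> space half_line" by (rule AE_space)
      then show "AE s in half_line. (\<lambda>i. G i s) \<longlonglongrightarrow> F n s"
        using aeZ
      proof eventually_elim
        case (elim s)
        then have "(\<lambda>i. g i s) \<longlonglongrightarrow> f s" using lim[of s] by simp
        moreover have "isCont (c n) (f s)" using cc[of n] by (simp add: continuous_on_eq_continuous_at)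
        ultimately have "(\<lambda>i. c n (g i s)) \<longlonglongrightarrow> c n (f s)"
          by (rule isCont_tendsto_compose[rotated])
        then show ?case unfolding G_def F_def by (intro tendsto_intros)
      qed
      show "AE s in half_line. norm (G i s) \<le> norm (D s)" for i
        by (intro AE_half_line Gb)
    qed (use Gm in auto)
    then have "eventually (\<lambda>i. hnorm p (\<lambda>s. G i s - F n s) < d / 2) sequentially"
      using d by (intro order_tendstoD(2)) auto
    then obtain i where "hnorm p (\<lambda>s. G i s - F n s) < d / 2"
      by (auto simp: eventually_sequentially)
    then have i: "hnorm p (\<lambda>s. F n s - G i s) < d / 2"
      by (subst lp_norm_minus_commute)
    have lpG: "hfun p (G i)"
      by (intro lp_fun_bound(1)[OF p D Gm] AE_half_line Gb)
    obtain v where v: "v \<in> V" "hnorm p (\<lambda>s. G i s - v s) < d / 2"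
      using dense_continuous[OF cG[of i], of "1 / real (Suc n)" "real (Suc n) + 1" "d / 2"] Gz d by auto
    have "hnorm p (\<lambda>s. F n s - v s) < d"
      using lp_norm_triangle3[OF p lpF lpG lpV[OF v(1)], of n] i v by simp
    then show ?thesis using v by auto
  qed
  show ?thesis
  proof (rule dense_closed[OF f e])
    fix d :: real assume "d > 0"
    then obtain n where "hnorm p (\<lambda>s. f s - F n s) < d" using F_lim by auto
    then show "\<exists>g. hfun p g \<and> hnorm p (\<lambda>s. f s - g s) < d \<and>
        (\<forall>d>0. \<exists>v\<in>V. hnorm p (\<lambda>s. g s - v s) < d)"
      by (intro exI[of _ "F n"] conjI lpF allI impI approx_F)
  qed
qed

end

section \<open>Strong continuity and the generator on \<open>L^p\<close>\<close>

lemma lp_fun_exp: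
  assumes p: "p \<ge> 1" and a: "a > 0"
  shows "hfun p (\<lambda>s. complex_of_real (exp (- a * s)))"
proof -
  have "integrable half_line (\<lambda>s. indicator {0..} s * exp (- (a * p) * s))"
    using has_bochner_integral_half_lineI[OF _ _ has_integral_exp_minus_to_infinity[of "a * p" 0]] p a
    by (auto simp: has_bochner_integral_iff)
  moreover have "norm (complex_of_real (exp (- a * s))) powr p = indicator {0..} s * exp (- (a * p) * s)" if "s > 0" for s
    using that by (simp add: powr_def algebra_simps)
  ultimately have "integrable half_line (\<lambda>s. norm (complex_of_real (exp (- a * s))) powr p)"
    by (subst Bochner_Integration.integrable_cong[OF refl]) auto
  then show ?thesis by (simp add: lp_fun_def)
qed

text \<open>The functions with the claimed property form a subspace \<open>V\<close>, and dominated
  convergence puts the exponentials into it. Since the group consists of isometries, the property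
  passes to limits of elements of \<open>V\<close>.\<close>

lemma T_grp_strongly_continuous:
  assumes p: "p \<ge> 1" and f: "hfun p f"
  shows "((\<lambda>t. hnorm p (\<lambda>s. T_grp p t f s - f s)) \<longlongrightarrow> 0) (at 0)"
proof -
  define V where "V = {v. hfun p v \<and> ((\<lambda>t. hnorm p (\<lambda>s. T_grp p t v s - v s)) \<longlongrightarrow> 0) (at 0)}"
  have sq: "((\<lambda>t. n t) \<longlongrightarrow> 0) (at 0)" if "(m \<longlongrightarrow> 0) (at 0)" "\<And>t. 0 \<le> n t" "\<And>t. n t \<le> m t" for n m :: "real \<Rightarrow> real"
    using tendsto_sandwich[OF _ _ tendsto_const that(1), of n] that by auto
  have V: "\<exists>v\<in>V. hnorm p (\<lambda>s. f s - v s) < e" if e: "e > 0" for e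
  proof (rule lp_dense[OF p, where \<alpha> = 0])
    show "hfun p v" if "v \<in> V" for v using that by (simp add: V_def)
    show "(\<lambda>s. v s + w s) \<in> V" if "v \<in> V" "w \<in> V" for v w
    proof -
      have vw: "hfun p v" "hfun p w" using that by (auto simp: V_def)
      have lim: "((\<lambda>t. hnorm p (\<lambda>s. T_grp p t v s - v s) + hnorm p (\<lambda>s. T_grp p t w s - w s)) \<longlongrightarrow> 0) (at 0)"
        using that tendsto_add[where a = "0::real" and b = "0::real"] by (auto simp: V_def)
      have "hnorm p (\<lambda>s. T_grp p t (\<lambda>s. v s + w s) s - (v s + w s)) \<le> 
        hnorm p (\<lambda>s. T_grp p t v s - v s) + hnorm p (\<lambda>s. T_grp p t w s - w s)" for t
      proof -
        have "(\<lambda>s. T_grp p t (\<lambda>s. v s + w s) s - (v s + w s)) = (\<lambda>s. (T_grp p t v s - v s) + (T_grp p t w s - w s))"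
          by (auto simp: T_grp_def algebra_simps)
        then show ?thesis
          using lp_norm_triangle[OF p lp_fun_diff[OF p lp_fun_T_grp[OF vw(1)] vw(1)] lp_fun_diff[OF p lp_fun_T_grp[OF vw(2)] vw(2)]]
          by simp
      qed
      then have "((\<lambda>t. hnorm p (\<lambda>s. T_grp p t (\<lambda>s. v s + w s) s - (v s + w s))) \<longlongrightarrow> 0) (at 0)"
        by (intro sq[OF lim]) auto
      then show ?thesis using lp_fun_add[OF p vw] by (simp add: V_def)
    qed
    show "(\<lambda>s. c * v s) \<in> V" if "v \<in> V" for c v
    proof -
      have "(\<lambda>s. T_grp p t (\<lambda>s. c * v s) s - c * v s) = (\<lambda>s. c * (T_grp p t v s - v s))" for t
        by (auto simp: T_grp_def algebra_simps)
      then have "hnorm p (\<lambda>s. T_grp p t (\<lambda>s. c * v s) s - c * v s) = norm c * hnorm p (\<lambda>s. T_grp p t v s - v s)" for t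
        by (simp add: lp_norm_cmult[OF p])
      then show ?thesis using that lp_fun_cmult[of half_line p v c] tendsto_mult_right_zero
        by (auto simp: V_def)
    qed
    show "(\<lambda>s. complex_of_real (s powr 0 * exp (- (real k + 1) * s))) \<in> V" for k
    proof -
      define a where "a = real k + 1"
      have a: "a > 0" by (simp add: a_def)
      define v where "v s = complex_of_real (s powr 0 * exp (- a * s))" for s
      have ve: "v s = complex_of_real (exp (- a * s))" if "s > 0" for s using that by (simp add: v_def)
      have vm [measurable]: "v \<in> borel_measurable half_line" unfolding v_def by measurable
      have lpv: "hfun p v"
        by (rule lp_fun_bound[OF p lp_fun_exp[OF p a]]) (auto intro!: AE_half_line simp: ve)
      have "((\<lambda>t. hnorm p (\<lambda>s. T_grp p t v s - v s)) \<longlongrightarrow> 0) (at 0)"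
        unfolding tendsto_at_iff_sequentially
      proof (intro allI impI)
        fix X :: "nat \<Rightarrow> real" assume X: "X \<longlonglongrightarrow> 0"
        then have "Bseq X" by (rule convergent_imp_Bseq[OF convergentI])
        then obtain B where B: "B > 0" "\<And>n. \<bar>X n\<bar> \<le> B" by (auto simp: Bseq_def)
        have "(\<lambda>i. hnorm p (\<lambda>s. T_grp p (X i) v s - v s)) \<longlonglongrightarrow> 0"
        proof (rule lp_dominated_convergence(2)[OF p])
          \<comment> \<open>Along a sequence bounded by \<open>B\<close> all the dilated
            exponentials lie below the one with the slowest decay rate,
            \<open>a * exp (- B)\<close>.\<close>
          show "hfun p (\<lambda>s. complex_of_real (exp B) * complex_of_real (exp (- (a * exp (- B)) * s)))"
            by (intro lp_fun_cmult lp_fun_exp p) (use a in auto)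
          show "AE s in half_line. (\<lambda>i. T_grp p (X i) v s) \<longlonglongrightarrow> v s"
          proof (rule AE_half_line)
            fix s :: real assume s: "s > 0"
            have "(\<lambda>i. complex_of_real (exp (- X i / p)) * complex_of_real (exp (- a * (exp (- X i) * s)))) \<longlonglongrightarrow> complex_of_real (exp (- 0 / p)) * complex_of_real (exp (- a * (exp (- 0) * s)))"
              by (intro tendsto_intros X) (use p in auto)
            then show "(\<lambda>i. T_grp p (X i) v s) \<longlonglongrightarrow> v s"
              using s by (simp add: T_grp_def ve)
          qed
          show "AE s in half_line. norm (T_grp p (X i) v s) \<le> norm (complex_of_real (exp B) * complex_of_real (exp (- (a * exp (- B)) * s)))" for i
          proof (rule AE_half_line)
            fix s :: real assume s: "s > 0"
            have "- X i / p \<le> \<bar>X i\<bar> / 1" using p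
              by (metis abs_ge_minus_self abs_ge_zero divide_right_mono frac_le order_trans zero_less_one le_numeral_extra(4) order.trans zero_le_one)
            then have e1: "exp (- X i / p) \<le> exp B" using B(2)[of i] by simp
            have "exp (- B) \<le> exp (- X i)" using B(2)[of i] by simp
            then have "a * exp (- B) * s \<le> a * exp (- X i) * s" using a s by (intro mult_right_mono mult_left_mono) auto
            then have e2: "exp (- a * (exp (- X i) * s)) \<le> exp (- (a * exp (- B)) * s)" by simp
            show "norm (T_grp p (X i) v s) \<le> norm (complex_of_real (exp B) * complex_of_real (exp (- (a * exp (- B)) * s)))"
              using mult_mono[OF e1 e2] s by (simp add: T_grp_def ve norm_mult)
          qed
        qed (use lp_fun_T_grp[OF lpv] in \<open>auto simp: lp_fun_def\<close>)
        then show "((\<lambda>t. hnorm p (\<lambda>s. T_grp p t v s - v s)) \<circ> X) \<longlonglongrightarrow> 0"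
          by (simp add: o_def)
      qed
      then show ?thesis using lpv unfolding V_def v_def a_def by simp
    qed
  qed (use f e in auto)
  show ?thesis
  proof (rule tendstoI)
    fix e :: real assume e: "e > 0"
    obtain v where v: "v \<in> V" "hnorm p (\<lambda>s. f s - v s) < e / 3" using V[of "e / 3"] e by auto
    have lpv: "hfun p v" using v by (simp add: V_def)
    have "eventually (\<lambda>t. hnorm p (\<lambda>s. T_grp p t v s - v s) < e / 3) (at 0)"
      using v e by (intro order_tendstoD(2)[where y = 0]) (auto simp: V_def)
    then show "\<forall>\<^sub>F t in at 0. dist (hnorm p (\<lambda>s. T_grp p t f s - f s)) 0 < e"
    proof eventually_elim
      case (elim t)
      have "(\<lambda>s. T_grp p t f s - T_grp p t v s) = T_grp p t (\<lambda>s. f s - v s)" by (auto simp: T_grp_def algebra_simps)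
      then have "hnorm p (\<lambda>s. T_grp p t f s - T_grp p t v s) < e / 3"
        using v by (simp add: lp_norm_T_grp[OF p])
      then have "hnorm p (\<lambda>s. T_grp p t f s - f s) < e"
        using lp_norm_triangle3[OF p lp_fun_T_grp[OF f] lp_fun_T_grp[OF lpv] f, of t t] 
           lp_norm_triangle3[OF p lp_fun_T_grp[OF lpv] lpv f, of t] elim v lp_norm_minus_commute[of half_line p f v]
        by simp
      then show ?case by simp
    qed
  qed
qed

text \<open>The defining limit of the generator in the norm of \<open>L^p\<close>, two-sided because
  it concerns a group. Membership of \<open>f\<close> and \<open>g\<close> in \<open>L^p\<close> is
  kept as a separate hypothesis.\<close>

definition lp_gen :: "real \<Rightarrow> (real \<Rightarrow> complex) \<Rightarrow> (real \<Rightarrow> complex) \<Rightarrow> bool" where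
  "lp_gen p f g \<longleftrightarrow> ((\<lambda>t. hnorm p (\<lambda>s. (T_grp p t f s - f s) / complex_of_real t - g s)) \<longlongrightarrow> 0) (at 0)"

lemma lp_fun_quot:
  assumes p: "p \<ge> 1" and f: "hfun p f" and g: "hfun p g"
  shows "hfun p (\<lambda>s. (T_grp p t f s - f s) / complex_of_real t - g s)"
proof -
  have "hfun p (\<lambda>s. (1 / complex_of_real t) * (T_grp p t f s - f s) - g s)"
    by (intro lp_fun_diff lp_fun_cmult lp_fun_T_grp p f g)
  then show ?thesis by simp
qed

text \<open>The quotient at \<open>- t\<close> is \<open>T_grp p (- t)\<close> applied to the
  quotient at \<open>t\<close>. As this map is an isometry, the left-hand limit follows from the
  right-hand one and strong continuity at \<open>g\<close>.\<close>

lemma lp_genI_right: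
  assumes p: "p \<ge> 1" and f: "hfun p f" and g: "hfun p g"
    and lim: "((\<lambda>t. hnorm p (\<lambda>s. (T_grp p t f s - f s) / complex_of_real t - g s)) \<longlongrightarrow> 0) (at_right 0)"
  shows "lp_gen p f g"
proof -
  let ?n = "\<lambda>t. hnorm p (\<lambda>s. (T_grp p t f s - f s) / complex_of_real t - g s)"
  have "((\<lambda>t. ?n (- t)) \<longlongrightarrow> 0) (at_right 0)"
  proof (rule tendsto_sandwich[OF _ _ tendsto_const])
    have "((\<lambda>t. hnorm p (\<lambda>s. T_grp p t g s - g s)) \<longlongrightarrow> 0) (at_left 0)"
      using T_grp_strongly_continuous[OF p g] by (rule filterlim_mono[OF _ order_refl]) (simp add: at_le)
    then have "((\<lambda>t. hnorm p (\<lambda>s. T_grp p (- t) g s - g s)) \<longlongrightarrow> 0) (at_right 0)"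
      by (simp add: filterlim_at_left_to_right)
    from tendsto_add[OF lim this]
    show "((\<lambda>t. ?n t + hnorm p (\<lambda>s. T_grp p (- t) g s - g s)) \<longlongrightarrow> 0) (at_right 0)" by simp
    have "?n (- t) \<le> ?n t + hnorm p (\<lambda>s. T_grp p (- t) g s - g s)" for t
    proof -
      let ?q = "\<lambda>s. (T_grp p t f s - f s) / complex_of_real t - g s"
      have "T_grp p (- t) (T_grp p t f) = f"
        by (auto simp: T_grp_def exp_add[symmetric] mult.assoc[symmetric] exp_minus simp flip: of_real_mult)
      then have "T_grp p (- t) (T_grp p t f) s = f s" for s by simp
      then have "(\<lambda>s. (T_grp p (- t) f s - f s) / complex_of_real (- t) - g s) =
        (\<lambda>s. T_grp p (- t) ?q s + (T_grp p (- t) g s - g s))"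
        by (simp add: T_grp_def algebra_simps diff_divide_distrib fun_eq_iff)
      then show ?thesis
        using lp_norm_triangle[OF p lp_fun_T_grp[OF lp_fun_quot[OF p f g]] lp_fun_diff[OF p lp_fun_T_grp[OF g] g], of "- t" t "- t"]
        by (simp add: lp_norm_T_grp[OF p])
    qed
    then show "\<forall>\<^sub>F t in at_right 0. ?n (- t) \<le> ?n t + hnorm p (\<lambda>s. T_grp p (- t) g s - g s)" by simp
  qed auto
  then have "(?n \<longlongrightarrow> 0) (at_left 0)" by (simp add: filterlim_at_left_to_right)
  with lim show ?thesis unfolding lp_gen_def by (simp add: filterlim_at_split)
qed

lemma lp_gen_diff:
  assumes p: "p \<ge> 1" and f: "hfun p f" "hfun p g" "hfun p f'" "hfun p g'"
    and gen: "lp_gen p f g" "lp_gen p f' g'"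
  shows "lp_gen p (\<lambda>s. f s - f' s) (\<lambda>s. g s - g' s)"
  unfolding lp_gen_def
proof (rule tendsto_sandwich[OF _ _ tendsto_const])
  let ?n = "\<lambda>f g t. hnorm p (\<lambda>s. (T_grp p t f s - f s) / complex_of_real t - g s)"
  show "((\<lambda>t. ?n f g t + ?n f' g' t) \<longlongrightarrow> 0) (at 0)"
    using tendsto_add[OF gen[unfolded lp_gen_def]] by simp
  have "?n (\<lambda>s. f s - f' s) (\<lambda>s. g s - g' s) t \<le> ?n f g t + ?n f' g' t" for t
  proof -
    have "(\<lambda>s. (T_grp p t (\<lambda>s. f s - f' s) s - (f s - f' s)) / complex_of_real t - (g s - g' s)) = 
       (\<lambda>s. ((T_grp p t f s - f s) / complex_of_real t - g s) - ((T_grp p t f' s - f' s) / complex_of_real t - g' s))"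
      by (auto simp: T_grp_def diff_divide_distrib add_divide_distrib algebra_simps)
    then show ?thesis
      using lp_norm_triangle_diff[OF p lp_fun_quot[OF p f(1,2)] lp_fun_quot[OF p f(3,4)], of t t] by simp
  qed
  then show "\<forall>\<^sub>F t in at 0. ?n (\<lambda>s. f s - f' s) (\<lambda>s. g s - g' s) t \<le> ?n f g t + ?n f' g' t" by simp
qed auto

text \<open>A group of isometries has no real spectrum off zero: backwards in time the eigenfunction would grow.\<close>

lemma lp_gen_eigen:
  assumes p: "p \<ge> 1" and f: "hfun p f" and l: "l > 0" and gen: "lp_gen p f (\<lambda>s. - complex_of_real l * f s)"
  shows "hnorm p f = 0"
proof -
  let ?E = "\<lambda>t s. (T_grp p t f s - f s) / complex_of_real t - (- complex_of_real l * f s)"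
  have "((\<lambda>t. hnorm p (?E t)) \<longlongrightarrow> 0) (at_left 0)"
    using gen[unfolded lp_gen_def] by (rule filterlim_mono[OF _ order_refl]) (simp add: at_le)
  moreover have "\<forall>\<^sub>F t in at_left 0. l * hnorm p f \<le> hnorm p (?E t)"
    unfolding eventually_at_left_field
  proof (intro exI[of _ "-1"] conjI allI impI)
    fix t :: real assume t: "t > - 1" "t < 0"
    have lpE: "hfun p (?E t)" by (intro lp_fun_quot p f lp_fun_cmult)
    \<comment> \<open>For negative \<open>t\<close> the factor \<open>1 - l * t\<close> exceeds 1 by
      \<open>l * \<bar>t\<bar>\<close>, whereas \<open>T_grp\<close> keeps the norm; the excess must
      be made up by the error \<open>?E\<close>.\<close>
    have "(\<lambda>s. complex_of_real (1 - l * t) * f s) = (\<lambda>s. T_grp p t f s - complex_of_real t * ?E t s)"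
      using t by (auto simp: field_simps)
    then have "\<bar>1 - l * t\<bar> * hnorm p f = hnorm p (\<lambda>s. T_grp p t f s - complex_of_real t * ?E t s)"
      using lp_norm_cmult[OF p, of half_line "complex_of_real (1 - l * t)" f] unfolding norm_of_real by simp
    also have "\<dots> \<le> hnorm p f + \<bar>t\<bar> * hnorm p (?E t)"
      using lp_norm_triangle_diff[OF p lp_fun_T_grp[OF f] lp_fun_cmult[OF lpE, of "complex_of_real t"], of t]
      unfolding lp_norm_cmult[OF p] lp_norm_T_grp[OF p] norm_of_real .
    finally have "\<bar>t\<bar> * (l * hnorm p f) \<le> \<bar>t\<bar> * hnorm p (?E t)"
      using t mult_pos_neg[OF l t(2)] by (simp add: algebra_simps)
    then show "l * hnorm p f \<le> hnorm p (?E t)" using t by simp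
  qed simp
  ultimately have "l * hnorm p f \<le> 0"
    by (rule tendsto_lowerbound) simp
  then show ?thesis using l lp_norm_nonneg[of half_line p f] by (simp add: mult_le_0_iff)
qed

section \<open>Resolvents of the generator\<close>

text \<open>The operator \<open>kop (res_ker \<mu>)\<close> is the resolvent \<open>(\<Lambda> + 1/p + \<mu>)\<inverse>\<close> on \<open>L\<^sup>p\<close>.\<close>

definition res_ker :: "real \<Rightarrow> real \<Rightarrow> real" where
  "res_ker \<mu> u = (if u > 1 then u powr (- \<mu> - 1) else 0)"

lemma res_ker_measurable [measurable]: "res_ker \<mu> \<in> borel_measurable borel"
  unfolding res_ker_def[abs_def] by measurable

lemma kern_res_ker:
  assumes p: "p \<ge> 1" and \<mu>: "\<mu> \<ge> 0"
  shows "kern p (res_ker \<mu>)"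
  unfolding kern_def
proof (intro conjI allI impI)
  show "res_ker \<mu> \<in> borel_measurable half_line" by (rule measurable_half_line_borel) measurable
  show "0 \<le> res_ker \<mu> u" for u by (simp add: res_ker_def)
  have e: "- \<mu> - 1 - 1 / p < - 1"
  proof -
    have "1 / p > 0" using p by simp
    then show ?thesis using \<mu> by linarith
  qed
  show "integrable half_line (\<lambda>u. res_ker \<mu> u * u powr (- 1 / p))"
  proof (rule Bochner_Integration.integrable_bound)
    show "integrable half_line (\<lambda>u. indicator {1..} u * u powr (- \<mu> - 1 - 1 / p))"
      using has_bochner_integral_half_lineI[OF _ _ has_integral_powr_to_inf[OF e, of 1]]
      by (auto simp: has_bochner_integral_iff)
    show "(\<lambda>u. res_ker \<mu> u * u powr (- 1 / p)) \<in> borel_measurable half_line"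
      by (rule measurable_half_line_borel) measurable
    show "AE u in half_line. norm (res_ker \<mu> u * u powr (- 1 / p)) \<le> norm (indicator {1..} u * u powr (- \<mu> - 1 - 1 / p))"
      by (rule AE_half_line) (auto simp: res_ker_def powr_add[symmetric])
  qed
qed

text \<open>The slice of the power \<open>u powr (- \<mu> - 1)\<close> that \<open>res_ker\<close>
  gains when it is dilated by \<open>exp (- t)\<close>. The half-open interval fits the strict
  inequality in \<open>res_ker\<close>, so that the two kernels add up to the power on
  \<open>u > exp (- t)\<close>.\<close>

definition avg_ker :: "real \<Rightarrow> real \<Rightarrow> real \<Rightarrow> real" where
  "avg_ker \<mu> t u = (if exp (- t) < u \<and> u \<le> 1 then u powr (- \<mu> - 1) else 0)"

lemma avg_ker_measurable [measurable]: "avg_ker \<mu> t \<in> borel_measurable borel"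
  unfolding avg_ker_def[abs_def] by measurable

lemma avg_ker_integral:
  assumes p: "p \<ge> 1" and \<mu>: "\<mu> \<ge> 0" and t: "t > 0"
  defines "l \<equiv> \<mu> + 1 / p"
  shows "has_bochner_integral half_line (\<lambda>u. avg_ker \<mu> t u * u powr (- 1 / p)) ((exp (l * t) - 1) / l)"
proof -
  have l: "l > 0" using p \<mu> by (simp add: l_def add_nonneg_pos)
  have "((\<lambda>u. u powr (- l - 1)) has_integral ((- 1 / l) * 1 powr (- l) - (- 1 / l) * exp (- t) powr (- l))) {exp (- t)..1}"
  proof (rule fundamental_theorem_of_calculus)
    fix x assume x: "x \<in> {exp (- t)..1}"
    have "exp (- t) > 0" by simp
    then have "x > 0" using x unfolding atLeastAtMost_iff by linarith
    then show "((\<lambda>u. - 1 / l * u powr (- l)) has_vector_derivative x powr (- l - 1)) (at x within {exp (- t)..1})"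
      unfolding has_real_derivative_iff_has_vector_derivative[symmetric] using l
      by (auto intro!: derivative_eq_intros)
  qed (use t in simp)
  also have "(- 1 / l) * 1 powr (- l) - (- 1 / l) * exp (- t) powr (- l) = (exp (l * t) - 1) / l"
    by (simp add: powr_def diff_divide_distrib)
  finally have "has_bochner_integral half_line (\<lambda>u. indicator {exp (- t)..1} u * u powr (- l - 1)) ((exp (l * t) - 1) / l)"
    by (intro has_bochner_integral_half_lineI) (auto intro: order_trans[OF exp_ge_zero])
  moreover have "AE u in half_line. u \<noteq> exp (- t)"
    unfolding half_line_def using AE_lborel_singleton[of "exp (- t)"] by (subst AE_restrict_space_iff) auto
  then have ae: "AE u in half_line. indicator {exp (- t)..1} u * u powr (- l - 1) = avg_ker \<mu> t u * u powr (- 1 / p)"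
    by eventually_elim (auto simp: avg_ker_def indicator_def powr_add[symmetric] l_def algebra_simps)
  ultimately show ?thesis
    by (subst (asm) has_bochner_integral_cong_AE[OF _ _ ae]) (auto intro!: measurable_half_line_borel)
qed

lemma kern_avg_ker:
  assumes "p \<ge> 1" "\<mu> \<ge> 0" "t > 0"
  shows "kern p (avg_ker \<mu> t)"
  unfolding kern_def
proof (intro conjI allI impI)
  show "avg_ker \<mu> t \<in> borel_measurable half_line" by (rule measurable_half_line_borel) measurable
  show "0 \<le> avg_ker \<mu> t u" for u by (simp add: avg_ker_def)
  show "integrable half_line (\<lambda>u. avg_ker \<mu> t u * u powr (- 1 / p))"
    using avg_ker_integral[OF assms] by (simp add: has_bochner_integral_iff)
qed

text \<open>Variation of constants: dilation reproduces a power kernel up to a factor, and only its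
  lower limit moves from 1 to \<open>exp (- t)\<close>.\<close>

lemma T_grp_res:
  assumes p: "p \<ge> 1" and \<mu>: "\<mu> \<ge> 0" and t: "t > 0" and K: "hfun p K"
  shows "AE s in half_line. T_grp p t (kop (res_ker \<mu>) K) s = 
    complex_of_real (exp (- (\<mu> + 1 / p) * t)) * (kop (res_ker \<mu>) K s + kop (avg_ker \<mu> t) K s)"
  using kop_kernel_add[OF p kern_res_ker[OF p \<mu>] kern_avg_ker[OF p \<mu> t] K]
proof eventually_elim
  case (elim s)
  define c where "c = exp (- t)"
  have c: "c > 0" "c < 1" using t by (auto simp: c_def)
  have "T_grp p t (kop (res_ker \<mu>) K) s = complex_of_real (exp (- t / p)) * (\<integral>u. res_ker \<mu> (c * u / c) *\<^sub>R K (s * (c * u)) \<partial>half_line)"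
    using c by (simp add: T_grp_def kop_def c_def mult_ac)
  also have "(\<integral>u. res_ker \<mu> (c * u / c) *\<^sub>R K (s * (c * u)) \<partial>half_line) = (1 / c) *\<^sub>R (\<integral>v. res_ker \<mu> (v / c) *\<^sub>R K (s * v) \<partial>half_line)"
    by (rule integral_half_line_scale[OF c(1)])
  also have "(\<integral>v. res_ker \<mu> (v / c) *\<^sub>R K (s * v) \<partial>half_line) = (\<integral>v. c powr (\<mu> + 1) *\<^sub>R ((res_ker \<mu> v + avg_ker \<mu> t v) *\<^sub>R K (s * v)) \<partial>half_line)"
  proof (rule Bochner_Integration.integral_cong[OF refl])
    fix v assume "v \<in> space half_line"
    then have v: "v > 0" by simp
    have "(v / c) powr (- (\<mu> + 1)) = c powr (\<mu> + 1) * v powr (- (\<mu> + 1))"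
      using c v by (simp only: powr_divide powr_minus) (simp add: field_simps)
    then have "(v / c) powr (- \<mu> - 1) = c powr (\<mu> + 1) * v powr (- \<mu> - 1)"
      by (simp only: minus_add_distrib diff_conv_add_uminus)
    then have "res_ker \<mu> (v / c) = c powr (\<mu> + 1) * (res_ker \<mu> v + avg_ker \<mu> t v)"
      using c v unfolding res_ker_def avg_ker_def c_def[symmetric] by (auto simp: less_divide_eq)
    then show "res_ker \<mu> (v / c) *\<^sub>R K (s * v) = c powr (\<mu> + 1) *\<^sub>R ((res_ker \<mu> v + avg_ker \<mu> t v) *\<^sub>R K (s * v))" by simp
  qed
  also have "\<dots> = c powr (\<mu> + 1) *\<^sub>R kop (\<lambda>v. res_ker \<mu> v + avg_ker \<mu> t v) K s"
    by (simp add: kop_def del: scaleR_scaleR)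
  finally have "T_grp p t (kop (res_ker \<mu>) K) s = complex_of_real (exp (- t / p) * (1 / c) * c powr (\<mu> + 1)) * kop (\<lambda>v. res_ker \<mu> v + avg_ker \<mu> t v) K s"
    by (simp add: scaleR_conv_of_real mult_ac)
  also have "exp (- t / p) * (1 / c) * c powr (\<mu> + 1) = exp (- (\<mu> + 1 / p) * t)"
    by (simp add: c_def powr_def exp_add[symmetric] exp_minus[symmetric] divide_inverse) (simp add: field_simps)
  finally show ?case using elim by simp
qed

text \<open>With \<open>u = exp (- r)\<close> the operator is an average of the functions
  \<open>T_grp p r K\<close> over \<open>0 \<le> r < t\<close> with total mass \<open>m\<close>, so
  it is close to \<open>m * K\<close> whenever these functions are close to
  \<open>K\<close>.\<close>

lemma avg_approx:
  assumes p: "p \<ge> 1" and \<mu>: "\<mu> \<ge> 0" and t: "t > 0" and K: "hfun p K" and e: "e \<ge> 0"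
    and bound: "\<And>r. 0 \<le> r \<Longrightarrow> r < t \<Longrightarrow> hnorm p (\<lambda>s. T_grp p r K s - K s) \<le> e"
  defines "m \<equiv> (exp ((\<mu> + 1 / p) * t) - 1) / (\<mu> + 1 / p)"
  shows "hnorm p (\<lambda>s. kop (avg_ker \<mu> t) K s - complex_of_real m * K s) \<le> m * e"
proof -
  define w where "w u = avg_ker \<mu> t u * u powr (- 1 / p)" for u
  define F where "F s u = complex_of_real (u powr (1 / p)) * K (u * s) - K s" for s u
  have [measurable]: "K \<in> borel_measurable half_line" using K by (simp add: lp_fun_def)
  have wi: "has_bochner_integral half_line w m"
    unfolding w_def m_def by (rule avg_ker_integral[OF p \<mu> t])
  then have wint: "integrable half_line w" and wm: "(\<integral>u. w u \<partial>half_line) = m" by (auto simp: has_bochner_integral_iff)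
  have b: "hfun p (\<lambda>s. F s u) \<and> hnorm p (\<lambda>s. F s u) \<le> e" if "u \<in> space half_line" "w u \<noteq> 0" for u
  proof -
    have u: "u > 0" "exp (- t) < u" "u \<le> 1" using that by (auto simp: w_def avg_ker_def split: if_splits)
    define r where "r = - ln u"
    have r: "0 \<le> r" "r < t" using u ln_less_cancel_iff[of "exp (- t)" u] by (auto simp: r_def)
    have "(\<lambda>s. F s u) = (\<lambda>s. T_grp p r K s - K s)"
      using u by (auto simp: F_def T_grp_def r_def powr_def)
    then show ?thesis using bound[OF r] lp_fun_diff[OF p lp_fun_T_grp[OF K] K, of r] by simp
  qed
  have w0: "0 \<le> w u" for u by (simp add: w_def avg_ker_def)
  have Fm: "(\<lambda>(s, u). F s u) \<in> borel_measurable (half_line \<Otimes>\<^sub>M half_line)"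
    unfolding F_def by measurable
  note mi = minkowski_integral[OF p sigma_finite_half_line sigma_finite_half_line wint w0 Fm e b]
  have "AE s in half_line. (\<integral>u. w u *\<^sub>R F s u \<partial>half_line) = kop (avg_ker \<mu> t) K s - complex_of_real m * K s"
    using kop_bounded(1)[OF p kern_avg_ker[OF p \<mu> t] K]
  proof eventually_elim
    case (elim s)
    have "(\<integral>u. w u *\<^sub>R F s u \<partial>half_line) = (\<integral>u. avg_ker \<mu> t u *\<^sub>R K (s * u) - w u *\<^sub>R K s \<partial>half_line)"
    proof (rule Bochner_Integration.integral_cong[OF refl])
      fix u assume "u \<in> space half_line"
      then have u: "u > 0" by simp
      have "w u *\<^sub>R F s u = (avg_ker \<mu> t u * (u powr (- 1 / p) * u powr (1 / p))) *\<^sub>R K (s * u) - w u *\<^sub>R K s"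
        by (simp add: w_def F_def scaleR_conv_of_real algebra_simps)
      also have "u powr (- 1 / p) * u powr (1 / p) = 1" using u by (simp add: powr_add[symmetric])
      finally show "w u *\<^sub>R F s u = avg_ker \<mu> t u *\<^sub>R K (s * u) - w u *\<^sub>R K s" by simp
    qed
    also have "\<dots> = kop (avg_ker \<mu> t) K s - complex_of_real m * K s"
      using elim wint by (simp add: kop_def wm scaleR_conv_of_real)
    finally show ?case .
  qed
  then have "hnorm p (\<lambda>s. \<integral>u. w u *\<^sub>R F s u \<partial>half_line) = hnorm p (\<lambda>s. kop (avg_ker \<mu> t) K s - complex_of_real m * K s)"
    using mi(2) kop_bounded(2)[OF p kern_avg_ker[OF p \<mu> t] K] by (intro lp_norm_cong_AE) (auto simp: lp_fun_def)
  then show ?thesis using mi(3) by (simp add: wm)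
qed

text \<open>By \<open>T_grp_res\<close> the quotient minus the claimed value is \<open>a t\<close>
  times \<open>G\<close>, plus an averaging error, plus \<open>b t - 1\<close> times
  \<open>K\<close>. Both scalars tend to 0, and the averaging error is at most
  \<open>b t * e\<close>, where \<open>e\<close> bounds the distance from \<open>K\<close> to its
  translates \<open>T_grp p r K\<close> with \<open>r < t\<close>.\<close>

lemma lp_gen_res:
  assumes p: "p \<ge> 1" and \<mu>: "\<mu> \<ge> 0" and K: "hfun p K"
  shows "lp_gen p (kop (res_ker \<mu>) K) (\<lambda>s. K s - complex_of_real (\<mu> + 1 / p) * kop (res_ker \<mu>) K s)"
proof -
  define l where "l = \<mu> + 1 / p"
  have l: "l > 0" using p \<mu> by (simp add: l_def add_nonneg_pos)
  define G where "G = kop (res_ker \<mu>) K"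
  have G: "hfun p G" unfolding G_def by (rule kop_bounded(2)[OF p kern_res_ker[OF p \<mu>] K])
  have [measurable]: "G \<in> borel_measurable half_line" "K \<in> borel_measurable half_line"
    and [measurable]: "\<And>t. T_grp p t G \<in> borel_measurable half_line"
    using G K lp_fun_T_grp[OF G] by (auto simp: lp_fun_def)
  define m where "m t = (exp (l * t) - 1) / l" for t
  define a where "a t = (exp (- l * t) - 1) / t + l" for t
  define b where "b t = exp (- l * t) * m t / t" for t
  have a0: "(a \<longlongrightarrow> 0) (at_right 0)"
  proof -
    have "((\<lambda>t. exp (- l * t)) has_real_derivative - l) (at 0)"
      by (auto intro!: derivative_eq_intros)
    then have "((\<lambda>t. (exp (- l * t) - 1) / t) \<longlongrightarrow> - l) (at 0)"
      by (simp add: has_field_derivative_iff)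
    then have "((\<lambda>t. (exp (- l * t) - 1) / t) \<longlongrightarrow> - l) (at_right 0)"
      by (rule filterlim_mono[OF _ order_refl]) (simp add: at_le)
    from tendsto_add[OF this tendsto_const[of l]] show ?thesis by (simp add: a_def[abs_def])
  qed
  have b1: "(b \<longlongrightarrow> 1) (at_right 0)"
  proof -
    have "((\<lambda>t. exp (l * t)) has_real_derivative l) (at 0)"
      by (auto intro!: derivative_eq_intros)
    then have "((\<lambda>t. (exp (l * t) - 1) / t) \<longlongrightarrow> l) (at 0)"
      by (simp add: has_field_derivative_iff)
    then have "((\<lambda>t. exp (- l * t) * ((exp (l * t) - 1) / t) / l) \<longlongrightarrow> exp (- l * 0) * l / l) (at 0)"
      using l by (intro tendsto_intros) auto
    then have "((\<lambda>t. exp (- l * t) * ((exp (l * t) - 1) / t) / l) \<longlongrightarrow> exp (- l * 0) * l / l) (at_right 0)"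
      by (rule filterlim_mono[OF _ order_refl]) (simp add: at_le)
    then show ?thesis using l by (simp add: b_def[abs_def] m_def mult_ac)
  qed
  have bound: "hnorm p (\<lambda>s. (T_grp p t G s - G s) / complex_of_real t - (K s - complex_of_real l * G s))
    \<le> \<bar>a t\<bar> * hnorm p G + b t * e + \<bar>b t - 1\<bar> * hnorm p K"
    if t: "t > 0" and e: "e \<ge> 0" and be: "\<And>r. 0 \<le> r \<Longrightarrow> r < t \<Longrightarrow> hnorm p (\<lambda>s. T_grp p r K s - K s) \<le> e" for t e
  proof -
    define D where "D s = kop (avg_ker \<mu> t) K s - complex_of_real (m t) * K s" for s
    have A: "hfun p (kop (avg_ker \<mu> t) K)" by (rule kop_bounded(2)[OF p kern_avg_ker[OF p \<mu> t] K])
    have D: "hfun p D" unfolding D_def by (intro lp_fun_diff lp_fun_cmult p A K)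
    have Dn: "hnorm p D \<le> m t * e"
      unfolding D_def m_def l_def using avg_approx[OF p \<mu> t K e be] by simp
    let ?R = "\<lambda>s. (complex_of_real (a t) * G s + complex_of_real (exp (- l * t) / t) * D s) + complex_of_real (b t - 1) * K s"
    have "hnorm p (\<lambda>s. (T_grp p t G s - G s) / complex_of_real t - (K s - complex_of_real l * G s)) = hnorm p ?R"
    proof (rule lp_norm_cong_AE)
      show "AE s in half_line. (T_grp p t G s - G s) / complex_of_real t - (K s - complex_of_real l * G s) = ?R s"
        using T_grp_res[OF p \<mu> t K]
      proof eventually_elim
        case (elim s)
        have "T_grp p t G s = complex_of_real (exp (- l * t)) * (G s + D s + complex_of_real (m t) * K s)"
          using elim by (simp add: G_def l_def D_def)
        then show ?case using t by (simp add: a_def b_def field_simps)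
      qed
    qed (use D in \<open>auto simp: lp_fun_def\<close>)
    also have "\<dots> \<le> hnorm p (\<lambda>s. complex_of_real (a t) * G s + complex_of_real (exp (- l * t) / t) * D s) + hnorm p (\<lambda>s. complex_of_real (b t - 1) * K s)"
      by (intro lp_norm_triangle lp_fun_add lp_fun_cmult p G D K)
    also have "hnorm p (\<lambda>s. complex_of_real (a t) * G s + complex_of_real (exp (- l * t) / t) * D s)
       \<le> hnorm p (\<lambda>s. complex_of_real (a t) * G s) + hnorm p (\<lambda>s. complex_of_real (exp (- l * t) / t) * D s)"
      by (intro lp_norm_triangle lp_fun_cmult p G D)
    also have "hnorm p (\<lambda>s. complex_of_real (a t) * G s) = \<bar>a t\<bar> * hnorm p G"
      unfolding lp_norm_cmult[OF p] norm_of_real ..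
    also have "hnorm p (\<lambda>s. complex_of_real (b t - 1) * K s) = \<bar>b t - 1\<bar> * hnorm p K"
      unfolding lp_norm_cmult[OF p] norm_of_real ..
    also have "hnorm p (\<lambda>s. complex_of_real (exp (- l * t) / t) * D s) = (exp (- l * t) / t) * hnorm p D"
      unfolding lp_norm_cmult[OF p] norm_of_real using t by simp
    also have "\<dots> \<le> (exp (- l * t) / t) * (m t * e)"
      using t by (intro mult_left_mono Dn) auto
    also have "\<dots> = b t * e" by (simp add: b_def)
    finally show ?thesis by simp
  qed
  have "((\<lambda>t. hnorm p (\<lambda>s. (T_grp p t G s - G s) / complex_of_real t - (K s - complex_of_real l * G s))) \<longlongrightarrow> 0) (at_right 0)"
  proof (rule tendstoI)
    fix e :: real assume e: "e > 0"
    have "\<forall>\<^sub>F r in at 0. hnorm p (\<lambda>s. T_grp p r K s - K s) < e / 3"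
      using T_grp_strongly_continuous[OF p K] e by (intro order_tendstoD(2)) auto
    then obtain d where d: "d > 0" "\<And>r. r \<noteq> 0 \<Longrightarrow> \<bar>r\<bar> < d \<Longrightarrow> hnorm p (\<lambda>s. T_grp p r K s - K s) < e / 3"
      unfolding eventually_at by (auto simp: dist_real_def)
    \<comment> \<open>The limit at 0 says nothing about \<open>r = 0\<close> itself, where the
      difference vanishes.\<close>
    have d0: "hnorm p (\<lambda>s. T_grp p r K s - K s) \<le> e / 3" if "0 \<le> r" "r < d" for r
    proof (cases "r = 0")
      case True
      then show ?thesis using e p by (simp add: T_grp_def lp_norm_def)
    qed (use d(2)[of r] that in auto)
    have "((\<lambda>t. \<bar>a t\<bar> * hnorm p G + b t * (e / 3) + \<bar>b t - 1\<bar> * hnorm p K) \<longlongrightarrow> \<bar>0\<bar> * hnorm p G + 1 * (e / 3) + \<bar>1 - 1\<bar> * hnorm p K) (at_right 0)"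
      by (intro tendsto_intros a0 b1)
    then have "\<forall>\<^sub>F t in at_right 0. \<bar>a t\<bar> * hnorm p G + b t * (e / 3) + \<bar>b t - 1\<bar> * hnorm p K < e"
      by (rule order_tendstoD(2)) (use e in simp)
    moreover have "\<forall>\<^sub>F t in at_right 0. t < d \<and> t > 0"
      using d(1) eventually_at_right_real[of 0 d] by (auto elim: eventually_mono)
    ultimately show "\<forall>\<^sub>F t in at_right 0. dist (hnorm p (\<lambda>s. (T_grp p t G s - G s) / complex_of_real t - (K s - complex_of_real l * G s))) 0 < e"
    proof eventually_elim
      case (elim t)
      then show ?case using bound[of t "e / 3"] d0 e by fastforce
    qed
  qed
  then have "lp_gen p G (\<lambda>s. K s - complex_of_real l * G s)"
    by (intro lp_genI_right p G lp_fun_diff lp_fun_cmult K)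
  then show ?thesis by (simp add: G_def l_def)
qed

lemma res_injective:
  assumes p: "p \<ge> 1" and \<mu>: "\<mu> \<ge> 0" and K: "hfun p K"
    and z: "hnorm p (kop (res_ker \<mu>) K) = 0"
  shows "hnorm p K = 0"
proof -
  define G where "G = kop (res_ker \<mu>) K"
  define l where "l = \<mu> + 1 / p"
  have G: "hfun p G" unfolding G_def by (rule kop_bounded(2)[OF p kern_res_ker[OF p \<mu>] K])
  have [measurable]: "G \<in> borel_measurable half_line" "K \<in> borel_measurable half_line"
    and [measurable]: "\<And>t. T_grp p t G \<in> borel_measurable half_line"
    using G K lp_fun_T_grp[OF G] by (auto simp: lp_fun_def)
  have G0: "AE s in half_line. G s = 0" using z lp_norm_eq_0_iff[OF p G] by (simp add: G_def)
  have TG0: "AE s in half_line. T_grp p t G s = 0" for t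
    using z lp_norm_eq_0_iff[OF p lp_fun_T_grp[OF G]] by (simp add: G_def lp_norm_T_grp[OF p])
  have "hnorm p (\<lambda>s. (T_grp p t G s - G s) / complex_of_real t - (K s - complex_of_real l * G s)) = hnorm p (\<lambda>s. - 1 * K s)" for t
  proof (rule lp_norm_cong_AE)
    show "AE s in half_line. (T_grp p t G s - G s) / complex_of_real t - (K s - complex_of_real l * G s) = - 1 * K s"
      using G0 TG0[of t] by eventually_elim simp
  qed measurable
  then have "((\<lambda>t::real. hnorm p (\<lambda>s. - 1 * K s)) \<longlongrightarrow> 0) (at 0)"
    using lp_gen_res[OF p \<mu> K] by (simp add: lp_gen_def G_def l_def)
  then show ?thesis using lp_norm_cmult[OF p, of half_line "- 1" K] by (simp add: tendsto_const_iff)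
qed

text \<open>Converse of \<open>lp_gen_res\<close>: the difference of \<open>G\<close> and the
  resolvent applied to \<open>Q + (\<mu> + 1 / p) * G\<close> is an eigenfunction for
  \<open>- (\<mu> + 1 / p)\<close>, hence null. This is what makes the domain no larger than the
  range of the resolvent.\<close>

lemma lp_gen_imp_res:
  assumes p: "p \<ge> 1" and \<mu>: "\<mu> \<ge> 0" and G: "hfun p G" and Q: "hfun p Q"
    and gen: "lp_gen p G Q"
  shows "hnorm p (\<lambda>s. G s - kop (res_ker \<mu>) (\<lambda>s. Q s + complex_of_real (\<mu> + 1 / p) * G s) s) = 0"
proof -
  define l where "l = \<mu> + 1 / p"
  have l: "l > 0" using p \<mu> by (simp add: l_def add_nonneg_pos)
  define K where "K s = Q s + complex_of_real l * G s" for s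
  have K: "hfun p K" unfolding K_def by (intro lp_fun_add lp_fun_cmult p G Q)
  define R where "R = kop (res_ker \<mu>) K"
  have R: "hfun p R" unfolding R_def by (rule kop_bounded(2)[OF p kern_res_ker[OF p \<mu>] K])
  have "lp_gen p R (\<lambda>s. K s - complex_of_real l * R s)"
    using lp_gen_res[OF p \<mu> K] by (simp add: R_def l_def)
  then have "lp_gen p (\<lambda>s. G s - R s) (\<lambda>s. Q s - (K s - complex_of_real l * R s))"
    by (intro lp_gen_diff p G Q R gen lp_fun_diff lp_fun_cmult K)
  also have "(\<lambda>s. Q s - (K s - complex_of_real l * R s)) = (\<lambda>s. - complex_of_real l * (G s - R s))"
    by (auto simp: K_def algebra_simps)
  finally show ?thesis
    using lp_gen_eigen[OF p lp_fun_diff[OF p G R] l] by (simp add: R_def K_def[abs_def] l_def)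
qed

section \<open>Fractional kernels\<close>

lemma integral_half_line_shift:
  fixes f :: "real \<Rightarrow> 'b::{banach, second_countable_topology}"
  assumes "t \<ge> 0"
  shows "(\<integral>x. f (t + x) \<partial>half_line) = (\<integral>s. indicator {t<..} s *\<^sub>R f s \<partial>half_line)"
proof -
  have "(\<integral>s. indicator {t<..} s *\<^sub>R f s \<partial>half_line) = (\<integral>s. indicator {t<..} s *\<^sub>R f s \<partial>lborel)"
    unfolding integral_half_line set_lebesgue_integral_def
    by (rule Bochner_Integration.integral_cong) (use assms in \<open>auto simp: indicator_def\<close>)
  also have "\<dots> = \<bar>1\<bar> *\<^sub>R (\<integral>x. indicator {t<..} (t + 1 * x) *\<^sub>R f (t + 1 * x) \<partial>lborel)"
    by (rule lborel_integral_real_affine) simp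
  also have "\<dots> = (\<integral>x. f (t + x) \<partial>half_line)"
    unfolding integral_half_line set_lebesgue_integral_def by (simp add: indicator_def)
  finally show ?thesis ..
qed

lemma integrable_half_line_shift:
  fixes f :: "real \<Rightarrow> 'b::{banach, second_countable_topology}"
  assumes "t \<ge> 0"
  shows "integrable half_line (\<lambda>x. f (t + x)) \<longleftrightarrow> integrable half_line (\<lambda>s. indicator {t<..} s *\<^sub>R f s)"
proof -
  have "integrable half_line (\<lambda>s. indicator {t<..} s *\<^sub>R f s) \<longleftrightarrow> integrable lborel (\<lambda>s. indicator {t<..} s *\<^sub>R f s)"
    unfolding integrable_half_line set_integrable_def
    by (rule Bochner_Integration.integrable_cong) (use assms in \<open>auto simp: indicator_def\<close>)
  also have "\<dots> \<longleftrightarrow> integrable lborel (\<lambda>x. indicator {t<..} (t + 1 * x) *\<^sub>R f (t + 1 * x))"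
    by (rule lborel_integrable_real_affine_iff[symmetric]) simp
  also have "\<dots> \<longleftrightarrow> integrable half_line (\<lambda>x. f (t + x))"
    unfolding integrable_half_line set_integrable_def by (simp add: indicator_def)
  finally show ?thesis ..
qed

text \<open>The substitution \<open>t * u = t + x\<close> leads from operators over
  \<open>u > 1\<close> to Weyl integrals over \<open>x > 0\<close>.\<close>

lemma integral_half_line_dilate_shift:
  fixes f :: "real \<Rightarrow> 'b::{banach, second_countable_topology}"
  assumes t: "t > 0"
  shows "(\<integral>u. indicator {1<..} u *\<^sub>R f (t * u) \<partial>half_line) = (1 / t) *\<^sub>R (\<integral>x. f (t + x) \<partial>half_line)"
proof -
  have "(\<integral>u. indicator {1<..} u *\<^sub>R f (t * u) \<partial>half_line) = (\<integral>u. (\<lambda>s. indicator {t<..} s *\<^sub>R f s) (t * u) \<partial>half_line)"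
    by (rule Bochner_Integration.integral_cong) (use t in \<open>auto simp: indicator_def\<close>)
  also have "\<dots> = (1 / t) *\<^sub>R (\<integral>s. indicator {t<..} s *\<^sub>R f s \<partial>half_line)"
    by (rule integral_half_line_scale[OF t])
  finally show ?thesis using t by (simp add: integral_half_line_shift)
qed

text \<open>Kernels of Erdelyi-Kober fractional integrals. Up to constants, the exponents
  \<open>- \<gamma>\<close> and \<open>- (k + 1)\<close> produce the weighted Weyl derivative of
  order \<open>k + \<gamma>\<close> from the weighted ordinary derivative of order
  \<open>k + 1\<close>, and \<open>g - 1\<close> and \<open>- g\<close> recover a function from its
  weighted Weyl derivative of order \<open>g\<close>.\<close>

definition weyl_ker :: "real \<Rightarrow> real \<Rightarrow> real \<Rightarrow> real" where
  "weyl_ker a b u = (if u > 1 then (u - 1) powr a * u powr b else 0)"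

lemma weyl_ker_measurable [measurable]: "weyl_ker a b \<in> borel_measurable borel"
  unfolding weyl_ker_def[abs_def] by measurable

lemma kern_weyl_ker:
  assumes p: "p \<ge> 1" and a: "a > - 1" and ab: "a + b - 1 / p < - 1"
  shows "kern p (weyl_ker a b)"
  unfolding kern_def
proof (intro conjI allI impI)
  show "weyl_ker a b \<in> borel_measurable half_line" by (rule measurable_half_line_borel) measurable
  show "0 \<le> weyl_ker a b u" for u by (simp add: weyl_ker_def)
  have "integrable half_line (\<lambda>x. x powr a * (1 + x) powr (b - 1 / p))"
    by (rule integrable_half_line_powr) (use a ab in auto)
  then have "integrable half_line (\<lambda>x. (\<lambda>u. (u - 1) powr a * u powr (b - 1 / p)) (1 + x))" by simp
  then have "integrable half_line (\<lambda>u. indicator {1<..} u *\<^sub>R ((u - 1) powr a * u powr (b - 1 / p)))"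
    by (subst (asm) integrable_half_line_shift) auto
  moreover have "indicator {1<..} u *\<^sub>R ((u - 1) powr a * u powr (b - 1 / p)) = weyl_ker a b u * u powr (- 1 / p)" for u
    by (auto simp: weyl_ker_def indicator_def powr_add[symmetric] algebra_simps)
  ultimately show "integrable half_line (\<lambda>u. weyl_ker a b u * u powr (- 1 / p))" by simp
qed

text \<open>Under \<open>u = 1 + (w - 1) * t\<close> the integral over \<open>1 < u < w\<close>
  becomes a Beta integral. The second exponents are chosen so that all powers of \<open>u\<close>
  cancel; the powers of \<open>w - 1\<close> cancel as well, and \<open>1 / w\<close>
  remains.\<close>

lemma weyl_ker_beta:
  assumes g: "0 < g" "g < 1" and w: "w > 0"
  shows "(\<integral>\<^sup>+u. ennreal (weyl_ker (g - 1) (- g) u * weyl_ker (- g) (- 1) (w / u) / u) \<partial>half_line)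
    = ennreal (Beta g (1 - g) * res_ker 0 w)"
proof (cases "w > 1")
  case False
  have z: "weyl_ker (g - 1) (- g) u * weyl_ker (- g) (- 1) (w / u) / u = 0" if "u > 0" for u
    using False that w by (auto simp: weyl_ker_def less_divide_eq)
  have "(\<integral>\<^sup>+u. ennreal (weyl_ker (g - 1) (- g) u * weyl_ker (- g) (- 1) (w / u) / u) \<partial>half_line) = (\<integral>\<^sup>+u. 0 \<partial>half_line)"
    by (intro nn_integral_cong) (metis z ennreal_0 space_half_line greaterThan_iff)
  then show ?thesis using False by (simp add: res_ker_def)
next
  case True
  note half_line_id_borel [measurable del]
  define f where "f u = indicator {1<..<w} u * ((1 / w) * ((u - 1) powr (g - 1) * (w - u) powr (- g)))" for u
  have fm: "(\<lambda>u. ennreal (f u)) \<in> borel_measurable borel" unfolding f_def by measurable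
  have am: "(\<lambda>t. 1 + (w - 1) * t) \<in> borel_measurable lborel"
    by (intro borel_measurable_add borel_measurable_times borel_measurable_const) simp
  have "(\<integral>\<^sup>+u. ennreal (weyl_ker (g - 1) (- g) u * weyl_ker (- g) (- 1) (w / u) / u) \<partial>half_line) = (\<integral>\<^sup>+u. ennreal (f u) \<partial>half_line)"
  proof (rule nn_integral_cong)
    fix u assume "u \<in> space half_line"
    then have u: "u > 0" by simp
    show "ennreal (weyl_ker (g - 1) (- g) u * weyl_ker (- g) (- 1) (w / u) / u) = ennreal (f u)"
    proof (cases "1 < u \<and> u < w")
      case True
      have "(w / u - 1) powr (- g) = ((w - u) / u) powr (- g)" using u by (simp add: diff_divide_distrib)
      also have "\<dots> = (w - u) powr (- g) / u powr (- g)" using u True by (simp add: powr_divide)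
      finally have "weyl_ker (g - 1) (- g) u * weyl_ker (- g) (- 1) (w / u) / u = 
        (u - 1) powr (g - 1) * u powr (- g) * ((w - u) powr (- g) / u powr (- g) * (w / u) powr (- 1)) / u"
        using True u by (simp add: weyl_ker_def less_divide_eq)
      also have "\<dots> = f u" using True u w by (simp add: f_def powr_minus_divide)
      finally show ?thesis by simp
    next
      case False
      then show ?thesis using u by (auto simp: weyl_ker_def f_def less_divide_eq indicator_def)
    qed
  qed
  also have "\<dots> = (\<integral>\<^sup>+u. ennreal (f u) \<partial>lborel)"
    unfolding nn_integral_half_line
    by (rule nn_integral_cong) (use w in \<open>auto simp: f_def indicator_def\<close>)
  also have "\<dots> = ennreal \<bar>w - 1\<bar> * (\<integral>\<^sup>+t. ennreal (f (1 + (w - 1) * t)) \<partial>lborel)"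
    using True by (intro nn_integral_real_affine fm) auto
  also have "\<dots> = (\<integral>\<^sup>+t. ennreal \<bar>w - 1\<bar> * ennreal (f (1 + (w - 1) * t)) \<partial>lborel)"
    by (rule nn_integral_cmult[symmetric]) (rule measurable_compose[OF am fm])
  also have "\<dots> = (\<integral>\<^sup>+t. ennreal (1 / w) * (ennreal (t powr (g - 1) * (1 - t) powr (1 - g - 1)) * indicator {0..1} t) \<partial>lborel)"
  proof (rule nn_integral_cong)
    fix t :: real
    have "\<bar>w - 1\<bar> * f (1 + (w - 1) * t) = (1 / w) * (t powr (g - 1) * (1 - t) powr (1 - g - 1)) * indicator {0..1} t"
    proof (cases "0 < t \<and> t < 1")
      case t: True
      have "(w - 1) * t < (w - 1) * 1" by (rule mult_strict_left_mono) (use True t in auto)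
      then have "1 + (w - 1) * t < 1 + (w - 1) * 1" by (rule add_strict_left_mono)
      also have "1 + (w - 1) * 1 = w" by simp
      finally have ex2: "1 + (w - 1) * t < w" .
      have ex: "1 < 1 + (w - 1) * t" using True t by simp
      have e2: "w - (1 + (w - 1) * t) = (w - 1) * (1 - t)" by (simp add: algebra_simps)
      have "f (1 + (w - 1) * t) = (1 / w) * (((w - 1) powr (g - 1) * (w - 1) powr (- g)) * (t powr (g - 1) * (1 - t) powr (- g)))"
        unfolding f_def e2 using True t ex ex2 by (simp add: powr_mult mult_ac)
      also have "(w - 1) powr (g - 1) * (w - 1) powr (- g) = (w - 1) powr (- 1)"
        by (subst powr_add[symmetric]) simp
      also have "(w - 1) powr (- 1) = 1 / (w - 1)" using True by (simp add: powr_minus_divide)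
      finally show ?thesis using True t by simp
    next
      case t: False
      then have "(w - 1) * t \<le> 0 \<or> w - 1 \<le> (w - 1) * t"
        using True mult_left_mono[of 1 t "w - 1"] mult_nonneg_nonpos[of "w - 1" t] by (cases "t \<le> 0") auto
      then have "f (1 + (w - 1) * t) = 0" by (auto simp: f_def indicator_def)
      moreover have "t powr (g - 1) * (1 - t) powr (1 - g - 1) * indicator {0..1} t = 0"
        using t by (cases "t = 0 \<or> t = 1") (auto simp: indicator_def)
      ultimately show ?thesis by auto
    qed
    then have "ennreal \<bar>w - 1\<bar> * ennreal (f (1 + (w - 1) * t)) = ennreal ((1 / w) * (t powr (g - 1) * (1 - t) powr (1 - g - 1)) * indicator {0..1} t)"
      by (subst ennreal_mult[symmetric]) (use w in \<open>auto simp: f_def\<close>)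
    also have "\<dots> = ennreal (1 / w) * (ennreal (t powr (g - 1) * (1 - t) powr (1 - g - 1)) * indicator {0..1} t)"
      using w by (auto simp: indicator_def ennreal_mult[symmetric])
    finally show "ennreal \<bar>w - 1\<bar> * ennreal (f (1 + (w - 1) * t)) = ennreal (1 / w) * (ennreal (t powr (g - 1) * (1 - t) powr (1 - g - 1)) * indicator {0..1} t)" .
  qed
  also have "\<dots> = ennreal (1 / w) * (\<integral>\<^sup>+t. ennreal (t powr (g - 1) * (1 - t) powr (1 - g - 1)) * indicator {0..1} t \<partial>lborel)"
    by (rule nn_integral_cmult) measurable
  also have "(\<integral>\<^sup>+t. ennreal (t powr (g - 1) * (1 - t) powr (1 - g - 1)) * indicator {0..1} t \<partial>lborel) = ennreal (Beta g (1 - g))"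
    by (rule nn_integral_has_integral_lebesgue'[OF _ has_integral_Beta_real]) (use g in auto)
  also have "ennreal (1 / w) * ennreal (Beta g (1 - g)) = ennreal (Beta g (1 - g) * res_ker 0 w)"
    using True w g by (subst ennreal_mult'[symmetric]) (auto simp: res_ker_def powr_minus_divide)
  finally show ?thesis .
qed

lemma Beta_pos: "0 < g \<Longrightarrow> g < 1 \<Longrightarrow> Beta g (1 - g :: real) > 0"
  by (simp add: Beta_def)

lemma kern_frac:
  assumes "p \<ge> 1" "0 < g" "g < 1"
  shows "kern p (weyl_ker (g - 1) (- g))" "kern p (weyl_ker (- g) (- 1))"
proof -
  have "1 / p > 0" using assms by simp
  then show "kern p (weyl_ker (g - 1) (- g))" "kern p (weyl_ker (- g) (- 1))"
    using assms by - (rule kern_weyl_ker; linarith)+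
qed

lemma kop_frac_compose:
  assumes p: "p \<ge> 1" and g: "0 < g" "g < 1" and f: "hfun p f"
  shows "AE t in half_line. kop (weyl_ker (g - 1) (- g)) (kop (weyl_ker (- g) (- 1)) f) t = Beta g (1 - g) *\<^sub>R kop (res_ker 0) f t"
proof -
  have "kern p (\<lambda>u. Beta g (1 - g) * res_ker 0 u)"
    using kern_res_ker[OF p, of 0] Beta_pos[OF g] by (auto simp: kern_def mult.assoc)
  from kop_compose[OF p kern_frac[OF p g] this f weyl_ker_beta[OF g]]
  show ?thesis unfolding kop_kernel_cmult .
qed

text \<open>The kernel operators commute, so the known composition may be read in the other order,
  in which the function assumed to vanish is the inner one.\<close>

lemma kop_frac_injective:
  assumes p: "p \<ge> 1" and g: "0 < g" "g < 1" and f: "hfun p f"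
    and z: "hnorm p (kop (weyl_ker (g - 1) (- g)) f) = 0"
  shows "hnorm p f = 0"
proof -
  let ?k = "weyl_ker (g - 1) (- g)" and ?l = "weyl_ker (- g) (- 1)"
  note k = kern_frac(1)[OF p g] and l = kern_frac(2)[OF p g]
  note kf = kop_bounded(2)[OF p k f]
  have "hnorm p (kop ?l (kop ?k f)) = 0"
    using kop_bounded(3)[OF p l kf] z by (intro antisym) auto
  then have "AE t in half_line. kop ?l (kop ?k f) t = 0"
    using lp_norm_eq_0_iff[OF p kop_bounded(2)[OF p l kf]] by simp
  with kop_commute[OF p k l f] kop_frac_compose[OF p g f]
  have "AE t in half_line. kop (res_ker 0) f t = 0"
    by eventually_elim (use Beta_pos[OF g] in auto)
  then have "hnorm p (kop (res_ker 0) f) = 0"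
    using lp_norm_eq_0_iff[OF p kop_bounded(2)[OF p kern_res_ker[OF p] f], of 0] by simp
  then show ?thesis using res_injective[OF p _ f, of 0] by simp
qed

lemma integral_half_line_FTC:
  fixes F f :: "real \<Rightarrow> complex"
  assumes F: "\<And>s. s > 0 \<Longrightarrow> (F has_vector_derivative f s) (at s)"
    and f: "\<And>s. s > 0 \<Longrightarrow> isCont f s"
    and int: "integrable half_line (\<lambda>x. f (t + x))"
    and lim: "(F \<longlongrightarrow> 0) at_top" and t: "t > 0"
  shows "(\<integral>x. f (t + x) \<partial>half_line) = - F t"
proof -
  have eq: "(\<lambda>s. indicator {0<..} s *\<^sub>R indicator {t<..} s *\<^sub>R f s) = (\<lambda>s. indicator {t<..} s *\<^sub>R f s)"
    using t by (auto simp: indicator_def)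
  have "(LBINT s=ereal t..\<infinity>. f s) = 0 - F t"
  proof (rule interval_integral_FTC_integrable)
    have "integrable half_line (\<lambda>s. indicator {t<..} s *\<^sub>R f s)"
      using int t by (subst (asm) integrable_half_line_shift) auto
    then show "set_integrable lborel (einterval (ereal t) \<infinity>) f"
      by (simp add: integrable_half_line set_integrable_def eq del: scaleR_scaleR)
    have "F \<midarrow>t\<rightarrow> F t"
      using has_vector_derivative_continuous[OF F[OF t]] by (simp add: isCont_def continuous_at)
    then have "(F \<longlongrightarrow> F t) (at_right t)"
      by (rule filterlim_mono[OF _ order_refl]) (simp add: at_le)
    then show "((F \<circ> real_of_ereal) \<longlongrightarrow> F t) (at_right (ereal t))"
      by (simp add: ereal_tendsto_simps)
    show "((F \<circ> real_of_ereal) \<longlongrightarrow> 0) (at_left \<infinity>)"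
      using lim by (simp add: ereal_tendsto_simps)
  qed (use F f t in auto)
  moreover have "(LBINT s=ereal t..\<infinity>. f s) = (\<integral>x. f (t + x) \<partial>half_line)"
    unfolding integral_half_line_shift[OF less_imp_le[OF t]] integral_half_line
    by (simp add: interval_lebesgue_integral_def set_lebesgue_integral_def eq del: scaleR_scaleR)
  ultimately show ?thesis by simp
qed

section \<open>Schwartz functions and Weyl derivatives\<close>

lemma vderiv_cong_pos:
  assumes "\<And>s. s > 0 \<Longrightarrow> f s = g s" "t > 0"
  shows "vderiv f t = vderiv g t"
  unfolding vderiv_def
proof (rule vector_derivative_cong_eq)
  show "\<forall>\<^sub>F x in nhds t. x \<in> UNIV \<longrightarrow> f x = g x"
    using assms by (intro eventually_mono[OF eventually_nhds_in_open[of "{0<..}"]]) auto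
qed auto

text \<open>\<open>vderiv\<close> yields total functions whose values off the half-line are
  uncontrolled. A candidate family has to match only at positive arguments, which suffices because
  differentiation is local.\<close>

lemma vderiv_funpow_eq:
  assumes F: "\<And>n t. t > 0 \<Longrightarrow> (F n has_vector_derivative F (Suc n) t) (at t)"
    and f: "\<And>t. t > 0 \<Longrightarrow> f t = F 0 t" and t: "t > 0"
  shows "(vderiv ^^ n) f t = F n t"
  using t
proof (induction n arbitrary: t)
  case (Suc n)
  have "(vderiv ^^ Suc n) f t = vderiv (F n) t"
    using vderiv_cong_pos[of "(vderiv ^^ n) f" "F n" t] Suc by simp
  also have "\<dots> = F (Suc n) t" unfolding vderiv_def using F[OF Suc.prems] by (rule vector_derivative_at)
  finally show ?case .
qed (use f in simp)

lemma schwartz_plusI: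
  assumes F: "\<And>n t. t > 0 \<Longrightarrow> (F n has_vector_derivative F (Suc n) t) (at t)"
    and f: "\<And>t. t > 0 \<Longrightarrow> f t = F 0 t"
    and lim: "\<And>n. \<exists>L. (F n \<longlongrightarrow> L) (at_right 0)"
    and bound: "\<And>n m. \<exists>C. \<forall>t>0. t ^ m * norm (F n t) \<le> C"
  shows "schwartz_plus f"
proof -
  have eq: "(vderiv ^^ n) f t = F n t" if "t > 0" for n t
    by (rule vderiv_funpow_eq[OF F f that])
  have "((vderiv ^^ n) f has_vector_derivative (vderiv ^^ Suc n) f t) (at t)" if "t > 0" for n t
    unfolding eq[OF that, of "Suc n"]
    by (rule has_vector_derivative_transform_within_open[OF F[OF that], of "{0<..}"]) (use that eq in auto)
  moreover have "\<exists>L. ((vderiv ^^ n) f \<longlongrightarrow> L) (at_right 0)" for n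
  proof -
    obtain L where "(F n \<longlongrightarrow> L) (at_right 0)" using lim by blast
    moreover have "\<forall>\<^sub>F t in at_right 0. F n t = (vderiv ^^ n) f t"
      by (rule eventually_mono[OF eventually_at_right_less[of "0::real"]]) (simp add: eq)
    ultimately have "((vderiv ^^ n) f \<longlongrightarrow> L) (at_right 0)" by (rule Lim_transform_eventually)
    then show ?thesis by blast
  qed
  ultimately show ?thesis using bound eq unfolding schwartz_plus_def by simp
qed

lemma schwartz_derivs:
  assumes "schwartz_plus f" "t > 0"
  shows "((vderiv ^^ n) f has_vector_derivative (vderiv ^^ Suc n) f t) (at t)"
  using assms by (simp add: schwartz_plus_def)

lemma schwartz_limit:
  assumes "schwartz_plus f" obtains L where "((vderiv ^^ n) f \<longlongrightarrow> L) (at_right 0)"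
  using assms unfolding schwartz_plus_def by blast

lemma schwartz_bound:
  assumes "schwartz_plus f" obtains C where "\<And>t. t > 0 \<Longrightarrow> t ^ m * norm ((vderiv ^^ n) f t) \<le> C"
  using assms unfolding schwartz_plus_def by blast

lemma schwartz_vderiv:
  assumes "schwartz_plus f" shows "schwartz_plus (vderiv f)"
proof (rule schwartz_plusI[where F = "\<lambda>n. (vderiv ^^ Suc n) f"])
  show "((vderiv ^^ Suc n) f has_vector_derivative (vderiv ^^ Suc (Suc n)) f t) (at t)" if "t > 0" for n t
    by (rule schwartz_derivs[OF assms that])
  show "\<exists>L. ((vderiv ^^ Suc n) f \<longlongrightarrow> L) (at_right 0)" for n
    using schwartz_limit[OF assms] by blast
  show "\<exists>C. \<forall>t>0. t ^ m * norm ((vderiv ^^ Suc n) f t) \<le> C" for n m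
    using schwartz_bound[OF assms, of m "Suc n"] by blast
qed simp

lemma schwartz_vderiv_funpow: "schwartz_plus f \<Longrightarrow> schwartz_plus ((vderiv ^^ n) f)"
  by (induction n) (auto intro: schwartz_vderiv)

lemma schwartz_add:
  assumes f: "schwartz_plus f" and g: "schwartz_plus g"
  shows "schwartz_plus (\<lambda>t. f t + g t)"
proof (rule schwartz_plusI[where F = "\<lambda>n t. (vderiv ^^ n) f t + (vderiv ^^ n) g t"])
  show "((\<lambda>t. (vderiv ^^ n) f t + (vderiv ^^ n) g t) has_vector_derivative (vderiv ^^ Suc n) f t + (vderiv ^^ Suc n) g t) (at t)" if "t > 0" for n t
    by (intro has_vector_derivative_add schwartz_derivs f g that)
  show "\<exists>L. ((\<lambda>t. (vderiv ^^ n) f t + (vderiv ^^ n) g t) \<longlongrightarrow> L) (at_right 0)" for n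
  proof -
    obtain L M where "((vderiv ^^ n) f \<longlongrightarrow> L) (at_right 0)" "((vderiv ^^ n) g \<longlongrightarrow> M) (at_right 0)"
      using schwartz_limit[OF f] schwartz_limit[OF g] by metis
    from tendsto_add[OF this] show ?thesis by blast
  qed
  show "\<exists>C. \<forall>t>0. t ^ m * norm ((vderiv ^^ n) f t + (vderiv ^^ n) g t) \<le> C" for n m
  proof -
    obtain C D where C: "\<And>t. t > 0 \<Longrightarrow> t ^ m * norm ((vderiv ^^ n) f t) \<le> C" and D: "\<And>t. t > 0 \<Longrightarrow> t ^ m * norm ((vderiv ^^ n) g t) \<le> D"
      using schwartz_bound[OF f, of m n] schwartz_bound[OF g, of m n] by metis
    have "t ^ m * norm ((vderiv ^^ n) f t + (vderiv ^^ n) g t) \<le> C + D" if "t > 0" for t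
    proof -
      have "t ^ m * norm ((vderiv ^^ n) f t + (vderiv ^^ n) g t) \<le> t ^ m * (norm ((vderiv ^^ n) f t) + norm ((vderiv ^^ n) g t))"
        using that by (intro mult_left_mono norm_triangle_ineq) auto
      then show ?thesis using C[OF that] D[OF that] by (simp add: distrib_left)
    qed
    then show ?thesis by blast
  qed
qed simp

lemma schwartz_cmult:
  assumes f: "schwartz_plus f"
  shows "schwartz_plus (\<lambda>t. c * f t)"
proof (rule schwartz_plusI[where F = "\<lambda>n t. c * (vderiv ^^ n) f t"])
  show "((\<lambda>t. c * (vderiv ^^ n) f t) has_vector_derivative c * (vderiv ^^ Suc n) f t) (at t)" if "t > 0" for n t
    by (intro has_vector_derivative_mult_right schwartz_derivs f that)
  show "\<exists>L. ((\<lambda>t. c * (vderiv ^^ n) f t) \<longlongrightarrow> L) (at_right 0)" for n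
  proof -
    obtain L where "((vderiv ^^ n) f \<longlongrightarrow> L) (at_right 0)" by (rule schwartz_limit[OF f])
    from tendsto_mult_left[OF this] show ?thesis by blast
  qed
  show "\<exists>C. \<forall>t>0. t ^ m * norm (c * (vderiv ^^ n) f t) \<le> C" for n m
  proof -
    obtain C where C: "\<And>t. t > 0 \<Longrightarrow> t ^ m * norm ((vderiv ^^ n) f t) \<le> C"
      using schwartz_bound[OF f, of m n] by blast
    have "t ^ m * norm (c * (vderiv ^^ n) f t) \<le> norm c * C" if "t > 0" for t
      using mult_left_mono[OF C[OF that], of "norm c"] by (simp add: norm_mult mult_ac)
    then show ?thesis by blast
  qed
qed simp

lemma vderiv_funpow_add:
  assumes f: "schwartz_plus f" and g: "schwartz_plus g" and t: "t > 0"
  shows "(vderiv ^^ n) (\<lambda>t. f t + g t) t = (vderiv ^^ n) f t + (vderiv ^^ n) g t"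
  by (rule vderiv_funpow_eq[where F = "\<lambda>n t. (vderiv ^^ n) f t + (vderiv ^^ n) g t"])
    (intro has_vector_derivative_add schwartz_derivs f g t | simp only: funpow_0)+

lemma vderiv_funpow_cmult:
  assumes f: "schwartz_plus f" and t: "t > 0"
  shows "(vderiv ^^ n) (\<lambda>t. c * f t) t = c * (vderiv ^^ n) f t"
  by (rule vderiv_funpow_eq[where F = "\<lambda>n t. c * (vderiv ^^ n) f t"])
    (intro has_vector_derivative_mult_right schwartz_derivs f t | simp only: funpow_0)+

lemma power_times_exp_bounded:
  fixes a t :: real
  assumes a: "a > 0" and t: "t \<ge> 0"
  shows "t ^ m * exp (- a * t) \<le> (real (Suc m) / a) ^ m"
proof -
  \<comment> \<open>Dividing by \<open>Suc m\<close> instead of \<open>m\<close> covers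
    \<open>m = 0\<close>; the surplus \<open>b\<close> in \<open>a = b * m + b\<close> is dropped in
    the estimate.\<close>
  define b where "b = a / real (Suc m)"
  have b: "b > 0" using a by (simp add: b_def)
  have "b * real (Suc m) = a" by (simp add: b_def)
  then have ab: "a = b * real m + b" by (simp add: algebra_simps)
  have "b * t \<le> exp (b * t)" using exp_ge_add_one_self[of "b * t"] by linarith
  then have "t * exp (- b * t) \<le> 1 / b"
    using b by (simp add: exp_minus field_simps)
  then have *: "(t * exp (- b * t)) ^ m \<le> (1 / b) ^ m" using t by (intro power_mono) auto
  have "- a * t \<le> real m * (- b * t)" using b t by (simp add: ab algebra_simps)
  then have "exp (- a * t) \<le> exp (- b * t) ^ m" by (simp add: exp_of_nat_mult[symmetric])
  then have "t ^ m * exp (- a * t) \<le> t ^ m * exp (- b * t) ^ m" using t by (intro mult_left_mono) auto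
  also have "\<dots> \<le> (1 / b) ^ m" using * by (simp add: power_mult_distrib)
  finally show ?thesis by (simp add: b_def)
qed

lemma exp_has_vector_derivative:
  "((\<lambda>t. complex_of_real (c * exp (- a * t))) has_vector_derivative complex_of_real ((- a) * c * exp (- a * t))) (at t)"
proof -
  have "((\<lambda>t. c * exp (- a * t)) has_real_derivative (- a) * c * exp (- a * t)) (at t)"
    by (auto intro!: derivative_eq_intros)
  then show ?thesis
    by (simp only: has_real_derivative_iff_has_vector_derivative has_vector_derivative_of_real)
qed

lemma vderiv_funpow_exp:
  assumes "t > 0"
  shows "(vderiv ^^ n) (\<lambda>t. complex_of_real (exp (- a * t))) t = complex_of_real ((- a) ^ n * exp (- a * t))"
proof (rule vderiv_funpow_eq[where F = "\<lambda>n t. complex_of_real ((- a) ^ n * exp (- a * t))"])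
  show "((\<lambda>t. complex_of_real ((- a) ^ n * exp (- a * t))) has_vector_derivative complex_of_real ((- a) ^ Suc n * exp (- a * t))) (at t)" for n t
    unfolding power_Suc by (rule exp_has_vector_derivative)
qed (use assms in simp_all)

lemma schwartz_exp:
  assumes a: "a > 0"
  shows "schwartz_plus (\<lambda>t. complex_of_real (exp (- a * t)))"
proof (rule schwartz_plusI[where F = "\<lambda>n t. complex_of_real ((- a) ^ n * exp (- a * t))"])
  show "((\<lambda>t. complex_of_real ((- a) ^ n * exp (- a * t))) has_vector_derivative complex_of_real ((- a) ^ Suc n * exp (- a * t))) (at t)" for n t
    unfolding power_Suc by (rule exp_has_vector_derivative)
  have "((\<lambda>t. complex_of_real ((- a) ^ n * exp (- a * t))) \<longlongrightarrow> complex_of_real ((- a) ^ n * exp (- a * 0))) (at_right 0)" for n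
    by (intro tendsto_intros)
  then show "\<exists>L. ((\<lambda>t. complex_of_real ((- a) ^ n * exp (- a * t))) \<longlongrightarrow> L) (at_right 0)" for n by blast
  have "t ^ m * norm (complex_of_real ((- a) ^ n * exp (- a * t))) \<le> a ^ n * (real (Suc m) / a) ^ m" if "t > 0" for n m t
    unfolding norm_of_real using mult_left_mono[OF power_times_exp_bounded[OF a, of t m], of "a ^ n"] a that
    by (simp add: abs_mult power_abs mult_ac)
  then show "\<exists>C. \<forall>t>0. t ^ m * norm (complex_of_real ((- a) ^ n * exp (- a * t))) \<le> C" for n m by blast
qed simp

text \<open>The moments of order 0 and \<open>m\<close> combine to one bound valid both near 0 and
  at infinity, in the form that \<open>integrable_half_line_powr\<close> can integrate.\<close>

lemma schwartz_decay:
  assumes "schwartz_plus f"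
  obtains C where "C \<ge> 0" "\<And>t. t > 0 \<Longrightarrow> norm (f t) \<le> C * (1 + t) powr (- real m)"
proof -
  obtain A where A: "\<And>t. t > 0 \<Longrightarrow> t ^ 0 * norm ((vderiv ^^ 0) f t) \<le> A"
    using schwartz_bound[OF assms, of 0 0] by blast
  obtain B where B: "\<And>t. t > 0 \<Longrightarrow> t ^ m * norm ((vderiv ^^ 0) f t) \<le> B"
    using schwartz_bound[OF assms, of m 0] by blast
  have bd: "(1 + t) ^ m * norm (f t) \<le> 2 ^ m * (A + B)" if t: "t > 0" for t
  proof -
    have "(1 + t) ^ m \<le> 2 ^ m * (1 + t ^ m)"
    proof (cases "t \<le> 1")
      case True
      then have "(1 + t) ^ m \<le> 2 ^ m" using t by (intro power_mono) auto
      also have "\<dots> \<le> 2 ^ m * (1 + t ^ m)" using t by simp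
      finally show ?thesis .
    next
      case False
      then have "(1 + t) ^ m \<le> (2 * t) ^ m" by (intro power_mono) auto
      also have "\<dots> \<le> 2 ^ m * (1 + t ^ m)" by (simp add: power_mult_distrib)
      finally show ?thesis .
    qed
    then have "(1 + t) ^ m * norm (f t) \<le> 2 ^ m * (1 + t ^ m) * norm (f t)" by (intro mult_right_mono) auto
    also have "\<dots> = 2 ^ m * (norm (f t) + t ^ m * norm (f t))" by (simp add: algebra_simps)
    also have "\<dots> \<le> 2 ^ m * (A + B)" using A[OF t] B[OF t] by (intro mult_left_mono add_mono) auto
    finally show ?thesis .
  qed
  have "norm (f t) \<le> (2 ^ m * \<bar>A + B\<bar>) * (1 + t) powr (- real m)" if t: "t > 0" for t
  proof -
    have "2 ^ m * (A + B) \<le> 2 ^ m * \<bar>A + B\<bar>" by simp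
    with bd[OF t] have "(1 + t) ^ m * norm (f t) \<le> 2 ^ m * \<bar>A + B\<bar>" by linarith
    then show ?thesis using t by (simp add: powr_minus powr_realpow field_simps)
  qed
  then show ?thesis by (intro that[of "2 ^ m * \<bar>A + B\<bar>"]) auto
qed

lemma schwartz_isCont: "schwartz_plus f \<Longrightarrow> t > 0 \<Longrightarrow> isCont f t"
  using has_vector_derivative_continuous[OF schwartz_derivs[of f t 0]] by simp

lemma schwartz_measurable: 
  assumes "schwartz_plus f" shows "f \<in> borel_measurable half_line"
proof -
  have "continuous_on {0<..} f"
    using schwartz_isCont[OF assms] by (intro continuous_at_imp_continuous_on) auto
  then have "f \<in> borel_measurable (restrict_space borel {0<..})"
    by (rule borel_measurable_continuous_on_restrict)
  then show ?thesis
    by (simp add: half_line_def measurable_cong_sets[OF sets_restrict_space_cong[OF sets_lborel] refl])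
qed

lemma schwartz_tendsto_0:
  assumes "schwartz_plus f" shows "(f \<longlongrightarrow> 0) at_top"
proof -
  obtain C where C: "C \<ge> 0" "\<And>t. t > 0 \<Longrightarrow> norm (f t) \<le> C * (1 + t) powr (- real 1)"
    using schwartz_decay[OF assms, of 1] by blast
  show ?thesis
  proof (rule Lim_null_comparison)
    show "\<forall>\<^sub>F t in at_top. norm (f t) \<le> C * (1 + t) powr (- real 1)"
      using C(2) by (intro eventually_mono[OF eventually_gt_at_top[of 0]])
    have "filterlim (\<lambda>t::real. 1 + t) at_top at_top"
      by (intro filterlim_tendsto_add_at_top[OF tendsto_const] filterlim_ident)
    from tendsto_neg_powr[OF _ this, of "- real 1"]
    show "((\<lambda>t. C * (1 + t) powr (- real 1)) \<longlongrightarrow> 0) at_top"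
      by (intro tendsto_mult_right_zero) simp
  qed
qed

lemma schwartz_lp:
  assumes p: "p \<ge> 1" and f: "schwartz_plus f"
  shows "hfun p (\<lambda>s. complex_of_real (s ^ m) * f s)"
proof -
  \<comment> \<open>Two extra powers leave \<open>(1 + x) powr (- 2)\<close>, which is integrable;
    its p-th power with \<open>p \<ge> 1\<close> is no larger.\<close>
  obtain C where C: "C \<ge> 0" "\<And>t. t > 0 \<Longrightarrow> norm (f t) \<le> C * (1 + t) powr (- real (m + 2))"
    using schwartz_decay[OF f, of "m + 2"] by blast
  have "integrable half_line (\<lambda>x. norm (complex_of_real (x ^ m) * f x) powr p)"
  proof (rule Bochner_Integration.integrable_bound)
    have "integrable half_line (\<lambda>x. x powr 0 * (1 + x) powr (- 2))"
      by (rule integrable_half_line_powr) auto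
    then show "integrable half_line (\<lambda>x. C powr p * (x powr 0 * (1 + x) powr (- 2)))" by simp
    show "(\<lambda>x. norm (complex_of_real (x ^ m) * f x) powr p) \<in> borel_measurable half_line"
      using schwartz_measurable[OF f] by measurable
    show "AE x in half_line. norm (norm (complex_of_real (x ^ m) * f x) powr p) \<le> norm (C powr p * (x powr 0 * (1 + x) powr (- 2)))"
    proof (rule AE_half_line)
      fix x :: real assume x: "x > 0"
      have "norm (complex_of_real (x ^ m) * f x) = x ^ m * norm (f x)" using x by (simp add: norm_mult norm_power)
      also have "\<dots> \<le> (1 + x) ^ m * (C * (1 + x) powr (- real (m + 2)))"
        using x C by (intro mult_mono power_mono) auto
      also have "\<dots> = C * ((1 + x) powr (real m) * (1 + x) powr (- real (m + 2)))"
        using x by (simp add: powr_realpow)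
      also have "(1 + x) powr (real m) * (1 + x) powr (- real (m + 2)) = (1 + x) powr (- 2)"
        by (simp add: powr_add[symmetric])
      finally have "norm (complex_of_real (x ^ m) * f x) powr p \<le> (C * (1 + x) powr (- 2)) powr p"
        using p by (intro powr_mono2) auto
      also have "\<dots> = C powr p * (1 + x) powr (- 2 * p)" using C x by (simp add: powr_mult powr_powr)
      also have "\<dots> \<le> C powr p * (1 + x) powr (- 2)"
        using x p by (intro mult_left_mono powr_mono) auto
      finally show "norm (norm (complex_of_real (x ^ m) * f x) powr p) \<le> norm (C powr p * (x powr 0 * (1 + x) powr (- 2)))"
        using x by simp
    qed
  qed
  then show ?thesis using schwartz_measurable[OF f] by (simp add: lp_fun_def)
qed

text \<open>The Weyl integral without its normalising factor, in the variable
  \<open>x = s - t\<close>: the singular kernel no longer depends on \<open>t\<close>, so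
  derivatives in \<open>t\<close> fall on \<open>\<psi>\<close> alone.\<close>

definition wint :: "real \<Rightarrow> (real \<Rightarrow> complex) \<Rightarrow> real \<Rightarrow> complex" where
  "wint \<beta> \<psi> t = (\<integral>x. x powr (\<beta> - 1) *\<^sub>R \<psi> (t + x) \<partial>half_line)"

lemma weyl_int_eq_wint: "weyl_int \<beta> \<psi> t = complex_of_real (1 / Gamma \<beta>) * wint \<beta> \<psi> t"
proof -
  have "(LINT s:{t..}|lborel. complex_of_real ((s - t) powr (\<beta> - 1)) * \<psi> s) = 
     \<bar>1\<bar> *\<^sub>R (\<integral>x. indicator {t..} (t + 1 * x) *\<^sub>R (complex_of_real ((t + 1 * x - t) powr (\<beta> - 1)) * \<psi> (t + 1 * x)) \<partial>lborel)"
    unfolding set_lebesgue_integral_def by (rule lborel_integral_real_affine) simp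
  also have "\<dots> = (\<integral>x. indicator {0<..} x *\<^sub>R (x powr (\<beta> - 1) *\<^sub>R \<psi> (t + x)) \<partial>lborel)"
    unfolding abs_one scaleR_one
    by (rule Bochner_Integration.integral_cong) (auto simp: indicator_def scaleR_conv_of_real)
  also have "\<dots> = wint \<beta> \<psi> t"
    unfolding wint_def integral_half_line set_lebesgue_integral_def ..
  finally show ?thesis by (simp add: weyl_int_def)
qed

lemma half_line_shift_measurable: 
  assumes "f \<in> borel_measurable half_line" "t \<ge> 0"
  shows "(\<lambda>x. f (t + x)) \<in> borel_measurable half_line"
proof (rule measurable_compose[OF _ assms(1)])
  show "(\<lambda>x. t + x) \<in> half_line \<rightarrow>\<^sub>M half_line"
    using assms(2) by (intro measurable_half_lineI borel_measurable_add measurable_const half_line_id_borel) auto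
qed

lemma wint_integrable:
  assumes \<beta>: "0 < \<beta>" "\<beta> \<le> 1" and \<psi>: "schwartz_plus \<psi>" and t: "t \<ge> 0"
  shows "integrable half_line (\<lambda>x. x powr (\<beta> - 1) *\<^sub>R \<psi> (t + x))"
proof -
  obtain C where C: "C \<ge> 0" "\<And>t. t > 0 \<Longrightarrow> norm (\<psi> t) \<le> C * (1 + t) powr (- real 2)"
    using schwartz_decay[OF \<psi>, of 2] by blast
  show ?thesis
  proof (rule Bochner_Integration.integrable_bound)
    have "integrable half_line (\<lambda>x. x powr (\<beta> - 1) * (1 + x) powr (- 2))"
      by (rule integrable_half_line_powr) (use \<beta> in auto)
    then show "integrable half_line (\<lambda>x. C * (x powr (\<beta> - 1) * (1 + x) powr (- 2)))" by simp
    show "(\<lambda>x. x powr (\<beta> - 1) *\<^sub>R \<psi> (t + x)) \<in> borel_measurable half_line"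
      using half_line_shift_measurable[OF schwartz_measurable[OF \<psi>] t] by measurable
    show "AE x in half_line. norm (x powr (\<beta> - 1) *\<^sub>R \<psi> (t + x)) \<le> norm (C * (x powr (\<beta> - 1) * (1 + x) powr (- 2)))"
    proof (rule AE_half_line)
      fix x :: real assume x: "x > 0"
      have "norm (\<psi> (t + x)) \<le> C * (1 + (t + x)) powr (- real 2)" using C(2)[of "t + x"] x t by simp
      also have "\<dots> \<le> C * (1 + x) powr (- real 2)"
        using C x t by (intro mult_left_mono powr_mono2') auto
      finally have "x powr (\<beta> - 1) * norm (\<psi> (t + x)) \<le> x powr (\<beta> - 1) * (C * (1 + x) powr (- real 2))"
        by (intro mult_left_mono) auto
      then show "norm (x powr (\<beta> - 1) *\<^sub>R \<psi> (t + x)) \<le> norm (C * (x powr (\<beta> - 1) * (1 + x) powr (- 2)))"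
        using C by (simp add: mult_ac)
    qed
  qed
qed

lemma wint_decay:
  assumes \<beta>: "0 < \<beta>" "\<beta> \<le> 1" and \<psi>: "schwartz_plus \<psi>"
  obtains C where "C \<ge> 0" "\<And>t. t > 0 \<Longrightarrow> norm (wint \<beta> \<psi> t) \<le> C * (1 + t) powr (- 2)"
proof -
  \<comment> \<open>Order 4 is split: two powers give the decay in \<open>t\<close>, the other two
    the integrability in \<open>x\<close>.\<close>
  obtain C where C: "C \<ge> 0" "\<And>t. t > 0 \<Longrightarrow> norm (\<psi> t) \<le> C * (1 + t) powr (- real 4)"
    using schwartz_decay[OF \<psi>, of 4] by blast
  define I where "I = (\<integral>x. x powr (\<beta> - 1) * (1 + x) powr (- 2) \<partial>half_line)"
  have I: "integrable half_line (\<lambda>x. x powr (\<beta> - 1) * (1 + x) powr (- 2))"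
    by (rule integrable_half_line_powr) (use \<beta> in auto)
  have I0: "I \<ge> 0" unfolding I_def by (intro Bochner_Integration.integral_nonneg) auto
  have "norm (wint \<beta> \<psi> t) \<le> (C * I) * (1 + t) powr (- 2)" if t: "t > 0" for t
  proof -
    have "norm (wint \<beta> \<psi> t) \<le> (\<integral>x. norm (x powr (\<beta> - 1) *\<^sub>R \<psi> (t + x)) \<partial>half_line)"
      unfolding wint_def by (rule integral_norm_bound)
    also have "\<dots> \<le> (\<integral>x. (C * (1 + t) powr (- 2)) * (x powr (\<beta> - 1) * (1 + x) powr (- 2)) \<partial>half_line)"
    proof (rule integral_mono)
      show "integrable half_line (\<lambda>x. norm (x powr (\<beta> - 1) *\<^sub>R \<psi> (t + x)))"
        using t by (intro integrable_norm wint_integrable \<beta> \<psi>) auto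
      show "integrable half_line (\<lambda>x. (C * (1 + t) powr (- 2)) * (x powr (\<beta> - 1) * (1 + x) powr (- 2)))"
        by (intro integrable_mult_right I)
      fix x assume "x \<in> space half_line"
      then have x: "x > 0" by simp
      have "norm (\<psi> (t + x)) \<le> C * (1 + (t + x)) powr (- real 4)" using C(2)[of "t + x"] x t by simp
      also have "(1 + (t + x)) powr (- real 4) = (1 + (t + x)) powr (- 2) * (1 + (t + x)) powr (- 2)"
        by (simp add: powr_add[symmetric])
      also have "C * \<dots> \<le> C * ((1 + t) powr (- 2) * (1 + x) powr (- 2))"
        using C x t by (intro mult_left_mono mult_mono powr_mono2') auto
      finally have "x powr (\<beta> - 1) * norm (\<psi> (t + x)) \<le> x powr (\<beta> - 1) * (C * ((1 + t) powr (- 2) * (1 + x) powr (- 2)))"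
        by (intro mult_left_mono) auto
      then show "norm (x powr (\<beta> - 1) *\<^sub>R \<psi> (t + x)) \<le> (C * (1 + t) powr (- 2)) * (x powr (\<beta> - 1) * (1 + x) powr (- 2))"
        by (simp add: mult_ac)
    qed
    also have "\<dots> = (C * I) * (1 + t) powr (- 2)" by (simp add: I_def)
    finally show ?thesis .
  qed
  then show ?thesis using that[of "C * I"] C I0 by auto
qed

text \<open>The dependence on \<open>M\<close> is explicit because the remainder is later integrated
  against the singular kernel. The constant is crude: linearising \<open>vderiv \<psi>\<close> costs
  \<open>2 * M\<close>, its linear part another \<open>M\<close>.\<close>

lemma schwartz_taylor:
  assumes \<psi>: "schwartz_plus \<psi>" and M: "\<And>r. \<bar>r - s\<bar> \<le> \<bar>h\<bar> \<Longrightarrow> norm ((vderiv ^^ 2) \<psi> r) \<le> M" and s: "s - \<bar>h\<bar> > 0"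
  shows "norm (\<psi> (s + h) - \<psi> s - h *\<^sub>R vderiv \<psi> s) \<le> 3 * M * h\<^sup>2"
proof -
  define S where "S = {s - \<bar>h\<bar>..s + \<bar>h\<bar>}"
  have S: "r > 0" "\<bar>r - s\<bar> \<le> \<bar>h\<bar>" if "r \<in> S" for r using that s by (auto simp: S_def)
  have d2: "(vderiv \<psi> has_vector_derivative (vderiv ^^ 2) \<psi> r) (at r within S)" if "r \<in> S" for r
    using schwartz_derivs[OF \<psi> S(1)[OF that], of 1]
    by (simp add: numeral_2_eq_2 has_vector_derivative_at_within)
  have d1: "(\<psi> has_vector_derivative vderiv \<psi> r) (at r within S)" if "r \<in> S" for r
    using schwartz_derivs[OF \<psi> S(1)[OF that], of 0] by (simp add: has_vector_derivative_at_within)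
  have sS: "s \<in> S" by (simp add: S_def)
  have seg: "closed_segment s r \<subseteq> S" if "r \<in> S" for r
    using that sS by (auto simp: S_def closed_segment_eq_real_ivl)
  have L: "norm (vderiv \<psi> r - vderiv \<psi> s) \<le> 3 * M * \<bar>h\<bar>" if r: "r \<in> S" for r
  proof -
    have "norm (vderiv \<psi> r - vderiv \<psi> s - (r - s) *\<^sub>R (vderiv ^^ 2) \<psi> s) \<le> norm (r - s) * (2 * M)"
    proof (rule vector_differentiable_bound_linearization[OF d2 seg[OF r] _ sS])
      fix x assume "x \<in> S"
      then have "norm ((vderiv ^^ 2) \<psi> x) \<le> M" "norm ((vderiv ^^ 2) \<psi> s) \<le> M" using M S(2) by auto
      then show "norm ((vderiv ^^ 2) \<psi> x - (vderiv ^^ 2) \<psi> s) \<le> 2 * M"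
        using norm_triangle_ineq4[of "(vderiv ^^ 2) \<psi> x" "(vderiv ^^ 2) \<psi> s"] by linarith
    qed
    moreover have "norm ((r - s) *\<^sub>R (vderiv ^^ 2) \<psi> s) \<le> norm (r - s) * M"
      using M[of s] by (auto intro!: mult_left_mono)
    moreover have "norm (vderiv \<psi> r - vderiv \<psi> s) \<le> norm (vderiv \<psi> r - vderiv \<psi> s - (r - s) *\<^sub>R (vderiv ^^ 2) \<psi> s) + norm ((r - s) *\<^sub>R (vderiv ^^ 2) \<psi> s)"
      by (metis diff_add_cancel norm_triangle_ineq)
    ultimately have "norm (vderiv \<psi> r - vderiv \<psi> s) \<le> norm (r - s) * (2 * M) + norm (r - s) * M"
      by linarith
    also have "\<dots> = \<bar>r - s\<bar> * (3 * M)" by simp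
    also have "\<dots> \<le> \<bar>h\<bar> * (3 * M)"
      using S(2)[OF r] order_trans[OF norm_ge_zero M[of s]] by (intro mult_right_mono) auto
    finally show ?thesis by (simp add: mult_ac)
  qed
  have "s + h \<in> S" by (auto simp: S_def abs_if)
  from vector_differentiable_bound_linearization[OF d1 seg[OF this] L sS]
  show ?thesis by (simp add: power2_eq_square mult_ac abs_mult_self_eq)
qed

text \<open>Differentiation under the integral by means of a quadratic remainder. For
  \<open>\<bar>h\<bar> < t\<close> every intermediate argument exceeds \<open>x\<close>, so the
  second derivative is bounded by \<open>C * (1 + x) powr (- 2)\<close> uniformly in
  \<open>h\<close>.\<close>

lemma wint_has_derivative:
  assumes \<beta>: "0 < \<beta>" "\<beta> \<le> 1" and \<psi>: "schwartz_plus \<psi>" and t: "t > 0"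
  shows "(wint \<beta> \<psi> has_vector_derivative wint \<beta> (vderiv \<psi>) t) (at t)"
proof -
  obtain C where C: "C \<ge> 0" "\<And>t. t > 0 \<Longrightarrow> norm ((vderiv ^^ 2) \<psi> t) \<le> C * (1 + t) powr (- real 2)"
    using schwartz_decay[OF schwartz_vderiv_funpow[OF \<psi>], of 2 2] by blast
  define I where "I = (\<integral>x. x powr (\<beta> - 1) * (1 + x) powr (- 2) \<partial>half_line)"
  have I: "integrable half_line (\<lambda>x. x powr (\<beta> - 1) * (1 + x) powr (- 2))"
    by (rule integrable_half_line_powr) (use \<beta> in auto)
  have bd: "norm (wint \<beta> \<psi> (t + h) - wint \<beta> \<psi> t - h *\<^sub>R wint \<beta> (vderiv \<psi>) t) \<le> (3 * C * I) * h\<^sup>2" if h: "\<bar>h\<bar> < t" for h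
  proof -
    have th: "t + h \<ge> 0" using h by (auto simp: abs_if split: if_splits)
    note i1 = wint_integrable[OF \<beta> \<psi> th] and i2 = wint_integrable[OF \<beta> \<psi> less_imp_le[OF t]]
      and i3 = wint_integrable[OF \<beta> schwartz_vderiv[OF \<psi>] less_imp_le[OF t]]
    let ?r = "\<lambda>x. x powr (\<beta> - 1) *\<^sub>R \<psi> (t + h + x) - x powr (\<beta> - 1) *\<^sub>R \<psi> (t + x) - h *\<^sub>R (x powr (\<beta> - 1) *\<^sub>R vderiv \<psi> (t + x))"
    have i4: "integrable half_line ?r" using i1 i2 i3 by (intro Bochner_Integration.integrable_diff integrable_scaleR_right) auto
    have "wint \<beta> \<psi> (t + h) - wint \<beta> \<psi> t - h *\<^sub>R wint \<beta> (vderiv \<psi>) t = integral\<^sup>L half_line ?r"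
      unfolding wint_def using i1 i2 i3 by (simp del: scaleR_scaleR)
    then have "norm (wint \<beta> \<psi> (t + h) - wint \<beta> \<psi> t - h *\<^sub>R wint \<beta> (vderiv \<psi>) t) \<le> (\<integral>x. norm (?r x) \<partial>half_line)"
      by (simp only: integral_norm_bound)
    also have "\<dots> \<le> (\<integral>x. (3 * C * h\<^sup>2) * (x powr (\<beta> - 1) * (1 + x) powr (- 2)) \<partial>half_line)"
    proof (rule integral_mono)
      show "integrable half_line (\<lambda>x. norm (?r x))" by (rule integrable_norm[OF i4])
      show "integrable half_line (\<lambda>x. (3 * C * h\<^sup>2) * (x powr (\<beta> - 1) * (1 + x) powr (- 2)))"
        by (intro integrable_mult_right I)
      fix x assume "x \<in> space half_line"
      then have x: "x > 0" by simp
      have "norm (\<psi> ((t + x) + h) - \<psi> (t + x) - h *\<^sub>R vderiv \<psi> (t + x)) \<le> 3 * (C * (1 + x) powr (- 2)) * h\<^sup>2"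
      proof (rule schwartz_taylor[OF \<psi>])
        show "t + x - \<bar>h\<bar> > 0" using h x by simp
        fix r assume r: "\<bar>r - (t + x)\<bar> \<le> \<bar>h\<bar>"
        then have rx: "r > x" using h by (auto simp: abs_if split: if_splits)
        then have "norm ((vderiv ^^ 2) \<psi> r) \<le> C * (1 + r) powr (- real 2)" using C(2)[of r] x by simp
        also have "\<dots> \<le> C * (1 + x) powr (- 2)" using C x rx by (auto intro!: mult_left_mono powr_mono2')
        finally show "norm ((vderiv ^^ 2) \<psi> r) \<le> C * (1 + x) powr (- 2)" .
      qed
      moreover have "?r x = x powr (\<beta> - 1) *\<^sub>R (\<psi> ((t + x) + h) - \<psi> (t + x) - h *\<^sub>R vderiv \<psi> (t + x))"
        by (simp add: scaleR_diff_right mult_ac add_ac)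
      ultimately have "norm (?r x) \<le> x powr (\<beta> - 1) * (3 * (C * (1 + x) powr (- 2)) * h\<^sup>2)"
        by (simp only: norm_scaleR) (auto intro!: mult_left_mono)
      then show "norm (?r x) \<le> (3 * C * h\<^sup>2) * (x powr (\<beta> - 1) * (1 + x) powr (- 2))"
        by (simp only: mult_ac)
    qed
    also have "\<dots> = (3 * C * I) * h\<^sup>2" by (simp add: I_def)
    finally show ?thesis .
  qed
  show ?thesis
    unfolding has_vector_derivative_def has_derivative_at
  proof (intro conjI)
    show "bounded_linear (\<lambda>x. x *\<^sub>R wint \<beta> (vderiv \<psi>) t)" by (rule bounded_linear_scaleR_left)
    show "(\<lambda>h. norm (wint \<beta> \<psi> (t + h) - wint \<beta> \<psi> t - h *\<^sub>R wint \<beta> (vderiv \<psi>) t) / norm h) \<midarrow>0\<rightarrow> 0"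
    proof (rule Lim_null_comparison)
      show "\<forall>\<^sub>F h in at 0. norm (norm (wint \<beta> \<psi> (t + h) - wint \<beta> \<psi> t - h *\<^sub>R wint \<beta> (vderiv \<psi>) t) / norm h) \<le> (3 * C * I) * \<bar>h\<bar>"
        unfolding eventually_at
      proof (intro exI[of _ t] conjI ballI impI t)
        fix h :: real assume "h \<noteq> 0 \<and> dist h 0 < t"
        then have h: "h \<noteq> 0" "\<bar>h\<bar> < t" by auto
        have h2: "h\<^sup>2 = \<bar>h\<bar> * \<bar>h\<bar>" by (simp add: power2_eq_square abs_mult_self_eq)
        have "norm (wint \<beta> \<psi> (t + h) - wint \<beta> \<psi> t - h *\<^sub>R wint \<beta> (vderiv \<psi>) t) \<le> (3 * C * I * \<bar>h\<bar>) * \<bar>h\<bar>"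
          using bd[OF h(2)] unfolding h2 by (simp only: mult.assoc)
        then show "norm (norm (wint \<beta> \<psi> (t + h) - wint \<beta> \<psi> t - h *\<^sub>R wint \<beta> (vderiv \<psi>) t) / norm h) \<le> (3 * C * I) * \<bar>h\<bar>"
          using h(1) by (simp add: divide_le_eq)
      qed
      show "(\<lambda>h. (3 * C * I) * \<bar>h\<bar>) \<midarrow>0\<rightarrow> 0"
        by (intro tendsto_mult_right_zero tendsto_rabs_zero tendsto_ident_at)
    qed
  qed
qed

text \<open>The one integration that lowers the order of a Weyl derivative by one; decay at infinity
  removes the boundary term.\<close>

lemma wint_FTC:
  assumes \<beta>: "0 < \<beta>" "\<beta> \<le> 1" and \<psi>: "schwartz_plus \<psi>" and t: "t > 0"
  shows "(\<integral>x. wint \<beta> (vderiv \<psi>) (t + x) \<partial>half_line) = - wint \<beta> \<psi> t"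
proof (rule integral_half_line_FTC[OF _ _ _ _ t])
  note \<psi>' = schwartz_vderiv[OF \<psi>]
  show "(wint \<beta> \<psi> has_vector_derivative wint \<beta> (vderiv \<psi>) s) (at s)" if "s > 0" for s
    by (rule wint_has_derivative[OF \<beta> \<psi> that])
  show cont: "isCont (wint \<beta> (vderiv \<psi>)) s" if "s > 0" for s
    using has_vector_derivative_continuous[OF wint_has_derivative[OF \<beta> \<psi>' that]] by simp
  obtain C where C: "C \<ge> 0" "\<And>t. t > 0 \<Longrightarrow> norm (wint \<beta> (vderiv \<psi>) t) \<le> C * (1 + t) powr (- 2)"
    using wint_decay[OF \<beta> \<psi>'] by blast
  have m: "wint \<beta> (vderiv \<psi>) \<in> borel_measurable half_line"
  proof -
    have "continuous_on {0<..} (wint \<beta> (vderiv \<psi>))"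
      using cont by (intro continuous_at_imp_continuous_on) auto
    then have "wint \<beta> (vderiv \<psi>) \<in> borel_measurable (restrict_space borel {0<..})"
      by (rule borel_measurable_continuous_on_restrict)
    then show ?thesis
      by (simp add: half_line_def measurable_cong_sets[OF sets_restrict_space_cong[OF sets_lborel] refl])
  qed
  show "integrable half_line (\<lambda>x. wint \<beta> (vderiv \<psi>) (t + x))"
  proof (rule Bochner_Integration.integrable_bound)
    have "integrable half_line (\<lambda>x. x powr 0 * (1 + x) powr (- 2))"
      by (rule integrable_half_line_powr) auto
    then show "integrable half_line (\<lambda>x. C * (x powr 0 * (1 + x) powr (- 2)))" by (rule integrable_mult_right)
    show "(\<lambda>x. wint \<beta> (vderiv \<psi>) (t + x)) \<in> borel_measurable half_line"
      by (rule half_line_shift_measurable[OF m less_imp_le[OF t]])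
    show "AE x in half_line. norm (wint \<beta> (vderiv \<psi>) (t + x)) \<le> norm (C * (x powr 0 * (1 + x) powr (- 2)))"
    proof (rule AE_half_line)
      fix x :: real assume x: "x > 0"
      have "norm (wint \<beta> (vderiv \<psi>) (t + x)) \<le> C * (1 + (t + x)) powr (- 2)" using C(2)[of "t + x"] x t by simp
      also have "\<dots> \<le> C * (1 + x) powr (- 2)" using C x t by (intro mult_left_mono powr_mono2') auto
      finally show "norm (wint \<beta> (vderiv \<psi>) (t + x)) \<le> norm (C * (x powr 0 * (1 + x) powr (- 2)))"
        using C x by simp
    qed
  qed
  obtain D where D: "D \<ge> 0" "\<And>t. t > 0 \<Longrightarrow> norm (wint \<beta> \<psi> t) \<le> D * (1 + t) powr (- 2)"
    using wint_decay[OF \<beta> \<psi>] by blast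
  show "(wint \<beta> \<psi> \<longlongrightarrow> 0) at_top"
  proof (rule Lim_null_comparison)
    show "\<forall>\<^sub>F t in at_top. norm (wint \<beta> \<psi> t) \<le> D * (1 + t) powr (- 2)"
      using D(2) by (intro eventually_mono[OF eventually_gt_at_top[of 0]])
    have "filterlim (\<lambda>t::real. 1 + t) at_top at_top"
      by (intro filterlim_tendsto_add_at_top[OF tendsto_const] filterlim_ident)
    from tendsto_neg_powr[OF _ this, of "- 2"]
    show "((\<lambda>t. D * (1 + t) powr (- 2)) \<longlongrightarrow> 0) at_top"
      by (intro tendsto_mult_right_zero) simp
  qed
qed

lemma wint_1:
  assumes \<psi>: "schwartz_plus \<psi>" and t: "t > 0"
  shows "wint 1 (vderiv \<psi>) t = - \<psi> t"
proof -
  have i: "integrable half_line (\<lambda>x. vderiv \<psi> (t + x))"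
    using wint_integrable[of 1 "vderiv \<psi>" t] schwartz_vderiv[OF \<psi>] t
    by (subst Bochner_Integration.integrable_cong[OF refl, where g = "\<lambda>x. x powr (1 - 1) *\<^sub>R vderiv \<psi> (t + x)"]) auto
  have "wint 1 (vderiv \<psi>) t = (\<integral>x. vderiv \<psi> (t + x) \<partial>half_line)"
    unfolding wint_def by (rule Bochner_Integration.integral_cong) auto
  also have "\<dots> = - \<psi> t"
  proof (rule integral_half_line_FTC[OF _ _ i _ t])
    show "(\<psi> has_vector_derivative vderiv \<psi> s) (at s)" if "s > 0" for s
      using schwartz_derivs[OF \<psi> that, of 0] by simp
    show "isCont (vderiv \<psi>) s" if "s > 0" for s by (rule schwartz_isCont[OF schwartz_vderiv[OF \<psi>] that])
    show "(\<psi> \<longlongrightarrow> 0) at_top" by (rule schwartz_tendsto_0[OF \<psi>])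
  qed
  finally show ?thesis .
qed

lemma vderiv_funpow_weyl_int:
  assumes \<beta>: "0 < \<beta>" "\<beta> \<le> 1" and \<psi>: "schwartz_plus \<psi>" and t: "t > 0"
  shows "(vderiv ^^ n) (weyl_int \<beta> \<psi>) t = weyl_int \<beta> ((vderiv ^^ n) \<psi>) t"
proof (rule vderiv_funpow_eq[where F = "\<lambda>n. weyl_int \<beta> ((vderiv ^^ n) \<psi>)"])
  show "(weyl_int \<beta> ((vderiv ^^ n) \<psi>) has_vector_derivative weyl_int \<beta> ((vderiv ^^ Suc n) \<psi>) s) (at s)" if "s > 0" for n s
    unfolding weyl_int_eq_wint[abs_def] funpow.simps(2) comp_apply
    by (intro has_vector_derivative_mult_right wint_has_derivative \<beta> schwartz_vderiv_funpow \<psi> that)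
qed (use t in simp_all)

text \<open>For order \<open>k + \<gamma>\<close> the definition has \<open>n = k + 1\<close> and a
  Weyl integral of order \<open>1 - \<gamma>\<close> in \<open>(0, 1]\<close>, through which the
  derivatives pass onto \<open>\<phi>\<close>. The identity prescribed for order 0 agrees with the
  formula by \<open>wint_1\<close>.\<close>

lemma weyl_deriv_schwartz:
  fixes k :: nat and \<gamma> :: real
  assumes \<gamma>: "0 \<le> \<gamma>" "\<gamma> < 1" and \<phi>: "schwartz_plus \<phi>" and t: "t > 0"
  shows "weyl_deriv (real k + \<gamma>) \<phi> t = (- 1) ^ Suc k * (complex_of_real (1 / Gamma (1 - \<gamma>)) * wint (1 - \<gamma>) ((vderiv ^^ Suc k) \<phi>) t)"
proof (cases "real k + \<gamma> = 0")
  case True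
  then have "k = 0" "\<gamma> = 0" using \<gamma> by (auto simp: add_nonneg_eq_0_iff)
  then show ?thesis using wint_1[OF \<phi> t] by (simp add: weyl_deriv_def)
next
  case False
  have fl: "\<lfloor>\<gamma>\<rfloor> = 0" using \<gamma> by (simp add: floor_unique)
  have "weyl_deriv (real k + \<gamma>) \<phi> t = (- 1) ^ Suc k * (vderiv ^^ Suc k) (weyl_int (1 - \<gamma>) \<phi>) t"
    using False by (simp add: weyl_deriv_def Let_def fl)
  also have "(vderiv ^^ Suc k) (weyl_int (1 - \<gamma>) \<phi>) t = weyl_int (1 - \<gamma>) ((vderiv ^^ Suc k) \<phi>) t"
    by (rule vderiv_funpow_weyl_int) (use \<gamma> \<phi> t in auto)
  finally show ?thesis by (simp add: weyl_int_eq_wint)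
qed

section \<open>Weighted Weyl derivatives as kernel operators\<close>

definition weyl_G :: "real \<Rightarrow> (real \<Rightarrow> complex) \<Rightarrow> real \<Rightarrow> complex" where
  "weyl_G \<alpha> \<phi> t = complex_of_real (t powr \<alpha>) * weyl_deriv \<alpha> \<phi> t"

lemma T_norm_eq: "T_norm \<alpha> p \<phi> = hnorm p (weyl_G \<alpha> \<phi>) / Gamma (\<alpha> + 1)"
  by (simp add: T_norm_def lp_norm_def integral_half_line weyl_G_def norm_mult mult.commute)

lemma lp_fun_cong: "(\<And>x. x \<in> space M \<Longrightarrow> f x = g x) \<Longrightarrow> lp_fun M p f \<longleftrightarrow> lp_fun M p g"
  unfolding lp_fun_def
  by (intro arg_cong2[where f = "(\<and>)"] measurable_cong Bochner_Integration.integrable_cong) auto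

lemma lp_norm_cong: "(\<And>x. x \<in> space M \<Longrightarrow> f x = g x) \<Longrightarrow> lp_norm M p f = lp_norm M p g"
  unfolding lp_norm_def
  by (intro arg_cong2[where f = "(powr)"] refl Bochner_Integration.integral_cong) auto

lemma real_split_floor:
  assumes "\<alpha> \<ge> 0"
  obtains k :: nat and \<gamma> :: real where "\<alpha> = real k + \<gamma>" "0 \<le> \<gamma>" "\<gamma> < 1"
proof
  show "\<alpha> = real (nat \<lfloor>\<alpha>\<rfloor>) + frac \<alpha>" using assms by (simp add: frac_def)
qed (auto simp: frac_lt_1)

lemma wint_cong: "(\<And>s. s > 0 \<Longrightarrow> f s = g s) \<Longrightarrow> t > 0 \<Longrightarrow> wint \<beta> f t = wint \<beta> g t"
  unfolding wint_def by (rule Bochner_Integration.integral_cong) auto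

lemma weyl_G_linear:
  assumes \<alpha>: "\<alpha> \<ge> 0" and \<phi>: "schwartz_plus \<phi>" and \<psi>: "schwartz_plus \<psi>" and t: "t > 0"
  shows "weyl_G \<alpha> (\<lambda>s. \<phi> s + c * \<psi> s) t = weyl_G \<alpha> \<phi> t + c * weyl_G \<alpha> \<psi> t"
proof -
  obtain k \<gamma> where a: "\<alpha> = real k + \<gamma>" "0 \<le> \<gamma>" "\<gamma> < 1" using real_split_floor[OF \<alpha>] .
  note c\<psi> = schwartz_cmult[OF \<psi>, of c]
  have \<beta>: "0 < 1 - \<gamma>" "1 - \<gamma> \<le> 1" using a by auto
  have "wint (1 - \<gamma>) ((vderiv ^^ Suc k) (\<lambda>s. \<phi> s + c * \<psi> s)) t = wint (1 - \<gamma>) (\<lambda>s. (vderiv ^^ Suc k) \<phi> s + c * (vderiv ^^ Suc k) \<psi> s) t"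
    by (rule wint_cong) (simp_all only: vderiv_funpow_add[OF \<phi> c\<psi>] vderiv_funpow_cmult[OF \<psi>] t)
  also have "\<dots> = wint (1 - \<gamma>) ((vderiv ^^ Suc k) \<phi>) t + c * wint (1 - \<gamma>) ((vderiv ^^ Suc k) \<psi>) t"
  proof -
    note i = wint_integrable[OF \<beta> schwartz_vderiv_funpow[OF \<phi>, of "Suc k"] less_imp_le[OF t]]
      and j = wint_integrable[OF \<beta> schwartz_vderiv_funpow[OF \<psi>, of "Suc k"] less_imp_le[OF t]]
    have "wint (1 - \<gamma>) (\<lambda>s. (vderiv ^^ Suc k) \<phi> s + c * (vderiv ^^ Suc k) \<psi> s) t =
      (\<integral>x. x powr (1 - \<gamma> - 1) *\<^sub>R (vderiv ^^ Suc k) \<phi> (t + x) + c * (x powr (1 - \<gamma> - 1) *\<^sub>R (vderiv ^^ Suc k) \<psi> (t + x)) \<partial>half_line)"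
      unfolding wint_def by (rule Bochner_Integration.integral_cong) (simp_all only: scaleR_add_right mult_scaleR_right)
    also have "\<dots> = wint (1 - \<gamma>) ((vderiv ^^ Suc k) \<phi>) t + c * wint (1 - \<gamma>) ((vderiv ^^ Suc k) \<psi>) t"
      unfolding wint_def using i j
      by (subst Bochner_Integration.integral_add) (auto simp del: mult_scaleR_right funpow.simps)
    finally show ?thesis .
  qed
  finally show ?thesis
    unfolding weyl_G_def a(1) weyl_deriv_schwartz[OF a(2,3) schwartz_add[OF \<phi> c\<psi>] t]
      weyl_deriv_schwartz[OF a(2,3) \<phi> t] weyl_deriv_schwartz[OF a(2,3) \<psi> t]
    by (simp add: algebra_simps del: funpow.simps)
qed

lemma weyl_G_diff:
  assumes "\<alpha> \<ge> 0" "schwartz_plus \<phi>" "schwartz_plus \<psi>" "t > 0"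
  shows "weyl_G \<alpha> (\<lambda>s. \<phi> s - \<psi> s) t = weyl_G \<alpha> \<phi> t - weyl_G \<alpha> \<psi> t"
  using weyl_G_linear[OF assms, of "- 1"] by simp

text \<open>The second exponent of the kernel cancels the \<open>u\<close>-part of the weight
  \<open>(t * u) ^ Suc k\<close> and leaves \<open>t ^ Suc k\<close>. In this form membership in
  \<open>L^p\<close> follows from the bound for kernel operators.\<close>

lemma weyl_G_eq_kop:
  assumes \<gamma>: "0 \<le> \<gamma>" "\<gamma> < 1" and \<phi>: "schwartz_plus \<phi>" and t: "t > 0"
  shows "weyl_G (real k + \<gamma>) \<phi> t = ((- 1) ^ Suc k * complex_of_real (1 / Gamma (1 - \<gamma>))) *
    kop (weyl_ker (- \<gamma>) (- real (Suc k))) (\<lambda>s. complex_of_real (s ^ Suc k) * (vderiv ^^ Suc k) \<phi> s) t"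
proof -
  define \<psi> where "\<psi> = (vderiv ^^ Suc k) \<phi>"
  define h where "h s = ((s / t - 1) powr (- \<gamma>) * (s / t) powr (- real (Suc k)) * s ^ Suc k) *\<^sub>R \<psi> s" for s
  have "kop (weyl_ker (- \<gamma>) (- real (Suc k))) (\<lambda>s. complex_of_real (s ^ Suc k) * \<psi> s) t = (\<integral>u. indicator {1<..} u *\<^sub>R h (t * u) \<partial>half_line)"
    unfolding kop_def
    by (rule Bochner_Integration.integral_cong) (use t in \<open>auto simp: weyl_ker_def h_def indicator_def scaleR_conv_of_real\<close>)
  also have "\<dots> = (1 / t) *\<^sub>R (\<integral>x. h (t + x) \<partial>half_line)" by (rule integral_half_line_dilate_shift[OF t])
  also have "(\<integral>x. h (t + x) \<partial>half_line) = (\<integral>x. (t powr \<gamma> * t ^ Suc k) *\<^sub>R (x powr (1 - \<gamma> - 1) *\<^sub>R \<psi> (t + x)) \<partial>half_line)"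
  proof (rule Bochner_Integration.integral_cong[OF refl])
    fix x assume "x \<in> space half_line"
    then have x: "x > 0" by simp
    have "((t + x) / t - 1) powr (- \<gamma>) = (x / t) powr (- \<gamma>)" using t by (simp add: add_divide_distrib)
    also have "\<dots> = x powr (- \<gamma>) * t powr \<gamma>" using t x by (simp add: powr_divide powr_minus divide_simps)
    finally have 1: "((t + x) / t - 1) powr (- \<gamma>) = x powr (- \<gamma>) * t powr \<gamma>" .
    have "((t + x) / t) powr (- real (Suc k)) * (t + x) ^ Suc k = (t + x) powr (- real (Suc k)) / t powr (- real (Suc k)) * (t + x) powr (real (Suc k))"
      using t x by (subst powr_divide) (auto simp only: powr_realpow[symmetric] add_pos_pos)
    also have "\<dots> = t powr (real (Suc k))"
      using t x by (simp only: powr_minus) (simp add: field_simps)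
    also have "\<dots> = t ^ Suc k" using t by (simp only: powr_realpow)
    finally have 2: "((t + x) / t) powr (- real (Suc k)) * (t + x) ^ Suc k = t ^ Suc k" .
    have "((t + x) / t - 1) powr (- \<gamma>) * ((t + x) / t) powr (- real (Suc k)) * (t + x) ^ Suc k = t powr \<gamma> * t ^ Suc k * x powr (1 - \<gamma> - 1)"
      unfolding mult.assoc 2 1 by simp
    then show "h (t + x) = (t powr \<gamma> * t ^ Suc k) *\<^sub>R (x powr (1 - \<gamma> - 1) *\<^sub>R \<psi> (t + x))"
      unfolding h_def by (simp only: scaleR_scaleR)
  qed
  also have "\<dots> = (t powr \<gamma> * t ^ Suc k) *\<^sub>R wint (1 - \<gamma>) \<psi> t"
    unfolding wint_def by (simp only: integral_scaleR_right)
  also have "(1 / t) *\<^sub>R \<dots> = t powr (real k + \<gamma>) *\<^sub>R wint (1 - \<gamma>) \<psi> t"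
    using t by (simp add: powr_add powr_realpow mult_ac)
  finally show ?thesis
    unfolding weyl_G_def weyl_deriv_schwartz[OF \<gamma> \<phi> t] \<psi>_def[symmetric]
    by (simp add: scaleR_conv_of_real)
qed

lemma weyl_G_lp:
  assumes p: "p \<ge> 1" and \<alpha>: "\<alpha> \<ge> 0" and \<phi>: "schwartz_plus \<phi>"
  shows "hfun p (weyl_G \<alpha> \<phi>)"
proof -
  obtain k \<gamma> where a: "\<alpha> = real k + \<gamma>" "0 \<le> \<gamma>" "\<gamma> < 1" using real_split_floor[OF \<alpha>] .
  have "1 / p > 0" "real (Suc k) \<ge> 1" using p by simp_all
  then have "- \<gamma> + - real (Suc k) - 1 / p < - 1" using a(2) by linarith
  then have "kern p (weyl_ker (- \<gamma>) (- real (Suc k)))"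
    using a p by (intro kern_weyl_ker) simp_all
  note kop_bounded(2)[OF p this schwartz_lp[OF p schwartz_vderiv_funpow[OF \<phi>, of "Suc k"], of "Suc k"]]
  from lp_fun_cmult[OF this, of "(- 1) ^ Suc k * complex_of_real (1 / Gamma (1 - \<gamma>))"]
  show ?thesis unfolding a(1)
    by (rule lp_fun_cong[THEN iffD2, rotated]) (simp only: space_half_line greaterThan_iff weyl_G_eq_kop[OF a(2,3) \<phi>])
qed

text \<open>The kernel power cancels the weight \<open>s powr (\<alpha> + 1)\<close>; what remains
  is the integral from \<open>t\<close> to infinity of the Weyl derivative of order
  \<open>\<alpha> + 1\<close>, which \<open>wint_FTC\<close> evaluates.\<close>

lemma weyl_G_res:
  assumes \<alpha>: "\<alpha> \<ge> 0" and \<phi>: "schwartz_plus \<phi>" and t: "t > 0"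
  shows "weyl_G \<alpha> \<phi> t = kop (res_ker \<alpha>) (weyl_G (\<alpha> + 1) \<phi>) t"
proof -
  obtain k \<gamma> where a: "\<alpha> = real k + \<gamma>" "0 \<le> \<gamma>" "\<gamma> < 1" using real_split_floor[OF \<alpha>] .
  have a1: "\<alpha> + 1 = real (Suc k) + \<gamma>" using a by simp
  define \<psi> where "\<psi> = (vderiv ^^ Suc k) \<phi>"
  have \<psi>: "schwartz_plus \<psi>" unfolding \<psi>_def by (rule schwartz_vderiv_funpow[OF \<phi>])
  define h where "h s = (s / t) powr (- \<alpha> - 1) *\<^sub>R weyl_G (\<alpha> + 1) \<phi> s" for s
  have "kop (res_ker \<alpha>) (weyl_G (\<alpha> + 1) \<phi>) t = (\<integral>u. indicator {1<..} u *\<^sub>R h (t * u) \<partial>half_line)"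
    unfolding kop_def
    by (rule Bochner_Integration.integral_cong) (use t in \<open>auto simp: res_ker_def h_def indicator_def\<close>)
  also have "\<dots> = (1 / t) *\<^sub>R (\<integral>x. h (t + x) \<partial>half_line)" by (rule integral_half_line_dilate_shift[OF t])
  also have "(\<integral>x. h (t + x) \<partial>half_line) = (\<integral>x. (complex_of_real (t powr (\<alpha> + 1)) * ((- 1) ^ Suc (Suc k) * complex_of_real (1 / Gamma (1 - \<gamma>)))) * wint (1 - \<gamma>) (vderiv \<psi>) (t + x) \<partial>half_line)"
  proof (rule Bochner_Integration.integral_cong[OF refl])
    fix x assume "x \<in> space half_line"
    then have x: "t + x > 0" using t by simp
    have "((t + x) / t) powr (- (\<alpha> + 1)) * (t + x) powr (\<alpha> + 1) = t powr (\<alpha> + 1)"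
      using t x by (simp only: powr_divide powr_minus) (simp add: field_simps)
    then have e: "((t + x) / t) powr (- \<alpha> - 1) * (t + x) powr (\<alpha> + 1) = t powr (\<alpha> + 1)"
      by (simp only: minus_add_distrib diff_conv_add_uminus)
    have "h (t + x) = (((t + x) / t) powr (- \<alpha> - 1) * (t + x) powr (\<alpha> + 1)) *\<^sub>R weyl_deriv (\<alpha> + 1) \<phi> (t + x)"
      by (simp add: h_def weyl_G_def scaleR_conv_of_real)
    also have "\<dots> = t powr (\<alpha> + 1) *\<^sub>R weyl_deriv (\<alpha> + 1) \<phi> (t + x)" unfolding e ..
    also have "weyl_deriv (\<alpha> + 1) \<phi> (t + x) = (- 1) ^ Suc (Suc k) * (complex_of_real (1 / Gamma (1 - \<gamma>)) * wint (1 - \<gamma>) (vderiv \<psi>) (t + x))"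
      unfolding a1 weyl_deriv_schwartz[OF a(2,3) \<phi> x] by (simp add: \<psi>_def)
    finally show "h (t + x) = (complex_of_real (t powr (\<alpha> + 1)) * ((- 1) ^ Suc (Suc k) * complex_of_real (1 / Gamma (1 - \<gamma>)))) * wint (1 - \<gamma>) (vderiv \<psi>) (t + x)"
      by (simp only: scaleR_conv_of_real mult.assoc)
  qed
  also have "\<dots> = (complex_of_real (t powr (\<alpha> + 1)) * ((- 1) ^ Suc (Suc k) * complex_of_real (1 / Gamma (1 - \<gamma>)))) * (- wint (1 - \<gamma>) \<psi> t)"
    by (subst integral_mult_right_zero) (subst wint_FTC, use a \<psi> t in auto)
  also have "(1 / t) *\<^sub>R \<dots> = complex_of_real (t powr \<alpha>) * ((- 1) ^ Suc k * (complex_of_real (1 / Gamma (1 - \<gamma>)) * wint (1 - \<gamma>) \<psi> t))"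
    using t by (simp add: scaleR_conv_of_real powr_add field_simps)
  also have "\<dots> = weyl_G \<alpha> \<phi> t"
    unfolding weyl_G_def unfolding a(1) weyl_deriv_schwartz[OF a(2,3) \<phi> t] \<psi>_def ..
  finally show ?thesis ..
qed

lemma weyl_G_0: "t > 0 \<Longrightarrow> weyl_G 0 \<phi> t = \<phi> t"
  by (simp add: weyl_G_def weyl_deriv_def)

text \<open>Abel's inversion: up to constants, both \<open>weyl_G g \<phi>\<close> and
  \<open>\<phi>\<close> itself are kernel operators applied to \<open>D\<close>, the function
  \<open>s\<close> times the derivative of \<open>\<phi>\<close>. For \<open>\<phi>\<close> the
  kernel is \<open>res_ker 0\<close>, and \<open>kop_frac_compose\<close> factors this operator
  through the other one.\<close>

lemma schwartz_eq_frac: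
  fixes p g :: real
  assumes p: "p \<ge> 1" and g: "0 < g" "g < 1" and \<phi>: "schwartz_plus \<phi>"
  shows "AE t in half_line. \<phi> t = complex_of_real (Gamma (1 - g) / Beta g (1 - g)) * kop (weyl_ker (g - 1) (- g)) (weyl_G g \<phi>) t"
proof -
  define D where "D s = complex_of_real (s ^ Suc 0) * (vderiv ^^ Suc 0) \<phi> s" for s
  have D: "hfun p D" unfolding D_def by (rule schwartz_lp[OF p schwartz_vderiv_funpow[OF \<phi>]])
  have G: "weyl_G g \<phi> s = - complex_of_real (1 / Gamma (1 - g)) * kop (weyl_ker (- g) (- 1)) D s" if "s > 0" for s
    using weyl_G_eq_kop[of g \<phi> s 0] g \<phi> that by (simp add: D_def[abs_def])
  have R: "kop (res_ker 0) D s = - \<phi> s" if s: "s > 0" for s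
  proof -
    have "weyl_G (real 0 + 0) \<phi> s = - kop (weyl_ker 0 (- 1)) D s"
      using weyl_G_eq_kop[of 0 \<phi> s 0] \<phi> s by (simp add: D_def[abs_def])
    also have "kop (weyl_ker 0 (- 1)) D s = kop (res_ker 0) D s"
      by (rule kop_kernel_cong) (auto simp: weyl_ker_def res_ker_def)
    finally show ?thesis using weyl_G_0[OF s, of \<phi>] by simp
  qed
  have "AE t in half_line. t \<in> space half_line" by (rule AE_space)
  then show ?thesis
    using kop_frac_compose[OF p g D]
  proof eventually_elim
    case (elim t)
    then have t: "t > 0" by simp
    have "kop (weyl_ker (g - 1) (- g)) (weyl_G g \<phi>) t = kop (weyl_ker (g - 1) (- g)) (\<lambda>s. - complex_of_real (1 / Gamma (1 - g)) * kop (weyl_ker (- g) (- 1)) D s) t"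
      by (rule kop_cong[OF G t])
    also have "\<dots> = - complex_of_real (1 / Gamma (1 - g)) * (Beta g (1 - g) *\<^sub>R (- \<phi> t))"
      unfolding kop_cmult elim(2) R[OF t] ..
    finally have "kop (weyl_ker (g - 1) (- g)) (weyl_G g \<phi>) t = complex_of_real (Beta g (1 - g) / Gamma (1 - g)) * \<phi> t"
      by (simp add: scaleR_conv_of_real)
    moreover have "Gamma (1 - g) > 0" using g by (intro Gamma_real_pos) simp
    ultimately show ?case using Beta_pos[OF g] by simp
  qed
qed

text \<open>Exponentials are eigenfunctions of Weyl derivatives, with eigenvalue
  \<open>a powr \<alpha>\<close>. What matters is that the constant is positive, so it is left in
  terms of the integral \<open>J\<close>, which rescaling relates to a Gamma value.\<close>

lemma weyl_G_exp:
  assumes \<alpha>: "\<alpha> \<ge> 0" and a: "a > 0"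
  obtains c where "c > 0" "\<And>t. t > 0 \<Longrightarrow> weyl_G \<alpha> (\<lambda>s. complex_of_real (exp (- a * s))) t = complex_of_real (c * (t powr \<alpha> * exp (- a * t)))"
proof -
  obtain k \<gamma> where k: "\<alpha> = real k + \<gamma>" "0 \<le> \<gamma>" "\<gamma> < 1" using real_split_floor[OF \<alpha>] .
  define \<beta> where "\<beta> = 1 - \<gamma>"
  have \<beta>: "\<beta> > 0" using k by (simp add: \<beta>_def)
  have GG: "Gamma \<beta> > 0" by (rule Gamma_real_pos[OF \<beta>])
  define J where "J = (\<integral>x. x powr (\<beta> - 1) * exp (- a * x) \<partial>half_line)"
  have "has_bochner_integral half_line (\<lambda>x. indicator {0..} x * (x powr (\<beta> - 1) / exp x)) (Gamma \<beta>)"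
    by (rule has_bochner_integral_half_lineI[OF _ _ Gamma_integral_real[OF \<beta>]]) auto
  then have "Gamma \<beta> = (\<integral>x. indicator {0..} x * (x powr (\<beta> - 1) / exp x) \<partial>half_line)"
    by (simp add: has_bochner_integral_iff)
  also have "\<dots> = a * (\<integral>x. indicator {0..} (a * x) * ((a * x) powr (\<beta> - 1) / exp (a * x)) \<partial>half_line)"
    using a integral_half_line_scale[OF a, of "\<lambda>x. indicator {0..} x * (x powr (\<beta> - 1) / exp x)"] by simp
  also have "(\<integral>x. indicator {0..} (a * x) * ((a * x) powr (\<beta> - 1) / exp (a * x)) \<partial>half_line) = (\<integral>x. a powr (\<beta> - 1) * (x powr (\<beta> - 1) * exp (- a * x)) \<partial>half_line)"
    by (rule Bochner_Integration.integral_cong) (use a in \<open>auto simp: indicator_def powr_mult exp_minus divide_simps\<close>)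
  also have "\<dots> = a powr (\<beta> - 1) * J" by (simp add: J_def)
  finally have "0 < (a * a powr (\<beta> - 1)) * J" using GG by simp
  then have J: "J > 0" by (rule zero_less_mult_pos) (use a in simp)
  define c where "c = a ^ Suc k * J / Gamma \<beta>"
  have c: "c > 0" using a J GG by (simp add: c_def)
  have "weyl_G \<alpha> (\<lambda>s. complex_of_real (exp (- a * s))) t = complex_of_real (c * (t powr \<alpha> * exp (- a * t)))" if t: "t > 0" for t
  proof -
    have "wint \<beta> ((vderiv ^^ Suc k) (\<lambda>s. complex_of_real (exp (- a * s)))) t = wint \<beta> (\<lambda>s. complex_of_real ((- a) ^ Suc k * exp (- a * s))) t"
      by (rule wint_cong[OF vderiv_funpow_exp t])
    also have "\<dots> = (\<integral>x. complex_of_real (((- a) ^ Suc k * exp (- a * t)) * (x powr (\<beta> - 1) * exp (- a * x))) \<partial>half_line)"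
      unfolding wint_def
      by (rule Bochner_Integration.integral_cong) (simp_all add: scaleR_conv_of_real exp_add[symmetric] algebra_simps exp_of_real[symmetric])
    also have "\<dots> = complex_of_real (((- a) ^ Suc k * exp (- a * t)) * J)"
      by (simp only: integral_complex_of_real J_def integral_mult_right_zero)
    finally have w: "wint \<beta> ((vderiv ^^ Suc k) (\<lambda>s. complex_of_real (exp (- a * s)))) t = complex_of_real (((- a) ^ Suc k * exp (- a * t)) * J)" .
    have "weyl_G \<alpha> (\<lambda>s. complex_of_real (exp (- a * s))) t = complex_of_real (t powr \<alpha> * ((- 1) ^ Suc k * (1 / Gamma \<beta> * (((- a) ^ Suc k * exp (- a * t)) * J))))"
      unfolding weyl_G_def unfolding k(1) weyl_deriv_schwartz[OF k(2,3) schwartz_exp[OF a] t] w[unfolded \<beta>_def] \<beta>_def by simp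
    also have "t powr \<alpha> * ((- 1) ^ Suc k * (1 / Gamma \<beta> * (((- a) ^ Suc k * exp (- a * t)) * J))) = (((- 1) ^ Suc k * (- a) ^ Suc k) * J / Gamma \<beta>) * (t powr \<alpha> * exp (- a * t))"
      by (simp only: divide_inverse mult_ac mult_1_left mult_1_right)
    also have "(- 1) ^ Suc k * (- a) ^ Suc k = a ^ Suc k" by (simp only: power_mult_distrib[symmetric]) simp
    finally show ?thesis unfolding c_def .
  qed
  with c show ?thesis by (rule that)
qed

section \<open>The inverse of the weighted Weyl derivative\<close>

lemma lp_norm_diff_eq_0_iff:
  assumes "p \<ge> 1" "lp_fun M p f" "lp_fun M p g"
  shows "lp_norm M p (\<lambda>s. f s - g s) = 0 \<longleftrightarrow> (AE s in M. f s = g s)"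
  using lp_norm_eq_0_iff[OF assms(1) lp_fun_diff[OF assms]] by simp

text \<open>\<open>rep_op p \<alpha> H\<close> says that \<open>H\<close> is the bounded injective inverse on \<open>L\<^sup>p\<close> of
  \<open>f \<mapsto> t\<^sup>\<alpha> W\<^sup>\<alpha> f\<close>. The space \<open>T_space \<alpha> p\<close> will be its range.\<close>

definition rep_op :: "real \<Rightarrow> real \<Rightarrow> ((real \<Rightarrow> complex) \<Rightarrow> real \<Rightarrow> complex) \<Rightarrow> bool" where
  "rep_op p \<alpha> H \<longleftrightarrow>
     (\<forall>f. hfun p f \<longrightarrow> hfun p (H f)) \<and>
     (\<exists>B\<ge>0. \<forall>f. hfun p f \<longrightarrow> hnorm p (H f) \<le> B * hnorm p f) \<and>
     (\<forall>f g c. hfun p f \<longrightarrow> hfun p g \<longrightarrow>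
        (AE s in half_line. H (\<lambda>s. f s + c * g s) s = H f s + c * H g s)) \<and>
     (\<forall>f. hfun p f \<longrightarrow> hnorm p (H f) = 0 \<longrightarrow> hnorm p f = 0) \<and>
     (\<forall>f t. hfun p f \<longrightarrow> (AE s in half_line. H (T_grp p t f) s = T_grp p t (H f) s)) \<and>
     (\<forall>\<phi>. schwartz_plus \<phi> \<longrightarrow> (AE s in half_line. \<phi> s = H (weyl_G \<alpha> \<phi>) s))"

lemma rep_op_lp: "rep_op p \<alpha> H \<Longrightarrow> hfun p f \<Longrightarrow> hfun p (H f)"
  by (simp add: rep_op_def)

lemma rep_op_bounded: 
  assumes "rep_op p \<alpha> H" 
  obtains B where "B \<ge> 0" "\<And>f. hfun p f \<Longrightarrow> hnorm p (H f) \<le> B * hnorm p f"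
  using assms unfolding rep_op_def by blast

lemma rep_op_linear: 
  "rep_op p \<alpha> H \<Longrightarrow> hfun p f \<Longrightarrow> hfun p g \<Longrightarrow>
     AE s in half_line. H (\<lambda>s. f s + c * g s) s = H f s + c * H g s"
  by (simp add: rep_op_def)

lemma rep_op_injective: 
  "rep_op p \<alpha> H \<Longrightarrow> hfun p f \<Longrightarrow> hnorm p (H f) = 0 \<Longrightarrow> hnorm p f = 0"
  by (simp add: rep_op_def)

lemma rep_op_T_grp: 
  "rep_op p \<alpha> H \<Longrightarrow> hfun p f \<Longrightarrow> AE s in half_line. H (T_grp p t f) s = T_grp p t (H f) s"
  by (simp add: rep_op_def)

lemma rep_op_schwartz: "rep_op p \<alpha> H \<Longrightarrow> schwartz_plus \<phi> \<Longrightarrow> AE s in half_line. \<phi> s = H (weyl_G \<alpha> \<phi>) s"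
  by (simp add: rep_op_def)

lemma rep_op_diff:
  assumes "rep_op p \<alpha> H" "hfun p f" "hfun p g"
  shows "AE s in half_line. H (\<lambda>s. f s - g s) s = H f s - H g s"
  using rep_op_linear[OF assms, of "- 1"] by simp

lemma rep_op_norm_diff:
  assumes p: "p \<ge> 1" and H: "rep_op p \<alpha> H" and f: "hfun p f" and g: "hfun p g"
  shows "hnorm p (\<lambda>s. H f s - H g s) = hnorm p (H (\<lambda>s. f s - g s))"
  using rep_op_diff[OF H f g] rep_op_lp[OF H f] rep_op_lp[OF H g] rep_op_lp[OF H lp_fun_diff[OF p f g]]
  by (intro lp_norm_cong_AE) (auto simp: lp_fun_def)

text \<open>\<open>H\<close> acts on functions, not on classes; linearity and boundedness make it
  respect equality almost everywhere.\<close>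

lemma rep_op_cong_AE:
  assumes p: "p \<ge> 1" and H: "rep_op p \<alpha> H" and f: "hfun p f" and g: "hfun p g"
    and ae: "AE s in half_line. f s = g s"
  shows "AE s in half_line. H f s = H g s"
proof -
  obtain B where B: "B \<ge> 0" "\<And>f. hfun p f \<Longrightarrow> hnorm p (H f) \<le> B * hnorm p f"
    using rep_op_bounded[OF H] by blast
  have "hnorm p (\<lambda>s. H f s - H g s) \<le> B * hnorm p (\<lambda>s. f s - g s)"
    unfolding rep_op_norm_diff[OF p H f g] by (rule B(2)[OF lp_fun_diff[OF p f g]])
  also have "hnorm p (\<lambda>s. f s - g s) = 0"
    using lp_norm_diff_eq_0_iff[OF p f g] ae by simp
  finally have "hnorm p (\<lambda>s. H f s - H g s) = 0" using lp_norm_nonneg by (simp add: antisym)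
  then show ?thesis using lp_norm_diff_eq_0_iff[OF p rep_op_lp[OF H f] rep_op_lp[OF H g]] by simp
qed

lemma kop_linear:
  assumes p: "p \<ge> 1" and k: "kern p k" and f: "hfun p f" and g: "hfun p g"
  shows "AE t in half_line. kop k (\<lambda>x. f x + c * g x) t = kop k f t + c * kop k g t"
  using kop_bounded(1)[OF p k f] kop_bounded(1)[OF p k lp_fun_cmult[OF g, of c]]
proof eventually_elim
  case (elim t)
  then have "kop k (\<lambda>x. f x + c * g x) t = kop k f t + kop k (\<lambda>x. c * g x) t"
    by (simp add: kop_def scaleR_add_right)
  then show ?case by (simp add: kop_cmult)
qed

lemma kern_integral_nonneg: "kern p k \<Longrightarrow> 0 \<le> (\<integral>u. k u * u powr (- 1 / p) \<partial>half_line)"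
  by (intro Bochner_Integration.integral_nonneg) (auto simp: kern_def)

lemma rep_op_0: 
  assumes "p \<ge> 1" shows "rep_op p 0 (\<lambda>f. f)"
proof -
  have "\<exists>B\<ge>0. \<forall>f. hfun p f \<longrightarrow> hnorm p f \<le> B * hnorm p f"
    by (rule exI[of _ 1]) simp
  then show ?thesis unfolding rep_op_def by (auto intro!: AE_half_line simp: weyl_G_0)
qed

lemma rep_op_frac:
  assumes p: "p \<ge> 1" and g: "0 < g" "g < 1"
  shows "\<exists>H. rep_op p g H"
proof -
  \<comment> \<open>The constant undoes the Gamma factor of the Weyl integral and the Beta value of
    the composition.\<close>
  define c where "c = complex_of_real (Gamma (1 - g) / Beta g (1 - g))"
  have "Gamma (1 - g) > 0" using g by (intro Gamma_real_pos) simp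
  then have c: "c \<noteq> 0" using Beta_pos[OF g] by (simp add: c_def)
  define k where "k = weyl_ker (g - 1) (- g)"
  have k: "kern p k" unfolding k_def by (rule kern_frac(1)[OF p g])
  let ?H = "\<lambda>f s. c * kop k f s"
  have "rep_op p g ?H"
    unfolding rep_op_def
  proof (intro conjI allI impI)
    show "hfun p (?H f)" if "hfun p f" for f
      by (intro lp_fun_cmult kop_bounded(2)[OF p k that])
    show "\<exists>B\<ge>0. \<forall>f. hfun p f \<longrightarrow> hnorm p (?H f) \<le> B * hnorm p f"
    proof (intro exI[of _ "norm c * (\<integral>u. k u * u powr (- 1 / p) \<partial>half_line)"] conjI allI impI)
      show "0 \<le> norm c * (\<integral>u. k u * u powr (- 1 / p) \<partial>half_line)"
        by (intro mult_nonneg_nonneg kern_integral_nonneg[OF k]) auto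
      show "hnorm p (?H f) \<le> norm c * (\<integral>u. k u * u powr (- 1 / p) \<partial>half_line) * hnorm p f" if "hfun p f" for f
        unfolding lp_norm_cmult[OF p] mult.assoc by (intro mult_left_mono kop_bounded(3)[OF p k that]) simp
    qed
    show "AE s in half_line. ?H (\<lambda>s. f s + a * h s) s = ?H f s + a * ?H h s"
      if "hfun p f" "hfun p h" for f h a
      using kop_linear[OF p k that, of a] by eventually_elim (simp add: algebra_simps)
    show "hnorm p f = 0" if "hfun p f" "hnorm p (?H f) = 0" for f
      using that c kop_frac_injective[OF p g that(1)] by (simp add: lp_norm_cmult[OF p] k_def)
    show "AE s in half_line. ?H (T_grp p t f) s = T_grp p t (?H f) s" for f t
      by (rule AE_half_line) (simp add: kop_T_grp, simp add: T_grp_def)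
    show "AE s in half_line. \<phi> s = ?H (weyl_G g \<phi>) s" if "schwartz_plus \<phi>" for \<phi>
      using schwartz_eq_frac[OF p g that] by (simp add: c_def k_def)
  qed
  then show ?thesis by blast
qed

text \<open>Injectivity and compatibility with dilations hold factor by factor; the formula for
  Schwartz functions is \<open>weyl_G_res\<close> followed by the one for order
  \<open>\<alpha>\<close>.\<close>

lemma rep_op_Suc:
  assumes p: "p \<ge> 1" and \<alpha>: "\<alpha> \<ge> 0" and H: "rep_op p \<alpha> H"
  shows "rep_op p (\<alpha> + 1) (\<lambda>f. H (kop (res_ker \<alpha>) f))"
  unfolding rep_op_def
proof (intro conjI allI impI)
  note k = kern_res_ker[OF p \<alpha>]
  note lpk = kop_bounded(2)[OF p k]
  show "hfun p (H (kop (res_ker \<alpha>) f))" if "hfun p f" for f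
    by (intro rep_op_lp[OF H] lpk that)
  obtain B where B: "B \<ge> 0" "\<And>f. hfun p f \<Longrightarrow> hnorm p (H f) \<le> B * hnorm p f"
    using rep_op_bounded[OF H] by blast
  show "\<exists>B\<ge>0. \<forall>f. hfun p f \<longrightarrow> hnorm p (H (kop (res_ker \<alpha>) f)) \<le> B * hnorm p f"
  proof (intro exI[of _ "B * (\<integral>u. res_ker \<alpha> u * u powr (- 1 / p) \<partial>half_line)"] conjI allI impI)
    show "0 \<le> B * (\<integral>u. res_ker \<alpha> u * u powr (- 1 / p) \<partial>half_line)"
      by (intro mult_nonneg_nonneg kern_integral_nonneg[OF k] B)
    fix f assume f: "hfun p f"
    have "hnorm p (H (kop (res_ker \<alpha>) f)) \<le> B * hnorm p (kop (res_ker \<alpha>) f)"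
      by (rule B(2)[OF lpk[OF f]])
    also have "\<dots> \<le> B * ((\<integral>u. res_ker \<alpha> u * u powr (- 1 / p) \<partial>half_line) * hnorm p f)"
      by (intro mult_left_mono kop_bounded(3)[OF p k f] B)
    finally show "hnorm p (H (kop (res_ker \<alpha>) f)) \<le> B * (\<integral>u. res_ker \<alpha> u * u powr (- 1 / p) \<partial>half_line) * hnorm p f"
      by (simp add: mult.assoc)
  qed
  show "AE s in half_line. H (kop (res_ker \<alpha>) (\<lambda>s. f s + c * g s)) s = H (kop (res_ker \<alpha>) f) s + c * H (kop (res_ker \<alpha>) g) s"
    if f: "hfun p f" and g: "hfun p g" for f g c
    using rep_op_cong_AE[OF p H lpk[OF lp_fun_add[OF p f lp_fun_cmult[OF g]]] lp_fun_add[OF p lpk[OF f] lp_fun_cmult[OF lpk[OF g]]] kop_linear[OF p k f g, of c]]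
      rep_op_linear[OF H lpk[OF f] lpk[OF g], of c]
    by eventually_elim simp
  show "hnorm p f = 0" if "hfun p f" "hnorm p (H (kop (res_ker \<alpha>) f)) = 0" for f
    using res_injective[OF p \<alpha> that(1)] rep_op_injective[OF H lpk[OF that(1)] that(2)] by simp
  show "AE s in half_line. H (kop (res_ker \<alpha>) (T_grp p t f)) s = T_grp p t (H (kop (res_ker \<alpha>) f)) s"
    if f: "hfun p f" for f t
    using rep_op_T_grp[OF H lpk[OF f], of t] by (simp add: kop_T_grp[abs_def])
  show "AE s in half_line. \<phi> s = H (kop (res_ker \<alpha>) (weyl_G (\<alpha> + 1) \<phi>)) s" if \<phi>: "schwartz_plus \<phi>" for \<phi>
  proof -
    have "hfun p (kop (res_ker \<alpha>) (weyl_G (\<alpha> + 1) \<phi>))"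
      using \<alpha> by (intro lpk weyl_G_lp p \<phi>) simp
    moreover have "AE s in half_line. weyl_G \<alpha> \<phi> s = kop (res_ker \<alpha>) (weyl_G (\<alpha> + 1) \<phi>) s"
      by (intro AE_half_line weyl_G_res \<alpha> \<phi>)
    ultimately have "AE s in half_line. H (weyl_G \<alpha> \<phi>) s = H (kop (res_ker \<alpha>) (weyl_G (\<alpha> + 1) \<phi>)) s"
      by (rule rep_op_cong_AE[OF p H weyl_G_lp[OF p \<alpha> \<phi>]])
    with rep_op_schwartz[OF H \<phi>] show ?thesis by eventually_elim simp
  qed
qed

lemma rep_op_exists:
  assumes p: "p \<ge> 1" and \<alpha>: "\<alpha> \<ge> 0"
  shows "\<exists>H. rep_op p \<alpha> H"
proof -
  obtain k \<gamma> where a: "\<alpha> = real k + \<gamma>" "0 \<le> \<gamma>" "\<gamma> < 1" using real_split_floor[OF \<alpha>] .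
  have "\<exists>H. rep_op p (real n + \<gamma>) H" for n
  proof (induction n)
    case 0
    show ?case using rep_op_0[OF p] rep_op_frac[OF p, of \<gamma>] a by (cases "\<gamma> = 0") auto
  next
    case (Suc n)
    then obtain H where "rep_op p (real n + \<gamma>) H" by blast
    from rep_op_Suc[OF p _ this] a show ?case by (auto simp: add_ac)
  qed
  then show ?thesis by (simp add: a(1))
qed

section \<open>Density of weighted Weyl derivatives and the description of
  \<open>T_space\<close>\<close>

lemma weyl_G_dense:
  assumes p: "p \<ge> 1" and \<alpha>: "\<alpha> \<ge> 0" and G: "hfun p G" and e: "e > 0"
  shows "\<exists>\<phi>. schwartz_plus \<phi> \<and> hnorm p (\<lambda>s. weyl_G \<alpha> \<phi> s - G s) < e"
proof -
  \<comment> \<open>Agreement is asked only at positive arguments, since the formulas for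
    \<open>weyl_G\<close> hold there.\<close>
  define V where "V = {v. \<exists>\<phi>. schwartz_plus \<phi> \<and> (\<forall>t>0. v t = weyl_G \<alpha> \<phi> t)}"
  have lin: "(\<lambda>s. v s + c * w s) \<in> V" if vw: "v \<in> V" "w \<in> V" for v w c
  proof -
    obtain \<phi> \<psi> where \<phi>: "schwartz_plus \<phi>" "\<forall>t>0. v t = weyl_G \<alpha> \<phi> t" and \<psi>: "schwartz_plus \<psi>" "\<forall>t>0. w t = weyl_G \<alpha> \<psi> t"
      using vw by (auto simp: V_def)
    have "schwartz_plus (\<lambda>s. \<phi> s + c * \<psi> s)" by (intro schwartz_add schwartz_cmult \<phi> \<psi>)
    then show ?thesis unfolding V_def using weyl_G_linear[OF \<alpha> \<phi>(1) \<psi>(1)] \<phi> \<psi>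
      by (intro CollectI exI[of _ "\<lambda>s. \<phi> s + c * \<psi> s"]) auto
  qed
  have "\<exists>v\<in>V. hnorm p (\<lambda>s. G s - v s) < e"
  proof (rule lp_dense[OF p, where \<alpha> = \<alpha>])
    show "hfun p v" if v: "v \<in> V" for v
    proof -
      obtain \<phi> where "schwartz_plus \<phi>" "\<forall>t>0. v t = weyl_G \<alpha> \<phi> t" using v by (auto simp: V_def)
      then show ?thesis using weyl_G_lp[OF p \<alpha>, of \<phi>] lp_fun_cong[of half_line v "weyl_G \<alpha> \<phi>" p] by simp
    qed
    have E: "(\<lambda>s. complex_of_real (s powr \<alpha> * exp (- (real k + 1) * s))) \<in> V" for k
    proof -
      have a: "real k + 1 > 0" by simp
      obtain c where c: "c > 0" "\<And>t. t > 0 \<Longrightarrow> weyl_G \<alpha> (\<lambda>s. complex_of_real (exp (- (real k + 1) * s))) t = complex_of_real (c * (t powr \<alpha> * exp (- (real k + 1) * t)))"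
        using weyl_G_exp[OF \<alpha> a] by blast
      note S = schwartz_exp[OF a]
      \<comment> \<open>A zero Schwartz function, so that \<open>weyl_G_linear\<close> also yields
        pure multiples.\<close>
      have z: "schwartz_plus (\<lambda>s. 0 * complex_of_real (exp (- (real k + 1) * s)))" by (rule schwartz_cmult[OF S])
      show ?thesis unfolding V_def
      proof (intro CollectI exI conjI allI impI)
        show "schwartz_plus (\<lambda>s. 0 * complex_of_real (exp (- (real k + 1) * s)) + complex_of_real (1 / c) * complex_of_real (exp (- (real k + 1) * s)))"
          by (intro schwartz_add z schwartz_cmult S)
        fix t :: real assume t: "t > 0"
        have z0: "weyl_G \<alpha> (\<lambda>s. 0 * complex_of_real (exp (- (real k + 1) * s))) t = 0"
          using weyl_G_diff[OF \<alpha> S S t] by simp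
        show "complex_of_real (t powr \<alpha> * exp (- (real k + 1) * t)) = weyl_G \<alpha> (\<lambda>s. 0 * complex_of_real (exp (- (real k + 1) * s)) + complex_of_real (1 / c) * complex_of_real (exp (- (real k + 1) * s))) t"
          unfolding weyl_G_linear[OF \<alpha> z S t] z0 c(2)[OF t] using c(1) by simp
      qed
    qed
    then show "(\<lambda>s. complex_of_real (s powr \<alpha> * exp (- (real k + 1) * s))) \<in> V" for k .
    show "(\<lambda>s. v s + w s) \<in> V" if "v \<in> V" "w \<in> V" for v w using lin[OF that, of 1] by simp
    show "(\<lambda>s. c * v s) \<in> V" if "v \<in> V" for c v
    proof -
      have "(\<lambda>s. v s + (- 1) * v s) \<in> V" by (rule lin[OF that that])
      from lin[OF this that, of c] show ?thesis by simp
    qed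
  qed (use G e in auto)
  then obtain v \<phi> where v: "hnorm p (\<lambda>s. G s - v s) < e" and \<phi>: "schwartz_plus \<phi>" "\<forall>t>0. v t = weyl_G \<alpha> \<phi> t"
    by (auto simp: V_def)
  have "hnorm p (\<lambda>s. weyl_G \<alpha> \<phi> s - G s) = hnorm p (\<lambda>s. v s - G s)"
    using \<phi> by (intro lp_norm_cong) simp
  then show ?thesis using v \<phi>(1) lp_norm_minus_commute[of half_line p v G] by auto
qed

lemma schwartz_lp0: "p \<ge> 1 \<Longrightarrow> schwartz_plus \<phi> \<Longrightarrow> hfun p \<phi>"
  using schwartz_lp[of p \<phi> 0] by simp

lemma T_norm_diff:
  assumes "\<alpha> \<ge> 0" "schwartz_plus \<phi>" "schwartz_plus \<psi>"
  shows "T_norm \<alpha> p (\<lambda>s. \<phi> s - \<psi> s) = hnorm p (\<lambda>s. weyl_G \<alpha> \<phi> s - weyl_G \<alpha> \<psi> s) / Gamma (\<alpha> + 1)"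
  unfolding T_norm_eq by (intro arg_cong2[where f = "(/)"] lp_norm_cong refl) (simp add: weyl_G_diff[OF assms])

text \<open>\<open>T_norm\<close> is the \<open>L^p\<close> norm of \<open>weyl_G\<close> up to a
  constant, so completeness provides \<open>G\<close>. Boundedness of \<open>H\<close> carries the
  convergence over to \<open>\<phi> n\<close>, which equals
  \<open>H (weyl_G \<alpha> (\<phi> n))\<close> almost everywhere, and limits in \<open>L^p\<close>
  are unique.\<close>

lemma T_approx_limit:
  assumes p: "p \<ge> 1" and \<alpha>: "\<alpha> \<ge> 0" and H: "rep_op p \<alpha> H" and f: "hfun p f" and ap: "T_approx \<alpha> p \<phi> f"
  obtains G where "hfun p G" "(\<lambda>n. hnorm p (\<lambda>s. weyl_G \<alpha> (\<phi> n) s - G s)) \<longlonglongrightarrow> 0"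
    "AE s in half_line. f s = H G s"
proof -
  have \<phi>: "schwartz_plus (\<phi> n)" for n using ap by (simp add: T_approx_def)
  have Gpos: "Gamma (\<alpha> + 1) > 0" using \<alpha> by (intro Gamma_real_pos) simp
  have lpG: "hfun p (weyl_G \<alpha> (\<phi> n))" for n by (rule weyl_G_lp[OF p \<alpha> \<phi>])
  have cau: "\<exists>N. \<forall>m\<ge>N. \<forall>n\<ge>N. hnorm p (\<lambda>s. weyl_G \<alpha> (\<phi> m) s - weyl_G \<alpha> (\<phi> n) s) < e" if e: "e > 0" for e
  proof -
    have "e / Gamma (\<alpha> + 1) > 0" using e Gpos by simp
    then obtain N where N: "\<And>m n. m \<ge> N \<Longrightarrow> n \<ge> N \<Longrightarrow> T_norm \<alpha> p (\<lambda>s. \<phi> m s - \<phi> n s) < e / Gamma (\<alpha> + 1)"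
      using ap unfolding T_approx_def by blast
    have "hnorm p (\<lambda>s. weyl_G \<alpha> (\<phi> m) s - weyl_G \<alpha> (\<phi> n) s) < e" if "m \<ge> N" "n \<ge> N" for m n
      using N[OF that] Gpos unfolding T_norm_diff[OF \<alpha> \<phi> \<phi>] by (simp add: divide_less_cancel)
    then show ?thesis by blast
  qed
  obtain G where G: "hfun p G" and lim: "(\<lambda>n. hnorm p (\<lambda>s. weyl_G \<alpha> (\<phi> n) s - G s)) \<longlonglongrightarrow> 0"
    by (rule lp_complete[OF p lpG cau])
  obtain B where B: "B \<ge> 0" "\<And>f. hfun p f \<Longrightarrow> hnorm p (H f) \<le> B * hnorm p f"
    using rep_op_bounded[OF H] by blast
  note HG = rep_op_lp[OF H G]
  have "hnorm p (\<lambda>s. f s - H G s) \<le> 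
      hnorm p (\<lambda>s. \<phi> n s - f s) + B * hnorm p (\<lambda>s. weyl_G \<alpha> (\<phi> n) s - G s)" for n
  proof -
    have "hnorm p (\<lambda>s. \<phi> n s - H G s) = hnorm p (\<lambda>s. H (weyl_G \<alpha> (\<phi> n)) s - H G s)"
      using rep_op_schwartz[OF H \<phi>[of n]] schwartz_lp0[OF p \<phi>[of n]] HG rep_op_lp[OF H lpG[of n]]
      by (intro lp_norm_cong_AE) (auto simp: lp_fun_def)
    also have "\<dots> \<le> B * hnorm p (\<lambda>s. weyl_G \<alpha> (\<phi> n) s - G s)"
      unfolding rep_op_norm_diff[OF p H lpG G] by (rule B(2)[OF lp_fun_diff[OF p lpG G]])
    finally show ?thesis
      using lp_norm_triangle3[OF p f schwartz_lp0[OF p \<phi>[of n]] HG] lp_norm_minus_commute[of half_line p f "\<phi> n"] by simp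
  qed
  moreover have "(\<lambda>n. hnorm p (\<lambda>s. \<phi> n s - f s) + B * hnorm p (\<lambda>s. weyl_G \<alpha> (\<phi> n) s - G s)) \<longlonglongrightarrow> 0 + B * 0"
    using ap by (intro tendsto_intros lim) (simp add: T_approx_def Lp_norm_eq)
  ultimately have "hnorm p (\<lambda>s. f s - H G s) \<le> 0"
    by (intro LIMSEQ_le_const) auto
  then have "hnorm p (\<lambda>s. f s - H G s) = 0" using lp_norm_nonneg by (simp add: antisym)
  then have "AE s in half_line. f s = H G s" using lp_norm_diff_eq_0_iff[OF p f HG] by simp
  then show ?thesis using that[OF G lim] by simp
qed

text \<open>Density of the functions \<open>weyl_G \<alpha> \<phi>\<close> produces the sequence;
  boundedness of \<open>H\<close> turns its convergence to \<open>G\<close> into convergence to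
  \<open>f\<close> in \<open>L^p\<close>.\<close>

lemma T_approx_exists:
  assumes p: "p \<ge> 1" and \<alpha>: "\<alpha> \<ge> 0" and H: "rep_op p \<alpha> H" and f: "hfun p f" and G: "hfun p G"
    and fG: "AE s in half_line. f s = H G s"
  shows "\<exists>\<phi>. T_approx \<alpha> p \<phi> f"
proof -
  have Gpos: "Gamma (\<alpha> + 1) > 0" using \<alpha> by (intro Gamma_real_pos) simp
  have "\<exists>\<phi>. schwartz_plus \<phi> \<and> hnorm p (\<lambda>s. weyl_G \<alpha> \<phi> s - G s) < 1 / real (Suc n)" for n
    by (rule weyl_G_dense[OF p \<alpha> G]) simp
  then obtain \<phi> where \<phi>: "\<And>n. schwartz_plus (\<phi> n)" and small: "\<And>n. hnorm p (\<lambda>s. weyl_G \<alpha> (\<phi> n) s - G s) < 1 / real (Suc n)"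
    by metis
  have lpG: "hfun p (weyl_G \<alpha> (\<phi> n))" for n by (rule weyl_G_lp[OF p \<alpha> \<phi>])
  have lim: "(\<lambda>n. hnorm p (\<lambda>s. weyl_G \<alpha> (\<phi> n) s - G s)) \<longlonglongrightarrow> 0"
  proof (rule tendsto_sandwich[OF _ _ tendsto_const LIMSEQ_inverse_real_of_nat])
    have "hnorm p (\<lambda>s. weyl_G \<alpha> (\<phi> n) s - G s) \<le> inverse (real (Suc n))" for n
      using small[of n] by (simp only: inverse_eq_divide less_imp_le)
    then show "\<forall>\<^sub>F n in sequentially. hnorm p (\<lambda>s. weyl_G \<alpha> (\<phi> n) s - G s) \<le> inverse (real (Suc n))"
      by (rule always_eventually[OF allI])
  qed simp
  have "T_approx \<alpha> p \<phi> f"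
    unfolding T_approx_def
  proof (intro conjI allI impI \<phi>)
    fix e :: real assume e: "e > 0"
    then have "e * Gamma (\<alpha> + 1) / 2 > 0" using Gpos by simp
    from order_tendstoD(2)[OF lim this] obtain N where N: "\<And>n. n \<ge> N \<Longrightarrow> hnorm p (\<lambda>s. weyl_G \<alpha> (\<phi> n) s - G s) < e * Gamma (\<alpha> + 1) / 2"
      by (auto simp: eventually_sequentially)
    have "T_norm \<alpha> p (\<lambda>s. \<phi> m s - \<phi> n s) < e" if "m \<ge> N" "n \<ge> N" for m n
    proof -
      have "hnorm p (\<lambda>s. weyl_G \<alpha> (\<phi> m) s - weyl_G \<alpha> (\<phi> n) s) < e * Gamma (\<alpha> + 1)"
        using lp_norm_triangle3[OF p lpG G lpG, of m n] N[OF that(1)] N[OF that(2)] lp_norm_minus_commute[of half_line p G "weyl_G \<alpha> (\<phi> n)"] by simp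
      then show ?thesis unfolding T_norm_diff[OF \<alpha> \<phi> \<phi>] using Gpos by (simp add: divide_less_eq)
    qed
    then show "\<exists>N. \<forall>m\<ge>N. \<forall>n\<ge>N. T_norm \<alpha> p (\<lambda>s. \<phi> m s - \<phi> n s) < e" by blast
  next
    obtain B where B: "B \<ge> 0" "\<And>f. hfun p f \<Longrightarrow> hnorm p (H f) \<le> B * hnorm p f"
      using rep_op_bounded[OF H] by blast
    show "(\<lambda>n. Lp_norm p (\<lambda>s. \<phi> n s - f s)) \<longlonglongrightarrow> 0"
    proof (rule tendsto_sandwich[OF _ _ tendsto_const])
      show "(\<lambda>n. B * hnorm p (\<lambda>s. weyl_G \<alpha> (\<phi> n) s - G s)) \<longlonglongrightarrow> 0"
        by (rule tendsto_mult_right_zero[OF lim])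
      have "Lp_norm p (\<lambda>s. \<phi> n s - f s) \<le> B * hnorm p (\<lambda>s. weyl_G \<alpha> (\<phi> n) s - G s)" for n
      proof -
        have "AE s in half_line. \<phi> n s - f s = H (weyl_G \<alpha> (\<phi> n)) s - H G s"
          using rep_op_schwartz[OF H \<phi>[of n]] fG by eventually_elim simp
        then have "Lp_norm p (\<lambda>s. \<phi> n s - f s) = hnorm p (\<lambda>s. H (weyl_G \<alpha> (\<phi> n)) s - H G s)"
          unfolding Lp_norm_eq using schwartz_lp0[OF p \<phi>[of n]] f rep_op_lp[OF H lpG[of n]] rep_op_lp[OF H G]
          by (intro lp_norm_cong_AE) (auto simp: lp_fun_def)
        also have "\<dots> \<le> B * hnorm p (\<lambda>s. weyl_G \<alpha> (\<phi> n) s - G s)"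
          unfolding rep_op_norm_diff[OF p H lpG G] by (rule B(2)[OF lp_fun_diff[OF p lpG G]])
        finally show ?thesis .
      qed
      then show "\<forall>\<^sub>F n in sequentially. Lp_norm p (\<lambda>s. \<phi> n s - f s) \<le> B * hnorm p (\<lambda>s. weyl_G \<alpha> (\<phi> n) s - G s)" by simp
    qed (simp add: Lp_norm_eq)
  qed
  then show ?thesis by blast
qed

text \<open>The assumption \<open>H0\<close> reflects that order 0 is defined without a completion:
  the space is then \<open>L^p\<close> itself, which the identity represents.\<close>

lemma T_space_iff:
  assumes p: "p \<ge> 1" and \<alpha>: "\<alpha> \<ge> 0" and H: "rep_op p \<alpha> H" and H0: "\<alpha> = 0 \<longrightarrow> H = (\<lambda>f. f)"
  shows "f \<in> T_space \<alpha> p \<longleftrightarrow> hfun p f \<and> (\<exists>G. hfun p G \<and> (AE s in half_line. f s = H G s))"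
proof (cases "\<alpha> = 0")
  case True
  then show ?thesis using H0 by (auto simp: T_space_def Lp_iff)
next
  case False
  then have "f \<in> T_space \<alpha> p \<longleftrightarrow> hfun p f \<and> (\<exists>\<phi>. T_approx \<alpha> p \<phi> f)" by (simp add: T_space_def Lp_iff)
  then show ?thesis
    using T_approx_limit[OF p \<alpha> H, of f] T_approx_exists[OF p \<alpha> H, of f] by metis
qed

text \<open>Whatever sequence \<open>SOME\<close> picks, its limit \<open>G'\<close> satisfies
  \<open>H G' = H G\<close> almost everywhere, and injectivity of \<open>H\<close> makes the norms
  of \<open>G'\<close> and \<open>G\<close> equal. So the value does not depend on the
  choice.\<close>

lemma T_space_norm_eq:
  assumes p: "p \<ge> 1" and \<alpha>: "\<alpha> \<ge> 0" and H: "rep_op p \<alpha> H" and H0: "\<alpha> = 0 \<longrightarrow> H = (\<lambda>f. f)"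
    and f: "hfun p f" and G: "hfun p G" and fG: "AE s in half_line. f s = H G s"
  shows "T_space_norm \<alpha> p f = hnorm p G / Gamma (\<alpha> + 1)"
proof (cases "\<alpha> = 0")
  case True
  then have "hnorm p f = hnorm p G"
    using H0 fG f G by (intro lp_norm_cong_AE) (auto simp: lp_fun_def)
  then show ?thesis using True by (simp add: T_space_norm_def Lp_norm_eq)
next
  case False
  define \<phi> where "\<phi> = (SOME \<phi>. T_approx \<alpha> p \<phi> f)"
  have ap: "T_approx \<alpha> p \<phi> f" unfolding \<phi>_def using T_approx_exists[OF p \<alpha> H f G fG] by (rule someI_ex)
  then have \<phi>: "schwartz_plus (\<phi> n)" for n by (simp add: T_approx_def)
  obtain G' where G': "hfun p G'" and lim: "(\<lambda>n. hnorm p (\<lambda>s. weyl_G \<alpha> (\<phi> n) s - G' s)) \<longlonglongrightarrow> 0"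
    and fG': "AE s in half_line. f s = H G' s"
    by (rule T_approx_limit[OF p \<alpha> H f ap])
  have "AE s in half_line. H G s = H G' s" using fG fG' by eventually_elim simp
  then have "hnorm p (H (\<lambda>s. G s - G' s)) = 0"
    using lp_norm_diff_eq_0_iff[OF p rep_op_lp[OF H G] rep_op_lp[OF H G']] by (simp add: rep_op_norm_diff[OF p H G G'])
  then have "hnorm p (\<lambda>s. G s - G' s) = 0" by (rule rep_op_injective[OF H lp_fun_diff[OF p G G']])
  then have eq: "hnorm p G' = hnorm p G"
    using lp_norm_abs_diff[OF p G G'] by simp
  have lpG: "hfun p (weyl_G \<alpha> (\<phi> n))" for n by (rule weyl_G_lp[OF p \<alpha> \<phi>])
  have "(\<lambda>n. hnorm p (weyl_G \<alpha> (\<phi> n)) - hnorm p G') \<longlonglongrightarrow> 0"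
    using lp_norm_abs_diff[OF p lpG G'] by (intro Lim_null_comparison[OF _ lim] always_eventually) simp
  then have "(\<lambda>n. hnorm p (weyl_G \<alpha> (\<phi> n))) \<longlonglongrightarrow> hnorm p G'" by (simp add: LIM_zero_iff)
  then have "(\<lambda>n. T_norm \<alpha> p (\<phi> n)) \<longlonglongrightarrow> hnorm p G' / Gamma (\<alpha> + 1)"
    unfolding T_norm_eq divide_inverse by (intro tendsto_mult_right)
  then have "lim (\<lambda>n. T_norm \<alpha> p (\<phi> n)) = hnorm p G' / Gamma (\<alpha> + 1)" by (rule limI)
  then show ?thesis using False eq by (simp add: T_space_norm_def \<phi>_def)
qed

lemma T_grp_cong_AE:
  assumes p: "p \<ge> 1" and f: "hfun p f" and g: "hfun p g" and ae: "AE s in half_line. f s = g s"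
  shows "AE s in half_line. T_grp p t f s = T_grp p t g s"
proof -
  have "(\<lambda>s. T_grp p t f s - T_grp p t g s) = T_grp p t (\<lambda>s. f s - g s)" by (auto simp: T_grp_def algebra_simps)
  then have "hnorm p (\<lambda>s. T_grp p t f s - T_grp p t g s) = 0"
    using lp_norm_diff_eq_0_iff[OF p f g] ae by (simp add: lp_norm_T_grp[OF p])
  then show ?thesis using lp_norm_diff_eq_0_iff[OF p lp_fun_T_grp[OF f] lp_fun_T_grp[OF g]] by simp
qed

lemma rep_op_quot:
  assumes p: "p \<ge> 1" and H: "rep_op p \<alpha> H" and G: "hfun p G" and Q: "hfun p Q"
    and f: "hfun p f" and fG: "AE s in half_line. f s = H G s" and gQ: "AE s in half_line. g s = H Q s"
  shows "AE s in half_line. (T_grp p t f s - f s) / complex_of_real t - g s = H (\<lambda>s. (T_grp p t G s - G s) / complex_of_real t - Q s) s"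
proof -
  let ?D = "\<lambda>s. T_grp p t G s - G s"
  note TG = lp_fun_T_grp[OF G, of t]
  note D = lp_fun_diff[OF p TG G]
  \<comment> \<open>The function \<open>- Q\<close> is written as \<open>Q + (- 2) * Q\<close>, so
    that the rule for \<open>f + c * g\<close> suffices.\<close>
  have e: "(\<lambda>s. (T_grp p t G s - G s) / complex_of_real t - Q s) = (\<lambda>s. Q s + (- 2) * Q s + (1 / complex_of_real t) * ?D s)"
    by auto
  have "hfun p (\<lambda>s. Q s + (- 2) * Q s)" by (intro lp_fun_add p Q lp_fun_cmult)
  note l1 = rep_op_linear[OF H this D, of "1 / complex_of_real t"]
  have "AE s in half_line. T_grp p t f s = T_grp p t (H G) s"
    by (rule T_grp_cong_AE[OF p f rep_op_lp[OF H G] fG])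
  then show ?thesis
    unfolding e using l1 rep_op_linear[OF H Q Q, of "- 2"] rep_op_diff[OF H TG G] rep_op_T_grp[OF H G, of t] fG gQ
  proof eventually_elim
    case (elim s)
    show ?case unfolding elim(2) elim(3) elim(4) elim(5) elim(6) elim(7) elim(1) by simp
  qed
qed

section \<open>The weak form of the generator\<close>

text \<open>Hoelder's inequality on \<open>[a, b]\<close>, obtained from Jensen's inequality with
  the indicator as weight; in this way \<open>p = 1\<close> is covered without a conjugate
  exponent.\<close>

lemma lp_local:
  assumes p: "p \<ge> 1" and ab: "0 < a" "a < b" and f: "hfun p f"
  shows "integrable half_line (\<lambda>s. indicator {a..b} s * norm (f s))"
    "(\<integral>s. indicator {a..b} s * norm (f s) \<partial>half_line) \<le> (b - a) powr ((p - 1) / p) * hnorm p f"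
proof -
  have "has_bochner_integral half_line (\<lambda>s. indicator {a..b} s * (1::real)) (b - a)"
  proof (rule has_bochner_integral_half_lineI)
    show "((\<lambda>x. 1::real) has_integral b - a) {a..b}"
      using has_integral_const_real[of "1::real" a b] ab by simp
  qed (use ab in auto)
  then have w: "integrable half_line (indicator {a..b} :: real \<Rightarrow> real)" and W: "(\<integral>s. indicator {a..b} s \<partial>half_line) = b - a"
    by (auto simp: has_bochner_integral_iff)
  have [measurable]: "f \<in> borel_measurable half_line" using f by (simp add: lp_fun_def)
  have [measurable]: "(indicator {a..b} :: real \<Rightarrow> real) \<in> borel_measurable half_line" using w by auto
  have i: "integrable half_line (\<lambda>s. indicator {a..b} s * norm (f s) powr p)"
    by (rule Bochner_Integration.integrable_bound[OF lp_fun_integrable[OF f]]) (auto simp: indicator_def)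
  note j = jensen_powr[OF p w _ _ _ i, unfolded W]
  show "integrable half_line (\<lambda>s. indicator {a..b} s * norm (f s))"
    by (rule j(1)) (use ab in auto)
  define I where "I = (\<integral>s. indicator {a..b} s * norm (f s) \<partial>half_line)"
  have "I powr p \<le> (b - a) powr (p - 1) * (\<integral>s. indicator {a..b} s * norm (f s) powr p \<partial>half_line)"
    unfolding I_def by (rule j(2)) (use ab in auto)
  also have "\<dots> \<le> (b - a) powr (p - 1) * (\<integral>s. norm (f s) powr p \<partial>half_line)"
    by (intro mult_left_mono integral_mono i lp_fun_integrable[OF f]) (auto simp: indicator_def)
  also have "\<dots> = ((b - a) powr ((p - 1) / p) * hnorm p f) powr p"
    using p ab by (simp add: lp_norm_powr[OF p, symmetric] powr_mult powr_powr)
  finally have le: "I powr p \<le> ((b - a) powr ((p - 1) / p) * hnorm p f) powr p" .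
  have "(I powr p) powr (1 / p) \<le> (((b - a) powr ((p - 1) / p) * hnorm p f) powr p) powr (1 / p)"
    by (rule powr_mono2[OF _ _ le]) (use p in auto)
  moreover have "I \<ge> 0" unfolding I_def by (intro Bochner_Integration.integral_nonneg) auto
  ultimately show "I \<le> (b - a) powr ((p - 1) / p) * hnorm p f"
    using p by (simp add: powr_powr)
qed

lemma lp_pairing:
  assumes p: "p \<ge> 1" and ab: "0 < a" "a < b" and f: "hfun p f"
    and g: "g \<in> borel_measurable borel" "\<And>s. s \<notin> {a..b} \<Longrightarrow> g s = 0" "\<And>s. norm (g s) \<le> M"
  shows "integrable half_line (\<lambda>s. f s * g s)"
    "norm (\<integral>s. f s * g s \<partial>half_line) \<le> M * (b - a) powr ((p - 1) / p) * hnorm p f"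
proof -
  note l = lp_local[OF p ab f]
  have M: "M \<ge> 0" using g(3)[of 0] norm_ge_zero order_trans by blast
  have bd: "norm (f s * g s) \<le> M * (indicator {a..b} s * norm (f s))" for s
    using mult_left_mono[OF g(3)[of s], of "norm (f s)"] g(2)[of s] by (auto simp: indicator_def norm_mult mult_ac)
  show i: "integrable half_line (\<lambda>s. f s * g s)"
  proof (rule Bochner_Integration.integrable_bound)
    show "integrable half_line (\<lambda>s. M * (indicator {a..b} s * norm (f s)))" using l(1) by simp
    show "(\<lambda>s. f s * g s) \<in> borel_measurable half_line"
      using f measurable_half_line_borel[OF g(1)] by (auto simp: lp_fun_def)
    show "AE s in half_line. norm (f s * g s) \<le> norm (M * (indicator {a..b} s * norm (f s)))"
      using bd M by (intro AE_I2) (metis abs_of_nonneg norm_ge_zero order_trans real_norm_def)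
  qed
  have "norm (\<integral>s. f s * g s \<partial>half_line) \<le> (\<integral>s. norm (f s * g s) \<partial>half_line)" by (rule integral_norm_bound)
  also have "\<dots> \<le> (\<integral>s. M * (indicator {a..b} s * norm (f s)) \<partial>half_line)"
    by (rule integral_mono[OF integrable_norm[OF i]]) (use l(1) bd in auto)
  also have "\<dots> \<le> M * ((b - a) powr ((p - 1) / p) * hnorm p f)"
    using mult_left_mono[OF l(2) M] by simp
  finally show "norm (\<integral>s. f s * g s \<partial>half_line) \<le> M * (b - a) powr ((p - 1) / p) * hnorm p f"
    by (simp add: mult.assoc)
qed

lemma bounded_compact_support:
  fixes g :: "real \<Rightarrow> complex"
  assumes "continuous_on UNIV g" "\<And>s. s \<notin> {a..b} \<Longrightarrow> g s = 0"
  obtains M where "M \<ge> 0" "\<And>s. norm (g s) \<le> M"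
proof -
  have "bounded (g ` {a..b})"
    by (intro compact_imp_bounded compact_continuous_image continuous_on_subset[OF assms(1)]) auto
  then obtain M where M: "\<And>s. s \<in> {a..b} \<Longrightarrow> norm (g s) \<le> M" unfolding bounded_iff by blast
  have "norm (g s) \<le> \<bar>M\<bar>" for s
    using M[of s] assms(2)[of s] by (cases "s \<in> {a..b}") auto
  then show ?thesis by (intro that[of "\<bar>M\<bar>"]) auto
qed

text \<open>The weak form of the generator is obtained by moving the dilation onto the test function.\<close>

lemma lp_gen_weak:
  assumes p: "p \<ge> 1" and f: "hfun p f" and g: "hfun p g" and gen: "lp_gen p f g"
    and \<psi>: "test_fun \<psi>"
  shows "(\<integral>s. g s * \<psi> s \<partial>half_line) = (\<integral>s. f s * (\<psi> s + complex_of_real s * vderiv \<psi> s) \<partial>half_line)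
    - complex_of_real (1 / p) * (\<integral>s. f s * \<psi> s \<partial>half_line)"
proof -
  have d: "((vderiv ^^ n) \<psi> has_vector_derivative (vderiv ^^ Suc n) \<psi> t) (at t)" for n t using \<psi> by (simp add: test_fun_def)
  have d0: "(\<psi> has_vector_derivative vderiv \<psi> t) (at t)" for t using d[of 0 t] by simp
  have d1: "(vderiv \<psi> has_vector_derivative (vderiv ^^ 2) \<psi> t) (at t)" for t using d[of 1 t] by (simp add: numeral_2_eq_2)
  have cont: "continuous_on UNIV \<psi>" "continuous_on UNIV (vderiv \<psi>)"
    using has_vector_derivative_continuous[OF d0] has_vector_derivative_continuous[OF d1]
    by (auto intro!: continuous_at_imp_continuous_on)
  obtain a b where ab: "0 < a" "a \<le> b" and supp: "\<And>s. s \<notin> {a..b} \<Longrightarrow> \<psi> s = 0" using \<psi> unfolding test_fun_def by blast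
  have supp': "vderiv \<psi> s = 0" if s: "s \<notin> {a..b}" for s
  proof -
    have "((\<lambda>_. 0) has_vector_derivative vderiv \<psi> s) (at s)"
      by (rule has_vector_derivative_transform_within_open[OF d0, of "- {a..b}"]) (use s supp in auto)
    then show ?thesis using vector_derivative_at has_vector_derivative_const by (metis vector_derivative_unique_at)
  qed
  \<comment> \<open>The factor \<open>exp t\<close> from the change of variables times
    \<open>exp (- t / p)\<close> from \<open>T_grp\<close> equals
    \<open>exp (c * t)\<close>.\<close>
  define c where "c = 1 - 1 / p"
  have c: "0 \<le> c" "c \<le> 1" using p by (auto simp: c_def)
  define \<omega> where "\<omega> s = complex_of_real c * \<psi> s + complex_of_real s * vderiv \<psi> s" for s
  have c\<omega>: "continuous_on UNIV \<omega>" unfolding \<omega>_def by (intro continuous_intros cont)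
  have s\<omega>: "\<omega> s = 0" if "s \<notin> {a..b}" for s using supp[OF that] supp'[OF that] by (simp add: \<omega>_def)
  obtain M where M: "M \<ge> 0" "\<And>s. norm (\<omega> s) \<le> M" using bounded_compact_support[OF c\<omega> s\<omega>] by blast
  obtain M0 where M0: "M0 \<ge> 0" "\<And>s. norm (\<psi> s) \<le> M0" using bounded_compact_support[OF cont(1) supp] by blast
  \<comment> \<open>Moving dilations with \<open>0 \<le> t \<le> 1\<close> onto
    \<open>\<psi>\<close> spreads its support from \<open>[a, b]\<close> at most to
    \<open>[a / exp 1, b]\<close>; this interval is nondegenerate even when
    \<open>a = b\<close>.\<close>
  define a' where "a' = a * exp (- 1)"
  have a'a: "a' < a" using ab by (simp add: a'_def)
  have a': "0 < a'" "a' < b" using ab a'a by (simp add: a'_def, linarith)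
  have sub: "s \<notin> {a..b}" if "s \<notin> {a'..b}" for s using that a'a by auto
  \<comment> \<open>\<open>\<theta> s t\<close> is the adjoint of \<open>T_grp p t\<close> applied
    to \<open>\<psi>\<close>, and \<open>\<omega>\<close> is its derivative at
    \<open>t = 0\<close>.\<close>
  define \<theta> where "\<theta> s t = complex_of_real (exp (c * t)) * \<psi> (exp t * s)" for s t :: real
  have \<theta>0: "\<theta> s 0 = \<psi> s" for s by (simp add: \<theta>_def)
  have \<theta>d: "(\<theta> s has_vector_derivative complex_of_real (exp (c * t)) * \<omega> (exp t * s)) (at t within S)" for s t S
  proof -
    have "((\<lambda>t. exp t * s) has_vector_derivative exp t * s) (at t)"
      by (auto intro!: derivative_eq_intros simp: has_real_derivative_iff_has_vector_derivative[symmetric])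
    from vector_diff_chain_at[OF this, of \<psi>] d0
    have 1: "((\<lambda>t. \<psi> (exp t * s)) has_vector_derivative (exp t * s) *\<^sub>R vderiv \<psi> (exp t * s)) (at t)" by (simp add: o_def)
    have "((\<lambda>t. exp (c * t)) has_real_derivative c * exp (c * t)) (at t)"
      by (auto intro!: derivative_eq_intros)
    then have 2: "((\<lambda>t. complex_of_real (exp (c * t))) has_vector_derivative complex_of_real (c * exp (c * t))) (at t)"
      by (simp only: has_real_derivative_iff_has_vector_derivative has_vector_derivative_of_real)
    have "complex_of_real (exp (c * t)) * ((exp t * s) *\<^sub>R vderiv \<psi> (exp t * s)) + complex_of_real (c * exp (c * t)) * \<psi> (exp t * s)
        = complex_of_real (exp (c * t)) * \<omega> (exp t * s)"
      unfolding \<omega>_def scaleR_conv_of_real of_real_mult distrib_left by (simp only: mult_ac add_ac)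
    with has_vector_derivative_mult[OF 2 1]
    have "((\<lambda>t. complex_of_real (exp (c * t)) * \<psi> (exp t * s)) has_vector_derivative complex_of_real (exp (c * t)) * \<omega> (exp t * s)) (at t)"
      by (simp only:)
    then show ?thesis unfolding \<theta>_def by (rule has_vector_derivative_at_within)
  qed
  \<comment> \<open>Linear in \<open>t\<close> and uniform in \<open>s\<close>, hence a dominating
    factor for the quotients. The 3 is 2 for the linearisation error plus 1 for the linear
    part.\<close>
  have \<theta>b: "norm (\<theta> s t - \<theta> s 0) \<le> (3 * exp 1 * M) * t" if t: "0 \<le> t" "t \<le> 1" for s t
  proof -
    let ?d = "\<lambda>t. complex_of_real (exp (c * t)) * \<omega> (exp t * s)"
    have db: "norm (?d r) \<le> exp 1 * M" if "r \<in> {0..1}" for r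
    proof -
      have "c * r \<le> 1 * 1" using c that by (intro mult_mono) auto
      then show ?thesis using M(2) by (simp add: norm_mult mult_mono)
    qed
    have "norm (\<theta> s t - \<theta> s 0 - (t - 0) *\<^sub>R ?d 0) \<le> norm (t - 0) * (2 * (exp 1 * M))"
    proof (rule vector_differentiable_bound_linearization[where S = "{0..1}" and f = "\<theta> s" and f' = ?d and ?x0.0 = 0])
      show "closed_segment 0 t \<subseteq> {0..1}" using t by (simp add: closed_segment_eq_real_ivl)
      show "norm (?d r - ?d 0) \<le> 2 * (exp 1 * M)" if "r \<in> {0..1}" for r
        using norm_triangle_ineq4[of "?d r" "?d 0"] db[OF that] db[of 0] by simp
    qed (use \<theta>d in auto)
    moreover have "norm (t *\<^sub>R ?d 0) \<le> t * (exp 1 * M)"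
      unfolding norm_scaleR using t db[of 0] by (intro mult_mono) auto
    moreover have "norm (\<theta> s t - \<theta> s 0) \<le> norm (\<theta> s t - \<theta> s 0 - (t - 0) *\<^sub>R ?d 0) + norm (t *\<^sub>R ?d 0)"
      using norm_triangle_ineq[of "\<theta> s t - \<theta> s 0 - (t - 0) *\<^sub>R ?d 0" "t *\<^sub>R ?d 0"] by simp
    ultimately show ?thesis using t by (simp add: algebra_simps)
  qed
  have \<theta>s: "\<theta> s t = 0" if "0 \<le> t" "t \<le> 1" "s \<notin> {a'..b}" "s > 0" for s t
  proof -
    have "exp t * s \<notin> {a..b}"
    proof
      assume "exp t * s \<in> {a..b}"
      then have 1: "a \<le> exp t * s" "exp t * s \<le> b" by auto
      have "exp t \<le> exp 1" using that by simp
      then have "a \<le> exp 1 * s" using 1(1) mult_right_mono[of "exp t" "exp 1" s] that by linarith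
      then have "a' \<le> s" by (simp add: a'_def exp_minus field_simps)
      moreover have "1 * s \<le> exp t * s" using that by (intro mult_right_mono) auto
      then have "s \<le> b" using 1 by simp
      ultimately show False using that by simp
    qed
    then show ?thesis using supp by (simp add: \<theta>_def)
  qed
  \<comment> \<open>Dominated convergence is a statement about sequences; one null sequence of
    positive times suffices, since the limit of the quotients is already given by
    \<open>gen\<close>.\<close>
  define \<tau> where "\<tau> n = 1 / real (Suc n)" for n
  have \<tau>: "0 < \<tau> n" "\<tau> n \<le> 1" for n by (auto simp: \<tau>_def)
  have \<tau>0: "\<tau> \<longlonglongrightarrow> 0" unfolding \<tau>_def using LIMSEQ_inverse_real_of_nat by (simp add: inverse_eq_divide)
  have \<tau>at: "filterlim \<tau> (at 0) sequentially"
    using \<tau>0 \<tau>(1) by (simp add: filterlim_at less_imp_neq[THEN not_sym])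
  define q where "q n s = (T_grp p (\<tau> n) f s - f s) / complex_of_real (\<tau> n)" for n s
  have lq: "hfun p (q n)" for n
  proof -
    have "hfun p (\<lambda>s. (1 / complex_of_real (\<tau> n)) * (T_grp p (\<tau> n) f s - f s))"
      by (intro lp_fun_cmult lp_fun_diff p lp_fun_T_grp f)
    then show ?thesis by (simp add: q_def[abs_def])
  qed
  have m\<psi>: "\<psi> \<in> borel_measurable borel" "\<omega> \<in> borel_measurable borel"
    using cont c\<omega> by (auto intro: borel_measurable_continuous_onI)
  have lim1: "(\<lambda>n. \<integral>s. q n s * \<psi> s \<partial>half_line) \<longlonglongrightarrow> (\<integral>s. g s * \<psi> s \<partial>half_line)"
  proof -
    have n0: "(\<lambda>n. hnorm p (\<lambda>s. q n s - g s)) \<longlonglongrightarrow> 0"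
      using filterlim_compose[OF gen[unfolded lp_gen_def] \<tau>at] by (simp add: q_def)
    have "norm ((\<integral>s. q n s * \<psi> s \<partial>half_line) - (\<integral>s. g s * \<psi> s \<partial>half_line)) \<le> M0 * (b - a') powr ((p - 1) / p) * hnorm p (\<lambda>s. q n s - g s)" for n
    proof -
      have "(\<integral>s. q n s * \<psi> s \<partial>half_line) - (\<integral>s. g s * \<psi> s \<partial>half_line) = (\<integral>s. (q n s - g s) * \<psi> s \<partial>half_line)"
        using lp_pairing(1)[OF p a' lq m\<psi>(1) supp[OF sub] M0(2)] lp_pairing(1)[OF p a' g m\<psi>(1) supp[OF sub] M0(2)]
        by (simp add: left_diff_distrib)
      then show ?thesis using lp_pairing(2)[OF p a' lp_fun_diff[OF p lq g] m\<psi>(1) supp[OF sub] M0(2)] by simp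
    qed
    then have "(\<lambda>n. (\<integral>s. q n s * \<psi> s \<partial>half_line) - (\<integral>s. g s * \<psi> s \<partial>half_line)) \<longlonglongrightarrow> 0"
      by (intro Lim_null_comparison[OF always_eventually[OF allI] tendsto_mult_right_zero[OF n0]])
    then show ?thesis by (simp add: LIM_zero_iff)
  qed
  \<comment> \<open>The substitution of \<open>exp t * s\<close> for \<open>s\<close> transfers the
    dilation from \<open>f\<close> to \<open>\<psi>\<close>.\<close>
  have qeq: "(\<integral>s. q n s * \<psi> s \<partial>half_line) = (\<integral>s. f s * ((\<theta> s (\<tau> n) - \<theta> s 0) / complex_of_real (\<tau> n)) \<partial>half_line)" for n
  proof -
    define t where "t = \<tau> n"
    have t: "0 < t" "t \<le> 1" using \<tau> by (auto simp: t_def)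
    have i1: "integrable half_line (\<lambda>s. T_grp p t f s * \<psi> s)"
      by (rule lp_pairing(1)[OF p a' lp_fun_T_grp[OF f] m\<psi>(1) supp[OF sub] M0(2)])
    have i2: "integrable half_line (\<lambda>s. f s * \<psi> s)" by (rule lp_pairing(1)[OF p a' f m\<psi>(1) supp[OF sub] M0(2)])
    have e: "exp t * exp (- t / p) = exp (c * t)" by (simp add: c_def exp_add[symmetric] algebra_simps)
    let ?F = "\<lambda>s. T_grp p t f s * \<psi> s"
    have s1: "?F (exp t * s) = complex_of_real (exp (- t / p)) * (f s * \<psi> (exp t * s))" for s
      by (simp add: T_grp_def exp_minus mult.assoc[symmetric])
    have "(\<integral>s. T_grp p t f s * \<psi> s \<partial>half_line) = exp t *\<^sub>R (\<integral>s. ?F (exp t * s) \<partial>half_line)"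
      using integral_half_line_scale[of "exp t" ?F] by simp
    also have "\<dots> = (\<integral>s. f s * \<theta> s t \<partial>half_line)"
      unfolding s1 integral_scaleR_right[symmetric] e[symmetric] \<theta>_def
      by (rule Bochner_Integration.integral_cong) (simp_all add: scaleR_conv_of_real e[symmetric])
    finally have e1: "(\<integral>s. T_grp p t f s * \<psi> s \<partial>half_line) = (\<integral>s. f s * \<theta> s t \<partial>half_line)" .
    have "integrable half_line (\<lambda>s. ?F (exp t * s))" using i1 by (subst integrable_half_line_scale) auto
    then have "integrable half_line (\<lambda>s. exp t *\<^sub>R (complex_of_real (exp (- t / p)) * (f s * \<psi> (exp t * s))))" unfolding s1 by simp
    then have i3: "integrable half_line (\<lambda>s. f s * \<theta> s t)"
      by (rule Bochner_Integration.integrable_cong[THEN iffD1, rotated -1]) (simp_all add: scaleR_conv_of_real e[symmetric] \<theta>_def)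
    have "(\<integral>s. q n s * \<psi> s \<partial>half_line) = (\<integral>s. (T_grp p t f s * \<psi> s - f s * \<psi> s) / complex_of_real t \<partial>half_line)"
      by (rule Bochner_Integration.integral_cong) (simp_all add: q_def t_def left_diff_distrib)
    also have "\<dots> = ((\<integral>s. f s * \<theta> s t \<partial>half_line) - (\<integral>s. f s * \<psi> s \<partial>half_line)) / complex_of_real t"
      using i1 i2 by (simp add: e1)
    also have "\<dots> = (\<integral>s. (f s * \<theta> s t - f s * \<theta> s 0) / complex_of_real t \<partial>half_line)"
      using i3 i2 by (simp add: \<theta>0)
    also have "\<dots> = (\<integral>s. f s * ((\<theta> s t - \<theta> s 0) / complex_of_real t) \<partial>half_line)"
      by (rule Bochner_Integration.integral_cong) (simp_all add: right_diff_distrib)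
    finally show ?thesis by (simp add: t_def)
  qed
  have lim2: "(\<lambda>n. \<integral>s. f s * ((\<theta> s (\<tau> n) - \<theta> s 0) / complex_of_real (\<tau> n)) \<partial>half_line) \<longlonglongrightarrow> (\<integral>s. f s * \<omega> s \<partial>half_line)"
  proof (rule integral_dominated_convergence[where w = "\<lambda>s. (3 * exp 1 * M) * (indicator {a'..b} s * norm (f s))"])
    have [measurable]: "f \<in> borel_measurable half_line" using f by (simp add: lp_fun_def)
    have [measurable]: "(\<lambda>s. \<theta> s t) \<in> borel_measurable half_line" "\<omega> \<in> borel_measurable half_line" for t
    proof -
      have "continuous_on UNIV (\<lambda>s. \<theta> s t)"
        unfolding \<theta>_def by (intro continuous_intros continuous_on_compose2[OF cont(1)]) auto
      then show "(\<lambda>s. \<theta> s t) \<in> borel_measurable half_line" "\<omega> \<in> borel_measurable half_line"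
        using m\<psi> by (auto intro!: measurable_half_line_borel borel_measurable_continuous_onI)
    qed
    show "(\<lambda>s. f s * \<omega> s) \<in> borel_measurable half_line" by measurable
    show "(\<lambda>s. f s * ((\<theta> s (\<tau> n) - \<theta> s 0) / complex_of_real (\<tau> n))) \<in> borel_measurable half_line" for n by measurable
    show "integrable half_line (\<lambda>s. (3 * exp 1 * M) * (indicator {a'..b} s * norm (f s)))"
      using lp_local(1)[OF p a' f] by (rule integrable_mult_right)
    show "AE s in half_line. (\<lambda>n. f s * ((\<theta> s (\<tau> n) - \<theta> s 0) / complex_of_real (\<tau> n))) \<longlonglongrightarrow> f s * \<omega> s"
    proof (rule AE_half_line)
      fix s :: real
      have "(\<theta> s has_vector_derivative \<omega> s) (at 0)" using \<theta>d[of s 0 UNIV] by simp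
      then have "((\<lambda>h. norm (\<theta> s h - \<theta> s 0 - h *\<^sub>R \<omega> s) / norm h) \<longlongrightarrow> 0) (at 0)"
        by (simp add: has_vector_derivative_def has_derivative_at)
      moreover have "norm (\<theta> s h - \<theta> s 0 - h *\<^sub>R \<omega> s) / norm h = norm ((\<theta> s h - \<theta> s 0) / complex_of_real h - \<omega> s)" if "h \<noteq> 0" for h
      proof -
        have "(\<theta> s h - \<theta> s 0) / complex_of_real h - \<omega> s = (\<theta> s h - \<theta> s 0 - h *\<^sub>R \<omega> s) / complex_of_real h"
          using that by (simp add: scaleR_conv_of_real field_simps)
        then show ?thesis by (simp add: norm_divide)
      qed
      then have "\<forall>\<^sub>F h in at 0. norm (\<theta> s h - \<theta> s 0 - h *\<^sub>R \<omega> s) / norm h = norm ((\<theta> s h - \<theta> s 0) / complex_of_real h - \<omega> s)"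
        by (simp add: eventually_at_filter)
      ultimately have "((\<lambda>h. norm ((\<theta> s h - \<theta> s 0) / complex_of_real h - \<omega> s)) \<longlongrightarrow> 0) (at 0)"
        by (rule Lim_transform_eventually)
      then have "((\<lambda>h. (\<theta> s h - \<theta> s 0) / complex_of_real h) \<longlongrightarrow> \<omega> s) (at 0)"
        by (rule LIM_zero_cancel[OF tendsto_norm_zero_cancel])
      from filterlim_compose[OF this \<tau>at]
      have "(\<lambda>n. (\<theta> s (\<tau> n) - \<theta> s 0) / complex_of_real (\<tau> n)) \<longlonglongrightarrow> \<omega> s" .
      then show "(\<lambda>n. f s * ((\<theta> s (\<tau> n) - \<theta> s 0) / complex_of_real (\<tau> n))) \<longlonglongrightarrow> f s * \<omega> s" by (rule tendsto_mult_left)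
    qed
    show "AE s in half_line. norm (f s * ((\<theta> s (\<tau> n) - \<theta> s 0) / complex_of_real (\<tau> n))) \<le> (3 * exp 1 * M) * (indicator {a'..b} s * norm (f s))" for n
    proof (rule AE_half_line)
      fix s :: real assume s: "s > 0"
      show "norm (f s * ((\<theta> s (\<tau> n) - \<theta> s 0) / complex_of_real (\<tau> n))) \<le> (3 * exp 1 * M) * (indicator {a'..b} s * norm (f s))"
      proof (cases "s \<in> {a'..b}")
        case True
        have "norm ((\<theta> s (\<tau> n) - \<theta> s 0) / complex_of_real (\<tau> n)) = norm (\<theta> s (\<tau> n) - \<theta> s 0) / \<tau> n"
          using \<tau>[of n] by (simp add: norm_divide)
        also have "\<dots> \<le> 3 * exp 1 * M"
          using \<theta>b[of "\<tau> n" s] \<tau>[of n] by (simp add: divide_le_eq)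
        finally have "norm (f s) * norm ((\<theta> s (\<tau> n) - \<theta> s 0) / complex_of_real (\<tau> n)) \<le> norm (f s) * (3 * exp 1 * M)"
          by (rule mult_left_mono) simp
        then show ?thesis unfolding norm_mult[of "f s"] using True by (simp add: mult.commute)
      next
        case False
        then show ?thesis using \<theta>s[of "\<tau> n" s] \<theta>s[of 0 s] \<tau>[of n] s by simp
      qed
    qed
  qed
  have "(\<integral>s. g s * \<psi> s \<partial>half_line) = (\<integral>s. f s * \<omega> s \<partial>half_line)"
    using LIMSEQ_unique[OF lim1[unfolded qeq] lim2] .
  \<comment> \<open>Since \<open>c + 1 / p = 1\<close>, adding \<open>\<psi> / p\<close> to
    \<open>\<omega>\<close> gives \<open>\<psi>\<close> plus \<open>s\<close> times its derivative,
    the form in the statement.\<close>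
  also have "\<dots> = (\<integral>s. f s * (\<omega> s + complex_of_real (1 / p) * \<psi> s) - complex_of_real (1 / p) * (f s * \<psi> s) \<partial>half_line)"
    by (rule Bochner_Integration.integral_cong) (simp_all add: algebra_simps)
  also have "\<dots> = (\<integral>s. f s * (\<omega> s + complex_of_real (1 / p) * \<psi> s) \<partial>half_line) - complex_of_real (1 / p) * (\<integral>s. f s * \<psi> s \<partial>half_line)"
  proof -
    have i1: "integrable half_line (\<lambda>s. f s * \<omega> s)" by (rule lp_pairing(1)[OF p a' f m\<psi>(2) s\<omega>[OF sub] M(2)])
    have i2: "integrable half_line (\<lambda>s. f s * \<psi> s)" by (rule lp_pairing(1)[OF p a' f m\<psi>(1) supp[OF sub] M0(2)])
    have "integrable half_line (\<lambda>s. f s * \<omega> s + complex_of_real (1 / p) * (f s * \<psi> s))"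
      by (intro Bochner_Integration.integrable_add i1 integrable_mult_right i2)
    then have i3: "integrable half_line (\<lambda>s. f s * (\<omega> s + complex_of_real (1 / p) * \<psi> s))" by (simp add: algebra_simps)
    show ?thesis by (subst Bochner_Integration.integral_diff[OF i3 integrable_mult_right[OF i2]]) simp
  qed
  also have "(\<lambda>s. f s * (\<omega> s + complex_of_real (1 / p) * \<psi> s)) = (\<lambda>s. f s * (\<psi> s + complex_of_real s * vderiv \<psi> s))"
    by (auto simp: \<omega>_def c_def algebra_simps)
  finally show ?thesis .
qed

section \<open>Transfer of the group and its generator from \<open>L^p\<close>\<close>

context
  fixes p \<alpha> :: real and H
  assumes p: "p \<ge> 1" and \<alpha>: "\<alpha> \<ge> 0" and H: "rep_op p \<alpha> H" and H0: "\<alpha> = 0 \<longrightarrow> H = (\<lambda>f. f)"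
begin

lemma T_space_T_grp:
  assumes f: "f \<in> T_space \<alpha> p"
  shows "T_grp p t f \<in> T_space \<alpha> p" "T_space_norm \<alpha> p (T_grp p t f) = T_space_norm \<alpha> p f"
proof -
  obtain G where lf: "hfun p f" and G: "hfun p G" and fG: "AE s in half_line. f s = H G s"
    using f T_space_iff[OF p \<alpha> H H0] by blast
  note Tf = lp_fun_T_grp[OF lf, of t] and TG = lp_fun_T_grp[OF G, of t]
  have "AE s in half_line. T_grp p t f s = H (T_grp p t G) s"
    using T_grp_cong_AE[OF p lf rep_op_lp[OF H G] fG, of t] rep_op_T_grp[OF H G, of t] by eventually_elim simp
  then show "T_grp p t f \<in> T_space \<alpha> p" "T_space_norm \<alpha> p (T_grp p t f) = T_space_norm \<alpha> p f"
    using T_space_iff[OF p \<alpha> H H0] T_space_norm_eq[OF p \<alpha> H H0 Tf TG] T_space_norm_eq[OF p \<alpha> H H0 lf G fG] Tf TG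
    by (auto simp: lp_norm_T_grp[OF p])
qed

lemma T_space_strongly_continuous:
  assumes f: "f \<in> T_space \<alpha> p"
  shows "((\<lambda>t. T_space_norm \<alpha> p (\<lambda>s. T_grp p t f s - f s)) \<longlongrightarrow> 0) (at 0)"
proof -
  obtain G where lf: "hfun p f" and G: "hfun p G" and fG: "AE s in half_line. f s = H G s"
    using f T_space_iff[OF p \<alpha> H H0] by blast
  have "T_space_norm \<alpha> p (\<lambda>s. T_grp p t f s - f s) = hnorm p (\<lambda>s. T_grp p t G s - G s) / Gamma (\<alpha> + 1)" for t
  proof (rule T_space_norm_eq[OF p \<alpha> H H0])
    show "AE s in half_line. T_grp p t f s - f s = H (\<lambda>s. T_grp p t G s - G s) s"
      using T_grp_cong_AE[OF p lf rep_op_lp[OF H G] fG, of t] rep_op_T_grp[OF H G, of t] rep_op_diff[OF H lp_fun_T_grp[OF G, of t] G] fG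
      by eventually_elim simp
  qed (auto intro: lp_fun_diff lp_fun_T_grp p lf G)
  then show ?thesis
    using tendsto_divide_zero[OF T_grp_strongly_continuous[OF p G], of "Gamma (\<alpha> + 1)"] by simp
qed

text \<open>By \<open>rep_op_quot\<close> and \<open>T_space_norm_eq\<close> the error of the
  difference quotient at \<open>f\<close> has, up to a constant factor, the same norm as the one at
  \<open>G\<close> in \<open>L^p\<close>. So \<open>H\<close> intertwines the generators of the two
  dilation groups.\<close>

lemma is_generator_value_iff:
  assumes lf: "hfun p f" and G: "hfun p G" and fG: "AE s in half_line. f s = H G s"
  shows "is_generator_value \<alpha> p f g \<longleftrightarrow>
    hfun p g \<and> (\<exists>Q. hfun p Q \<and> (AE s in half_line. g s = H Q s) \<and> lp_gen p G Q)"
proof -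
  have Gpos: "Gamma (\<alpha> + 1) > 0" using \<alpha> by (intro Gamma_real_pos) simp
  have *: "((\<lambda>t. T_space_norm \<alpha> p (\<lambda>s. (T_grp p t f s - f s) / complex_of_real t - g s)) \<longlongrightarrow> 0) (at 0) \<longleftrightarrow> lp_gen p G Q"
    if lg: "hfun p g" and Q: "hfun p Q" and gQ: "AE s in half_line. g s = H Q s" for Q
  proof -
    have "T_space_norm \<alpha> p (\<lambda>s. (T_grp p t f s - f s) / complex_of_real t - g s) = 
        hnorm p (\<lambda>s. (T_grp p t G s - G s) / complex_of_real t - Q s) / Gamma (\<alpha> + 1)" for t
      by (rule T_space_norm_eq[OF p \<alpha> H H0 lp_fun_quot[OF p lf lg] lp_fun_quot[OF p G Q] rep_op_quot[OF p H G Q lf fG gQ]])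
    then show ?thesis
      unfolding lp_gen_def using Gpos tendsto_mult_right_iff[of "1 / Gamma (\<alpha> + 1)" _ 0 "at (0::real)"]
      by (simp add: divide_inverse)
  qed
  show ?thesis
    unfolding is_generator_value_def T_space_iff[OF p \<alpha> H H0] using * by blast
qed

text \<open>Order \<open>\<alpha> + 1\<close> is represented by \<open>H\<close> after the
  resolvent, so the claim is that the generator on \<open>L^p\<close> has the range of the resolvent
  as its domain: \<open>lp_gen_imp_res\<close> gives one inclusion, \<open>lp_gen_res\<close> the
  other.\<close>

lemma generator_domain: "{f \<in> T_space \<alpha> p. \<exists>g. is_generator_value \<alpha> p f g} = T_space (\<alpha> + 1) p"
proof -
  let ?R = "kop (res_ker \<alpha>)"
  note lpR = kop_bounded(2)[OF p kern_res_ker[OF p \<alpha>]]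
  have a1: "\<alpha> + 1 \<ge> 0" "\<alpha> + 1 = 0 \<longrightarrow> (\<lambda>f. H (?R f)) = (\<lambda>f. f)" using \<alpha> by auto
  note T1 = T_space_iff[OF p a1(1) rep_op_Suc[OF p \<alpha> H] a1(2)]
  show ?thesis
  proof (intro set_eqI iffI)
    fix f assume "f \<in> {f \<in> T_space \<alpha> p. \<exists>g. is_generator_value \<alpha> p f g}"
    then obtain g G where gen: "is_generator_value \<alpha> p f g" and lf: "hfun p f" and G: "hfun p G" and fG: "AE s in half_line. f s = H G s"
      using T_space_iff[OF p \<alpha> H H0] by blast
    then obtain Q where Q: "hfun p Q" "lp_gen p G Q"
      using is_generator_value_iff[OF lf G fG] by blast
    \<comment> \<open>The image of \<open>G\<close> under the generator plus
      \<open>\<alpha> + 1 / p\<close>, whose inverse is \<open>?R\<close>.\<close>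
    let ?K = "\<lambda>s. Q s + complex_of_real (\<alpha> + 1 / p) * G s"
    have K: "hfun p ?K" by (intro lp_fun_add lp_fun_cmult p Q G)
    have "AE s in half_line. G s = ?R ?K s"
      using lp_gen_imp_res[OF p \<alpha> G Q] lp_norm_diff_eq_0_iff[OF p G lpR[OF K]] by simp
    then have "AE s in half_line. H G s = H (?R ?K) s" by (rule rep_op_cong_AE[OF p H G lpR[OF K]])
    with fG have "AE s in half_line. f s = H (?R ?K) s" by eventually_elim simp
    then show "f \<in> T_space (\<alpha> + 1) p" using T1 lf K by blast
  next
    fix f assume "f \<in> T_space (\<alpha> + 1) p"
    then obtain K where lf: "hfun p f" and K: "hfun p K" and fK: "AE s in half_line. f s = H (?R K) s"
      using T1 by blast
    let ?Q = "\<lambda>s. K s - complex_of_real (\<alpha> + 1 / p) * ?R K s"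
    have Q: "hfun p ?Q" by (intro lp_fun_diff lp_fun_cmult p K lpR)
    have "is_generator_value \<alpha> p f (H ?Q)"
      unfolding is_generator_value_iff[OF lf lpR[OF K] fK]
      using rep_op_lp[OF H Q] Q lp_gen_res[OF p \<alpha> K] by (intro conjI exI[of _ ?Q]) auto
    then show "f \<in> {f \<in> T_space \<alpha> p. \<exists>g. is_generator_value \<alpha> p f g}"
      using T_space_iff[OF p \<alpha> H H0] lf fK lpR[OF K] by blast
  qed
qed

text \<open>The embedding into \<open>L^p\<close> is bounded, so a generator value in the finer norm
  is also one in \<open>L^p\<close>. This reduces the weak formula to \<open>L^p\<close>.\<close>

lemma generator_lp_gen:
  assumes f: "f \<in> T_space \<alpha> p" and gen: "is_generator_value \<alpha> p f g"
  shows "hfun p f" "hfun p g" "lp_gen p f g"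
proof -
  obtain G where lf: "hfun p f" and G: "hfun p G" and fG: "AE s in half_line. f s = H G s"
    using f T_space_iff[OF p \<alpha> H H0] by blast
  obtain Q where lg: "hfun p g" and Q: "hfun p Q" and gQ: "AE s in half_line. g s = H Q s" and GQ: "lp_gen p G Q"
    using gen is_generator_value_iff[OF lf G fG] by blast
  obtain B where B: "B \<ge> 0" "\<And>f. hfun p f \<Longrightarrow> hnorm p (H f) \<le> B * hnorm p f"
    using rep_op_bounded[OF H] by blast
  show "hfun p f" "hfun p g" by fact+
  show "lp_gen p f g"
    unfolding lp_gen_def
  proof (rule tendsto_sandwich[OF _ _ tendsto_const])
    show "((\<lambda>t. B * hnorm p (\<lambda>s. (T_grp p t G s - G s) / complex_of_real t - Q s)) \<longlongrightarrow> 0) (at 0)"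
      by (rule tendsto_mult_right_zero[OF GQ[unfolded lp_gen_def]])
    have "hnorm p (\<lambda>s. (T_grp p t f s - f s) / complex_of_real t - g s) \<le> B * hnorm p (\<lambda>s. (T_grp p t G s - G s) / complex_of_real t - Q s)" for t
    proof -
      note q = lp_fun_quot[OF p G Q, of t]
      have "hnorm p (\<lambda>s. (T_grp p t f s - f s) / complex_of_real t - g s) = hnorm p (H (\<lambda>s. (T_grp p t G s - G s) / complex_of_real t - Q s))"
        using rep_op_quot[OF p H G Q lf fG gQ, of t] lp_fun_quot[OF p lf lg, of t] rep_op_lp[OF H q]
        by (intro lp_norm_cong_AE) (auto simp: lp_fun_def)
      then show ?thesis using B(2)[OF q] by simp
    qed
    then show "\<forall>\<^sub>F t in at 0. hnorm p (\<lambda>s. (T_grp p t f s - f s) / complex_of_real t - g s) \<le> B * hnorm p (\<lambda>s. (T_grp p t G s - G s) / complex_of_real t - Q s)"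
      by simp
  qed simp
qed

end

lemma T_grp_0: "T_grp p 0 f = f"
  by (simp add: T_grp_def)

lemma T_grp_add: "T_grp p (t + u) f = T_grp p t (T_grp p u f)"
proof
  fix s
  have "exp (- (t + u) / p) = exp (- t / p) * exp (- u / p)" by (simp add: exp_add[symmetric] add_divide_distrib diff_divide_distrib)
  moreover have "exp (- (t + u)) * s = exp (- u) * (exp (- t) * s)" by (simp add: exp_add[symmetric] mult.assoc[symmetric] add.commute)
  ultimately show "T_grp p (t + u) f s = T_grp p t (T_grp p u f) s"
    unfolding T_grp_def by (simp only: of_real_mult mult.assoc)
qed

theorem theorem2p5:
  fixes p \<alpha> :: real
  assumes "p \<ge> 1" and "\<alpha> \<ge> 0"
  shows "(\<forall>t f. f \<in> T_space \<alpha> p \<longrightarrow>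
              T_grp p t f \<in> T_space \<alpha> p \<and> T_space_norm \<alpha> p (T_grp p t f) = T_space_norm \<alpha> p f)
       \<and> (\<forall>f. T_grp p 0 f = f)
       \<and> (\<forall>t u f. T_grp p (t + u) f = T_grp p t (T_grp p u f))
       \<and> (\<forall>f \<in> T_space \<alpha> p.
              ((\<lambda>t. T_space_norm \<alpha> p (\<lambda>s. T_grp p t f s - f s)) \<longlongrightarrow> 0) (at 0))
       \<and> {f \<in> T_space \<alpha> p. \<exists>g. is_generator_value \<alpha> p f g} = T_space (\<alpha> + 1) p
       \<and> (\<forall>f g. f \<in> T_space \<alpha> p \<longrightarrow> is_generator_value \<alpha> p f g \<longrightarrow>
              (\<forall>\<psi>. test_fun \<psi> \<longrightarrow>
                 (LINT s:{0<..}|lborel. g s * \<psi> s) =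
                 (LINT s:{0<..}|lborel. f s * (\<psi> s + complex_of_real s * vderiv \<psi> s))
                 - complex_of_real (1 / p) * (LINT s:{0<..}|lborel. f s * \<psi> s)))"
proof -
  \<comment> \<open>At order 0 the identity is chosen explicitly, as the description of
    \<open>T_space\<close> requires; for positive orders any representing operator will do.\<close>
  have "\<exists>H. rep_op p \<alpha> H \<and> (\<alpha> = 0 \<longrightarrow> H = (\<lambda>f. f))"
    using rep_op_0[OF assms(1)] rep_op_exists[OF assms] by (cases "\<alpha> = 0") auto
  then obtain H where H: "rep_op p \<alpha> H" "\<alpha> = 0 \<longrightarrow> H = (\<lambda>f. f)" by blast
  note ctx = assms H
  have weak: "(LINT s:{0<..}|lborel. g s * \<psi> s) =
                 (LINT s:{0<..}|lborel. f s * (\<psi> s + complex_of_real s * vderiv \<psi> s))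
                 - complex_of_real (1 / p) * (LINT s:{0<..}|lborel. f s * \<psi> s)"
    if "f \<in> T_space \<alpha> p" "is_generator_value \<alpha> p f g" and \<psi>: "test_fun \<psi>" for f g \<psi>
    using lp_gen_weak[OF assms(1) generator_lp_gen[OF ctx that(1,2)] \<psi>] unfolding integral_half_line .
  show ?thesis
    by (intro conjI allI impI ballI T_space_T_grp[OF ctx] T_grp_0 T_grp_add
        T_space_strongly_continuous[OF ctx] generator_domain[OF ctx] weak)
qed

end
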